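(* There is an algorithm which, given $W$ as in the context, a basic point $x^I$ together with its basis $I$, and an index $k\in I$ such that $\mathcal E_{I\setminus\{k\}}$ is a tropical edge, returns the other basic point $x^{I'}$ of the tropical edge $\mathcal E_{I\setminus\{k\}}$ together with the index $i\notin I$ such that $I'=(I\setminus\{k\})\cup\{i\}$, in time $O(n(m+n))$ and space $O(nm)$ (counting each arithmetic operation or comparison in $\mathbb{T}$ as $O(1)$).
   Context: $\mathbb{T}=\mathbb{R}\cup\{-\infty\}$. Signed tropical numbers $\mathbb{T}_{\pm}$: positive numbers $a$ and negative numbers $\ominus a$, $-\infty=\ominus(-\infty)$; modulus $|a|=|\ominus a|=a$; positive part $w^+=|w|$ if $w$ positive else $-\infty$; negative part $w^-=|w|$ if negative else $-\infty$. $\operatorname{tper}(M)=\max_\sigma\sum_im_{i\sigma(i)}$; $M$ tropically singular if $\operatorname{tper}(M)=-\infty$ or the maximum is attained twice; signed square $M$ tropically sign singular if $\operatorname{tper}(|M|)=-\infty$ or two maximizing permutations $\sigma,\pi$ give $\operatorname{sgn}(\sigma)\prod\operatorname{sign}(m_{i\sigma(i)})=-\operatorname{sgn}(\pi)\prod\operatorname{sign}(m_{i\pi(i)})$. Setting: $A\in\mathbb{T}_{\pm}^{m\times n}$, $b\in\mathbb{T}_{\pm}^m$, $W=(A\ b)=(w_{ij})$, $W_i^\pm\odot x=\max_j(w^\pm_{ij}+x_j)$. Assumptions: each row of $W$ has an entry $\neq-\infty$; $W$ tropically generic (every square submatrix $U$ has $\operatorname{tper}(|U|)=-\infty$ or $|U|$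 not tropically singular); every point of $\mathcal C=\{x\in\mathbb{T}^{n+1}:W_i^+\odot x\ge W_i^-\odot x\ \forall i\}$ other than $(-\infty,\dots,-\infty)$ has finite coordinates. Points up to adding a common real constant. $\mathcal H_i=\{x:W_i^+\odot x=W_i^-\odot x\}$, $\mathcal C_I=\bigcap_{i\in I}\mathcal H_i\cap\mathcal C$. Basic point $x^I$ for basis $I$ ($|I|=n$, $\operatorname{tper}(|A_I|)>-\infty$): the unique nonzero point of $\mathcal C_I$ when it exists. Tropical edge: $\mathcal E_K=\mathcal C_K$ for $|K|=n-1$ with some $(n-1)\times(n-1)$ submatrix of $A_K$ not tropically sign singular and $\mathcal C_K$ containing a nonzero point; $\mathcal E_{I\setminus\{k\}}$ contains $x^I$ and exactly one other basic point $x^{I'}$, with $I'=(I\setminus\{k\})\cup\{i\}$. *)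

theory Defs
  imports Complex_Main "HOL-Combinatorics.Permutations"
begin

section \<open>Tropical numbers and signed tropical numbers\<close>

datatype trop = NegInf | Fin real

instantiation trop :: linorder
begin

fun less_eq_trop :: "trop \<Rightarrow> trop \<Rightarrow> bool" where
  "NegInf \<le> y \<longleftrightarrow> True"
| "Fin a \<le> NegInf \<longleftrightarrow> False"
| "Fin a \<le> Fin b \<longleftrightarrow> a \<le> b"

definition less_trop :: "trop \<Rightarrow> trop \<Rightarrow> bool" where
  "x < y \<longleftrightarrow> x \<le> y \<and> \<not> y \<le> (x :: trop)"

instance
proof
  fix x y z :: trop
  show "x < y \<longleftrightarrow> x \<le> y \<and> \<not> y \<le> x" by (rule less_trop_def)
  show "x \<le> x" by (cases x) auto
  show "x \<le> y \<Longrightarrow> y \<le> z \<Longrightarrow> x \<le> z" by (cases x; cases y; cases z) auto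
  show "x \<le> y \<Longrightarrow> y \<le> x \<Longrightarrow> x = y" by (cases x; cases y) auto
  show "x \<le> y \<or> y \<le> x" by (cases x; cases y) auto
qed

end

text \<open>The class operations \<open>+\<close> and \<open>0\<close> are ordinary addition (tropical multiplication) and its
  unit; tropical addition is \<open>max\<close>.\<close>

instantiation trop :: comm_monoid_add
begin

definition zero_trop :: trop where "0 = Fin 0"

fun plus_trop :: "trop \<Rightarrow> trop \<Rightarrow> trop" where
  "Fin a + Fin b = Fin (a + b)"
| "NegInf + y = NegInf"
| "Fin a + NegInf = NegInf"

instance
proof
  fix x y z :: trop
  show "x + y + z = x + (y + z)" by (cases x; cases y; cases z) auto
  show "x + y = y + x" by (cases x; cases y) auto
  show "0 + x = x" by (cases x) (auto simp: zero_trop_def)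
qed

end

text \<open>Having a single constructor for \<open>-\<infinity>\<close> builds in the identification of
  \<open>-\<infinity>\<close> with \<open>\<ominus>(-\<infinity>)\<close>.\<close>

datatype strop = SNegInf | Pos real | Neg real

fun modulus :: "strop \<Rightarrow> trop" where
  "modulus SNegInf = NegInf"
| "modulus (Pos a) = Fin a"
| "modulus (Neg a) = Fin a"

fun pos_part :: "strop \<Rightarrow> trop" where
  "pos_part (Pos a) = Fin a"
| "pos_part _ = NegInf"

fun neg_part :: "strop \<Rightarrow> trop" where
  "neg_part (Neg a) = Fin a"
| "neg_part _ = NegInf"

fun strop_sign :: "strop \<Rightarrow> int" where
  "strop_sign SNegInf = 0"
| "strop_sign (Pos a) = 1"
| "strop_sign (Neg a) = -1"

section \<open>Tropical permanents and singularity\<close>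

text \<open>A \<open>k \<times> k\<close> matrix is a function of two indices, of which only the values at indices
  below \<open>k\<close> are relevant.\<close>

definition perm_weight :: "nat \<Rightarrow> (nat \<Rightarrow> nat \<Rightarrow> trop) \<Rightarrow> (nat \<Rightarrow> nat) \<Rightarrow> trop" where
  "perm_weight k M \<sigma> = (\<Sum>i<k. M i (\<sigma> i))"

definition tper :: "nat \<Rightarrow> (nat \<Rightarrow> nat \<Rightarrow> trop) \<Rightarrow> trop" where
  "tper k M = Max (perm_weight k M ` {\<sigma>. \<sigma> permutes {..<k}})"

definition max_perms :: "nat \<Rightarrow> (nat \<Rightarrow> nat \<Rightarrow> trop) \<Rightarrow> (nat \<Rightarrow> nat) set" where
  "max_perms k M = {\<sigma>. \<sigma> permutes {..<k} \<and> perm_weight k M \<sigma> = tper k M}"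

definition trop_singular :: "nat \<Rightarrow> (nat \<Rightarrow> nat \<Rightarrow> trop) \<Rightarrow> bool" where
  "trop_singular k M \<longleftrightarrow>
     tper k M = NegInf \<or> (\<exists>\<sigma>\<in>max_perms k M. \<exists>\<pi>\<in>max_perms k M. \<sigma> \<noteq> \<pi>)"

definition mod_mat :: "(nat \<Rightarrow> nat \<Rightarrow> strop) \<Rightarrow> nat \<Rightarrow> nat \<Rightarrow> trop" where
  "mod_mat M i j = modulus (M i j)"

definition perm_sign :: "nat \<Rightarrow> (nat \<Rightarrow> nat \<Rightarrow> strop) \<Rightarrow> (nat \<Rightarrow> nat) \<Rightarrow> int" where
  "perm_sign k M \<sigma> = sign \<sigma> * (\<Prod>i<k. strop_sign (M i (\<sigma> i)))"

definition trop_sign_singular :: "nat \<Rightarrow> (nat \<Rightarrow> nat \<Rightarrow> strop) \<Rightarrow> bool" where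
  "trop_sign_singular k M \<longleftrightarrow>
     tper k (mod_mat M) = NegInf \<or>
     (\<exists>\<sigma>\<in>max_perms k (mod_mat M). \<exists>\<pi>\<in>max_perms k (mod_mat M).
        perm_sign k M \<sigma> = - perm_sign k M \<pi>)"

definition submat :: "(nat \<Rightarrow> nat \<Rightarrow> 'a) \<Rightarrow> nat set \<Rightarrow> nat set \<Rightarrow> nat \<Rightarrow> nat \<Rightarrow> 'a" where
  "submat W R S i j = W (sorted_list_of_set R ! i) (sorted_list_of_set S ! j)"

section \<open>The tropical cone, basic points and tropical edges\<close>

text \<open>The matrix \<open>W = (A b)\<close> has rows \<open>0, \<dots>, m - 1\<close> and columns \<open>0, \<dots>, n\<close>; the columns
  below \<open>n\<close> form \<open>A\<close> and column \<open>n\<close> is \<open>b\<close>. A point of \<open>\<T>\<^sup>n\<^sup>+\<^sup>1\<close> is a function of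
  which only the values at \<open>0, \<dots>, n\<close> are relevant.\<close>

definition row_pos :: "nat \<Rightarrow> (nat \<Rightarrow> nat \<Rightarrow> strop) \<Rightarrow> nat \<Rightarrow> (nat \<Rightarrow> trop) \<Rightarrow> trop" where
  "row_pos n W i x = Max ((\<lambda>j. pos_part (W i j) + x j) ` {..n})"

definition row_neg :: "nat \<Rightarrow> (nat \<Rightarrow> nat \<Rightarrow> strop) \<Rightarrow> nat \<Rightarrow> (nat \<Rightarrow> trop) \<Rightarrow> trop" where
  "row_neg n W i x = Max ((\<lambda>j. neg_part (W i j) + x j) ` {..n})"

definition trop_cone :: "nat \<Rightarrow> nat \<Rightarrow> (nat \<Rightarrow> nat \<Rightarrow> strop) \<Rightarrow> (nat \<Rightarrow> trop) set" where
  "trop_cone m n W = {x. \<forall>i<m. row_pos n W i x \<ge> row_neg n W i x}"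

definition trop_hyperplane :: "nat \<Rightarrow> (nat \<Rightarrow> nat \<Rightarrow> strop) \<Rightarrow> nat \<Rightarrow> (nat \<Rightarrow> trop) set" where
  "trop_hyperplane n W i = {x. row_pos n W i x = row_neg n W i x}"

definition trop_face ::
  "nat \<Rightarrow> nat \<Rightarrow> (nat \<Rightarrow> nat \<Rightarrow> strop) \<Rightarrow> nat set \<Rightarrow> (nat \<Rightarrow> trop) set" where
  "trop_face m n W I = (\<Inter>i\<in>I. trop_hyperplane n W i) \<inter> trop_cone m n W"

definition nonzero_point :: "nat \<Rightarrow> (nat \<Rightarrow> trop) \<Rightarrow> bool" where
  "nonzero_point n x \<longleftrightarrow> (\<exists>j\<le>n. x j \<noteq> NegInf)"

definition same_point :: "nat \<Rightarrow> (nat \<Rightarrow> trop) \<Rightarrow> (nat \<Rightarrow> trop) \<Rightarrow> bool" where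
  "same_point n x y \<longleftrightarrow> (\<exists>c::real. \<forall>j\<le>n. y j = x j + Fin c)"

definition trop_generic :: "nat \<Rightarrow> nat \<Rightarrow> (nat \<Rightarrow> nat \<Rightarrow> strop) \<Rightarrow> bool" where
  "trop_generic m n W \<longleftrightarrow>
     (\<forall>R S. R \<subseteq> {..<m} \<and> S \<subseteq> {..n} \<and> card R = card S \<longrightarrow>
        tper (card R) (mod_mat (submat W R S)) = NegInf \<or>
        \<not> trop_singular (card R) (mod_mat (submat W R S)))"

definition admissible :: "nat \<Rightarrow> nat \<Rightarrow> (nat \<Rightarrow> nat \<Rightarrow> strop) \<Rightarrow> bool" where
  "admissible m n W \<longleftrightarrow>
     (\<forall>i<m. \<exists>j\<le>n. W i j \<noteq> SNegInf) \<and>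
     trop_generic m n W \<and>
     (\<forall>x\<in>trop_cone m n W. nonzero_point n x \<longrightarrow> (\<forall>j\<le>n. x j \<noteq> NegInf))"

definition is_basis :: "nat \<Rightarrow> nat \<Rightarrow> (nat \<Rightarrow> nat \<Rightarrow> strop) \<Rightarrow> nat set \<Rightarrow> bool" where
  "is_basis m n W I \<longleftrightarrow>
     I \<subseteq> {..<m} \<and> card I = n \<and> tper n (mod_mat (submat W I {..<n})) > NegInf"

definition basic_point ::
  "nat \<Rightarrow> nat \<Rightarrow> (nat \<Rightarrow> nat \<Rightarrow> strop) \<Rightarrow> nat set \<Rightarrow> (nat \<Rightarrow> trop) \<Rightarrow> bool" where
  "basic_point m n W I x \<longleftrightarrow>
     is_basis m n W I \<and> x \<in> trop_face m n W I \<and> nonzero_point n x \<and>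
     (\<forall>y\<in>trop_face m n W I. nonzero_point n y \<longrightarrow> same_point n x y)"

definition is_trop_edge :: "nat \<Rightarrow> nat \<Rightarrow> (nat \<Rightarrow> nat \<Rightarrow> strop) \<Rightarrow> nat set \<Rightarrow> bool" where
  "is_trop_edge m n W K \<longleftrightarrow>
     K \<subseteq> {..<m} \<and> Suc (card K) = n \<and>
     (\<exists>S \<subseteq> {..<n}. card S = card K \<and> \<not> trop_sign_singular (card K) (submat W K S)) \<and>
     (\<exists>x\<in>trop_face m n W K. nonzero_point n x)"

text \<open>\<open>y\<close> is the one basic point of the edge \<open>K\<close> that differs from \<open>x\<close>.\<close>

definition other_basic_point ::
  "nat \<Rightarrow> nat \<Rightarrow> (nat \<Rightarrow> nat \<Rightarrow> strop) \<Rightarrow> nat set \<Rightarrow> (nat \<Rightarrow> trop) \<Rightarrow> (nat \<Rightarrow> trop) \<Rightarrow> bool" where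
  "other_basic_point m n W K x y \<longleftrightarrow>
     (\<exists>J. basic_point m n W J y) \<and> y \<in> trop_face m n W K \<and> \<not> same_point n x y \<and>
     (\<forall>J z. basic_point m n W J z \<and> z \<in> trop_face m n W K \<longrightarrow>
        same_point n x z \<or> same_point n y z)"

section \<open>Random access programs over tropical numbers\<close>

text \<open>Programs work on two kinds of one-way infinite arrays: arrays of natural numbers, used for
  indices, flags and control flow, and arrays of tropical numbers. A program mentions only finitely
  many arrays, each by a fixed number. Tropical numbers are opaque: they can only be copied, added,
  subtracted and compared, and \<open>-\<infinity>\<close> and \<open>0\<close> are the only tropical constants. Every
  operation, comparison and memory access takes one unit of time.

  A unit-cost machine on unbounded natural numbers could pack a whole array into a single cell.
  Execution is therefore relative to a word bound \<open>B\<close>: no natural number above \<open>B\<close> may arise,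
  not even as an intermediate result or an address; a run in which one arises has no outcome.\<close>

record state =
  nmem :: "nat \<Rightarrow> nat \<Rightarrow> nat"
  tmem :: "nat \<Rightarrow> nat \<Rightarrow> trop"

datatype cell = NCell nat nat | TCell nat nat

datatype nexp =
    NLit nat
  | NGet nat nexp
  | NAdd nexp nexp
  | NSub nexp nexp
  | NMul nexp nexp

datatype texp =
    TNegInf
  | TZero
  | TGet nat nexp
  | TAdd texp texp
  | TSub texp texp

datatype bexp =
    NLe nexp nexp
  | TLe texp texp
  | BNot bexp
  | BAnd bexp bexp

datatype com =
    Skip
  | NPut nat nexp nexp
  | TPut nat nexp texp
  | Seq com com
  | Cond bexp com com
  | While bexp com

text \<open>The value of \<open>x - (-\<infinity>)\<close> is immaterial and set to \<open>-\<infinity>\<close>.\<close>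

fun trop_diff :: "trop \<Rightarrow> trop \<Rightarrow> trop" where
  "trop_diff (Fin a) (Fin b) = Fin (a - b)"
| "trop_diff _ _ = NegInf"

fun nval :: "state \<Rightarrow> nexp \<Rightarrow> nat" where
  "nval s (NLit c) = c"
| "nval s (NGet r a) = nmem s r (nval s a)"
| "nval s (NAdd d e) = nval s d + nval s e"
| "nval s (NSub d e) = nval s d - nval s e"
| "nval s (NMul d e) = nval s d * nval s e"

fun tval :: "state \<Rightarrow> texp \<Rightarrow> trop" where
  "tval s TNegInf = NegInf"
| "tval s TZero = 0"
| "tval s (TGet r a) = tmem s r (nval s a)"
| "tval s (TAdd d e) = tval s d + tval s e"
| "tval s (TSub d e) = trop_diff (tval s d) (tval s e)"

fun bval :: "state \<Rightarrow> bexp \<Rightarrow> bool" where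
  "bval s (NLe d e) \<longleftrightarrow> nval s d \<le> nval s e"
| "bval s (TLe d e) \<longleftrightarrow> tval s d \<le> tval s e"
| "bval s (BNot b) \<longleftrightarrow> \<not> bval s b"
| "bval s (BAnd b c) \<longleftrightarrow> bval s b \<and> bval s c"

fun ncost :: "nexp \<Rightarrow> nat" where
  "ncost (NLit c) = 1"
| "ncost (NGet r a) = 1 + ncost a"
| "ncost (NAdd d e) = 1 + ncost d + ncost e"
| "ncost (NSub d e) = 1 + ncost d + ncost e"
| "ncost (NMul d e) = 1 + ncost d + ncost e"

fun tcost :: "texp \<Rightarrow> nat" where
  "tcost TNegInf = 1"
| "tcost TZero = 1"
| "tcost (TGet r a) = 1 + ncost a"
| "tcost (TAdd d e) = 1 + tcost d + tcost e"
| "tcost (TSub d e) = 1 + tcost d + tcost e"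

fun bcost :: "bexp \<Rightarrow> nat" where
  "bcost (NLe d e) = 1 + ncost d + ncost e"
| "bcost (TLe d e) = 1 + tcost d + tcost e"
| "bcost (BNot b) = 1 + bcost b"
| "bcost (BAnd b c) = 1 + bcost b + bcost c"

text \<open>The memory cells read during the evaluation of an expression.\<close>

fun ncells :: "state \<Rightarrow> nexp \<Rightarrow> cell set" where
  "ncells s (NLit c) = {}"
| "ncells s (NGet r a) = insert (NCell r (nval s a)) (ncells s a)"
| "ncells s (NAdd d e) = ncells s d \<union> ncells s e"
| "ncells s (NSub d e) = ncells s d \<union> ncells s e"
| "ncells s (NMul d e) = ncells s d \<union> ncells s e"

fun tcells :: "state \<Rightarrow> texp \<Rightarrow> cell set" where
  "tcells s TNegInf = {}"
| "tcells s TZero = {}"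
| "tcells s (TGet r a) = insert (TCell r (nval s a)) (ncells s a)"
| "tcells s (TAdd d e) = tcells s d \<union> tcells s e"
| "tcells s (TSub d e) = tcells s d \<union> tcells s e"

fun bcells :: "state \<Rightarrow> bexp \<Rightarrow> cell set" where
  "bcells s (NLe d e) = ncells s d \<union> ncells s e"
| "bcells s (TLe d e) = tcells s d \<union> tcells s e"
| "bcells s (BNot b) = bcells s b"
| "bcells s (BAnd b c) = bcells s b \<union> bcells s c"

text \<open>All natural numbers arising during the evaluation of an expression are at most \<open>B\<close>.\<close>

fun nfits :: "nat \<Rightarrow> state \<Rightarrow> nexp \<Rightarrow> bool" where
  "nfits B s (NLit c) \<longleftrightarrow> c \<le> B"
| "nfits B s (NGet r a) \<longleftrightarrow> nfits B s a \<and> nval s (NGet r a) \<le> B"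
| "nfits B s (NAdd d e) \<longleftrightarrow> nfits B s d \<and> nfits B s e \<and> nval s (NAdd d e) \<le> B"
| "nfits B s (NSub d e) \<longleftrightarrow> nfits B s d \<and> nfits B s e \<and> nval s (NSub d e) \<le> B"
| "nfits B s (NMul d e) \<longleftrightarrow> nfits B s d \<and> nfits B s e \<and> nval s (NMul d e) \<le> B"

fun tfits :: "nat \<Rightarrow> state \<Rightarrow> texp \<Rightarrow> bool" where
  "tfits B s TNegInf \<longleftrightarrow> True"
| "tfits B s TZero \<longleftrightarrow> True"
| "tfits B s (TGet r a) \<longleftrightarrow> nfits B s a"
| "tfits B s (TAdd d e) \<longleftrightarrow> tfits B s d \<and> tfits B s e"
| "tfits B s (TSub d e) \<longleftrightarrow> tfits B s d \<and> tfits B s e"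

fun bfits :: "nat \<Rightarrow> state \<Rightarrow> bexp \<Rightarrow> bool" where
  "bfits B s (NLe d e) \<longleftrightarrow> nfits B s d \<and> nfits B s e"
| "bfits B s (TLe d e) \<longleftrightarrow> tfits B s d \<and> tfits B s e"
| "bfits B s (BNot b) \<longleftrightarrow> bfits B s b"
| "bfits B s (BAnd b c) \<longleftrightarrow> bfits B s b \<and> bfits B s c"

definition nput :: "nat \<Rightarrow> nat \<Rightarrow> nat \<Rightarrow> state \<Rightarrow> state" where
  "nput r a v s = s\<lparr>nmem := (nmem s)(r := (nmem s r)(a := v))\<rparr>"

definition tput :: "nat \<Rightarrow> nat \<Rightarrow> trop \<Rightarrow> state \<Rightarrow> state" where
  "tput r a v s = s\<lparr>tmem := (tmem s)(r := (tmem s r)(a := v))\<rparr>"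

text \<open>\<open>exec B c s t S s'\<close>: with word bound \<open>B\<close>, program \<open>c\<close> started in \<open>s\<close> halts in \<open>s'\<close> after
  \<open>t\<close> time units, and \<open>S\<close> is the set of all memory cells read or written on the way.\<close>

inductive exec :: "nat \<Rightarrow> com \<Rightarrow> state \<Rightarrow> nat \<Rightarrow> cell set \<Rightarrow> state \<Rightarrow> bool" for B :: nat where
  exec_Skip: "exec B Skip s 1 {} s"
| exec_NPut: "nfits B s a \<Longrightarrow> nfits B s e \<Longrightarrow>
    exec B (NPut r a e) s (1 + ncost a + ncost e)
      (insert (NCell r (nval s a)) (ncells s a \<union> ncells s e)) (nput r (nval s a) (nval s e) s)"
| exec_TPut: "nfits B s a \<Longrightarrow> tfits B s e \<Longrightarrow>
    exec B (TPut r a e) s (1 + ncost a + tcost e)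
      (insert (TCell r (nval s a)) (ncells s a \<union> tcells s e)) (tput r (nval s a) (tval s e) s)"
| exec_Seq: "exec B c s t S s' \<Longrightarrow> exec B d s' t' S' s'' \<Longrightarrow>
    exec B (Seq c d) s (t + t') (S \<union> S') s''"
| exec_Cond_True: "bfits B s b \<Longrightarrow> bval s b \<Longrightarrow> exec B c s t S s' \<Longrightarrow>
    exec B (Cond b c d) s (1 + bcost b + t) (bcells s b \<union> S) s'"
| exec_Cond_False: "bfits B s b \<Longrightarrow> \<not> bval s b \<Longrightarrow> exec B d s t S s' \<Longrightarrow>
    exec B (Cond b c d) s (1 + bcost b + t) (bcells s b \<union> S) s'"
| exec_While_False: "bfits B s b \<Longrightarrow> \<not> bval s b \<Longrightarrow>
    exec B (While b c) s (1 + bcost b) (bcells s b) s"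
| exec_While_True: "bfits B s b \<Longrightarrow> bval s b \<Longrightarrow> exec B c s t S s' \<Longrightarrow>
    exec B (While b c) s' t' S' s'' \<Longrightarrow>
    exec B (While b c) s (1 + bcost b + t + t') (bcells s b \<union> S \<union> S') s''"

lemma exec_deterministic:
  "exec B c s t S s' \<Longrightarrow> exec B c s u T s'' \<Longrightarrow> u = t \<and> T = S \<and> s'' = s'"
proof (induction arbitrary: u T s'' rule: exec.induct)
  case (exec_Skip s)
  from exec_Skip.prems show ?case by cases simp
next
  case (exec_NPut s a e r)
  from exec_NPut.prems show ?case by cases simp
next
  case (exec_TPut s a e r)
  from exec_TPut.prems show ?case by cases simp
next
  case (exec_Seq c s t S s1 d t' S' s2)
  from exec_Seq.prems show ?case by cases (metis exec_Seq.IH)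
next
  case (exec_Cond_True s b c t S s1 d)
  from exec_Cond_True.prems show ?case
    by cases (use exec_Cond_True.IH exec_Cond_True.hyps in metis)+
next
  case (exec_Cond_False s b d t S s1 c)
  from exec_Cond_False.prems show ?case
    by cases (use exec_Cond_False.IH exec_Cond_False.hyps in metis)+
next
  case (exec_While_False s b c)
  from exec_While_False.prems show ?case
    by cases (use exec_While_False.hyps in simp_all)
next
  case (exec_While_True s b c t S s1 t' S' s2)
  from exec_While_True.prems show ?case
    by cases (use exec_While_True.IH exec_While_True.hyps in metis)+
qed

section \<open>Input encoding\<close>

fun sign_tag :: "strop \<Rightarrow> nat" where
  "sign_tag SNegInf = 0"
| "sign_tag (Pos a) = 1"
| "sign_tag (Neg a) = 2"

text \<open>Natural arrays: array \<open>0\<close> holds \<open>m, n, k\<close>, array \<open>1\<close> the signs of \<open>W\<close> row by row, array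
  \<open>2\<close> the basis listed as \<open>bas 0, \<dots>, bas (n - 1)\<close>. Tropical arrays: array \<open>0\<close> holds the moduli
  of \<open>W\<close> row by row, array \<open>1\<close> the coordinates of \<open>x\<close>. All other cells are blank.\<close>

definition pivot_input ::
  "nat \<Rightarrow> nat \<Rightarrow> (nat \<Rightarrow> nat \<Rightarrow> strop) \<Rightarrow> (nat \<Rightarrow> trop) \<Rightarrow> (nat \<Rightarrow> nat) \<Rightarrow> nat \<Rightarrow> state" where
  "pivot_input m n W x bas k =
     \<lparr>nmem = (\<lambda>r a.
        if r = 0 \<and> a = 0 then m
        else if r = 0 \<and> a = 1 then n
        else if r = 0 \<and> a = 2 then k
        else if r = 1 \<and> a < m * (n + 1) then sign_tag (W (a div (n + 1)) (a mod (n + 1)))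
        else if r = 2 \<and> a < n then bas a
        else 0),
      tmem = (\<lambda>r a.
        if r = 0 \<and> a < m * (n + 1) then modulus (W (a div (n + 1)) (a mod (n + 1)))
        else if r = 1 \<and> a \<le> n then x a
        else NegInf)\<rparr>"

text \<open>The result is read off cell \<open>0\<close> of natural array \<open>3\<close> and from tropical array \<open>2\<close>.\<close>

definition output_index :: "state \<Rightarrow> nat" where
  "output_index s = nmem s 3 0"

definition output_point :: "state \<Rightarrow> nat \<Rightarrow> trop" where
  "output_point s = tmem s 2"

end

theory Submission
  imports Defs
begin

text \<open>
  At a basic point \<open>\<xi>\<close>, the columns attaining the maximum of row \<open>i\<close> are two for every \<open>i \<in> I\<close>, one of
  each sign, and these pairs form a spanning tree on the columns: genericity forbids cycles, since a
  cycle would give two maximal permutations of one submatrix. To leave \<open>\<xi>\<close> along the edge of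
  \<open>K = I - {k}\<close>, raise at unit speed the positive maximal column of row \<open>k\<close> and every column that is
  forced to follow. The set \<open>J\<close> of moving columns only grows. When a moving column catches up with
  the constant maximum of a row of \<open>K\<close>, the maximal column of the opposite sign joins \<open>J\<close> and the row is
  done; each row of \<open>K\<close> admits one new column, so \<open>J\<close> never contains all columns. When a negative
  entry catches up with the positive maximum of a row outside \<open>K\<close>, the motion has reached the other basic
  point. If no event occurred, the limit of the ray would be a point of the cone with an infinite
  coordinate.

  A coordinate is raised only after its column enters \<open>J\<close>, so the maximum over \<open>J\<close>, shifted back by the
  time of entry, together with the maximum at \<open>\<xi>\<close>, determines the time of the next event of a row. Each
  of the at most \<open>n\<close> new columns therefore costs \<open>O(m)\<close>.
\<close>

section \<open>Two matchings from too many hyperedges, and tropical genericity\<close>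

text \<open>The delicate point is less that the motion ends at a basic point than that no third
  basic point lies on the edge. For points \<open>z\<close> and \<open>w\<close>, the coordinates
  where \<open>w - z\<close> is maximal are those that rise first on the way from \<open>z\<close>
  to \<open>w\<close>. If a row is active at both points and its maximal columns at \<open>z\<close>
  are one pair of opposite signs, that set contains both columns or neither. When every row of a
  spanning tree behaves like this, the set is everything and \<open>w\<close> equals
  \<open>z\<close> up to a constant. The invariant therefore claims that \<open>J\<close> lies in
  this set for every competing basic point \<open>w\<close>; at the end of the motion the tree then
  identifies \<open>w\<close> with the point reached. Genericity enters only by counting: rows with
  two tight columns each inside a set of columns are fewer than these columns. The done rows exhaust
  this count on \<open>J\<close>, and between events the other rows of \<open>K\<close> exhaust it
  on the complement. Space needs no separate analysis: under a word bound of order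
  \<open>n * m\<close>, a fixed number of arrays offers only that many cells.\<close>

text \<open>Contract the hyperedge \<open>e\<close> to the point \<open>p\<close>: the number of
  vertices drops by \<open>card (T e) - 1\<close>, exactly the contribution of \<open>e\<close> to
  the sum, so the induction hypothesis applies. Lifting its two matchings can spoil the equality of
  images only inside \<open>T e\<close>, and \<open>e\<close> itself, matched crosswise, repairs it.
  The model case is a cycle in a graph with its two orientations.\<close>

lemma two_matchings:
  assumes "finite R" "finite V" "V \<noteq> {}" "\<And>e. e \<in> R \<Longrightarrow> T e \<subseteq> V"
    and "card V \<le> (\<Sum>e\<in>R. card (T e) - 1)"
  shows "\<exists>R'\<subseteq>R. \<exists>f g. inj_on f R' \<and> inj_on g R' \<and> f ` R' = g ` R' \<and>
    (\<forall>e\<in>R'. f e \<in> T e \<and> g e \<in> T e) \<and> (\<exists>e\<in>R'. f e \<noteq> g e)"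
  using assms
proof (induction R arbitrary: V T rule: finite_induct)
  case empty
  then show ?case by simp
next
  case (insert e F)
  have fT: "finite (T a)" if "a \<in> insert e F" for a
    using insert.prems(1,3) that finite_subset by blast
  show ?case
  proof (cases "card (T e) \<le> 1")
    case True
    then have "card V \<le> (\<Sum>e\<in>F. card (T e) - 1)" using insert.prems(4) insert.hyps by simp
    moreover have "T a \<subseteq> V" if "a \<in> F" for a using insert.prems(3) that by blast
    ultimately have "\<exists>R'\<subseteq>F. \<exists>f g. inj_on f R' \<and> inj_on g R' \<and> f ` R' = g ` R' \<and>
        (\<forall>e\<in>R'. f e \<in> T e \<and> g e \<in> T e) \<and> (\<exists>e\<in>R'. f e \<noteq> g e)"
      by (intro insert.IH[OF insert.prems(1,2)])
    then obtain R' f g where "R' \<subseteq> F" "inj_on f R'" "inj_on g R'" "f ` R' = g ` R'"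
      "\<forall>e\<in>R'. f e \<in> T e \<and> g e \<in> T e" "\<exists>e\<in>R'. f e \<noteq> g e" by (elim exE conjE)
    then show ?thesis by (intro exI[of _ R'] conjI exI[of _ f] exI[of _ g]) auto
  next
    case big: False
    show ?thesis
    \<comment> \<open>Two shared vertices form a cycle of length two. Without them, the contraction
      \<open>c\<close> below is injective on every other hyperedge and keeps its size.\<close>
    proof (cases "\<exists>e'\<in>F. \<exists>a b. a \<noteq> b \<and> a \<in> T e \<and> b \<in> T e \<and> a \<in> T e' \<and> b \<in> T e'")
      case True
      then obtain e' a b where *: "e' \<in> F" "a \<noteq> b" "a \<in> T e" "b \<in> T e" "a \<in> T e'" "b \<in> T e'"
        by blast
      moreover have "e \<noteq> e'" using * insert.hyps by auto
      ultimately show ?thesis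
        by (intro exI[of _ "{e, e'}"] conjI exI[of _ "\<lambda>i. if i = e then a else b"]
            exI[of _ "\<lambda>i. if i = e then b else a"]) auto
    next
      case simple: False
      obtain p where p: "p \<in> T e" using big by fastforce
      define c where "c v = (if v \<in> T e then p else v)" for v
      define V' where "V' = insert p (V - T e)"
      have TeV: "T e \<subseteq> V" using insert.prems by auto
      have cV': "card V' = Suc (card V - card (T e))"
        unfolding V'_def using p TeV insert.prems(1) fT by (simp add: card_Diff_subset)
      have cT: "card (c ` T a) = card (T a)" if "a \<in> F" for a
        by (rule card_image) (use that simple p in \<open>auto simp: inj_on_def c_def split: if_splits\<close>)
      have le: "card (T e) \<le> card V" using TeV insert.prems(1) card_mono by blast
      have "card V \<le> (card (T e) - 1) + (\<Sum>a\<in>F. card (T a) - 1)"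
        using insert.prems(4) insert.hyps by simp
      then have "card V' \<le> (\<Sum>a\<in>F. card (T a) - 1)" unfolding cV' using big le by linarith
      also have "\<dots> = (\<Sum>a\<in>F. card (c ` T a) - 1)" using cT by simp
      finally have IHc: "card V' \<le> (\<Sum>a\<in>F. card (c ` T a) - 1)" .
      have "finite V'" "V' \<noteq> {}" unfolding V'_def using insert.prems by auto
      moreover have "c ` T a \<subseteq> V'" if "a \<in> F" for a
        using that insert.prems(3)[of a] unfolding V'_def c_def by auto
      ultimately obtain R' f' g' where R': "R' \<subseteq> F" and inj': "inj_on f' R'" "inj_on g' R'"
        and im': "f' ` R' = g' ` R'" and in': "\<forall>a\<in>R'. f' a \<in> c ` T a \<and> g' a \<in> c ` T a"
        and ne': "\<exists>a\<in>R'. f' a \<noteq> g' a"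
        using insert.IH[OF _ _ _ IHc] by metis
      from in' have "\<forall>a\<in>R'. \<exists>v. v \<in> T a \<and> c v = f' a" by fastforce
      then obtain f where f: "\<forall>a\<in>R'. f a \<in> T a \<and> c (f a) = f' a" by metis
      from in' have "\<forall>a\<in>R'. \<exists>v. v \<in> T a \<and> c v = g' a" by fastforce
      then obtain g where g: "\<forall>a\<in>R'. g a \<in> T a \<and> c (g a) = g' a" by metis
      have injf: "inj_on f R'" using inj'(1) f unfolding inj_on_def by metis
      have injg: "inj_on g R'" using inj'(2) g unfolding inj_on_def by metis
      have ne: "\<exists>a\<in>R'. f a \<noteq> g a" using ne' f g by metis
      \<comment> \<open>The contraction does not move a vertex outside \<open>T e\<close>, so the
        other lift uses the same vertex.\<close>
      have fg: "f a \<in> g ` R'" if "a \<in> R'" "f a \<notin> T e" for a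
      proof -
        have "f' a \<in> g' ` R'" using im' that by auto
        then obtain b where b: "b \<in> R'" "g' b = f' a" by auto
        then have "c (g b) = f a" using f g that by (metis c_def)
        then show ?thesis using b that p by (metis c_def imageI)
      qed
      have gf: "g a \<in> f ` R'" if "a \<in> R'" "g a \<notin> T e" for a
      proof -
        have "g' a \<in> f' ` R'" using im' that by auto
        then obtain b where b: "b \<in> R'" "f' b = g' a" by auto
        then have "c (f b) = g a" using f g that by (metis c_def)
        then show ?thesis using b that p by (metis c_def imageI)
      qed
      show ?thesis
      proof (cases "f ` R' = g ` R'")
        case True
        then show ?thesis
          using R' injf injg ne f g by (intro exI[of _ R'] conjI exI[of _ f] exI[of _ g]) auto
      next
        case False
        have hit: "(\<exists>a\<in>R'. f a \<in> T e) \<longleftrightarrow> (\<exists>a\<in>R'. g a \<in> T e)"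
        proof -
          have "(\<exists>a\<in>R'. f a \<in> T e) \<longleftrightarrow> p \<in> f' ` R'" using f p by (metis (full_types) c_def image_iff)
          moreover have "(\<exists>a\<in>R'. g a \<in> T e) \<longleftrightarrow> p \<in> g' ` R'"
            using g p by (metis (full_types) c_def image_iff)
          ultimately show ?thesis using im' by simp
        qed
        have "\<exists>a\<in>R'. f a \<in> T e"
        proof (rule ccontr)
          assume "\<not> ?thesis"
          then have "f ` R' = g ` R'" using fg gf hit by blast
          then show False using False by simp
        qed
        \<comment> \<open>Since \<open>f'\<close> and \<open>g'\<close> are injective, each lift has
          a single representative in \<open>T e\<close>; these two are the only places where the
          images can differ.\<close>
        then obtain a b where a: "a \<in> R'" "f a \<in> T e" and b: "b \<in> R'" "g b \<in> T e" using hit by blast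
        have uf: "d = a" if "d \<in> R'" "f d \<in> T e" for d
          using that a f inj'(1) unfolding inj_on_def by (metis c_def)
        have ug: "d = b" if "d \<in> R'" "g d \<in> T e" for d
          using that b g inj'(2) unfolding inj_on_def by (metis c_def)
        have ab: "f a \<noteq> g b"
        proof
          assume eq: "f a = g b"
          have "f d \<in> g ` R'" if "d \<in> R'" for d using that fg uf eq b by (cases "f d \<in> T e") auto
          moreover have "g d \<in> f ` R'" if "d \<in> R'" for d
            using that gf ug eq[symmetric] a by (cases "g d \<in> T e") auto
          ultimately show False using False by blast
        qed
        have fga: "f a \<notin> g ` R'" using ab ug a by (metis image_iff)
        have gbf: "g b \<notin> f ` R'" using ab uf b by (metis image_iff)
        have eR: "e \<notin> R'" using R' insert.hyps by auto
        \<comment> \<open>In each matching \<open>e\<close> takes the vertex of \<open>T e\<close>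
          used by the other one, so both images become the union of the old ones.\<close>
        define f2 where "f2 = f(e := g b)"
        define g2 where "g2 = g(e := f a)"
        have f2im: "f2 ` R' = f ` R'" and g2im: "g2 ` R' = g ` R'"
          using eR unfolding f2_def g2_def by auto
        have "inj_on f2 (insert e R')" "inj_on g2 (insert e R')"
          using injf injg eR fga gbf unfolding f2_def g2_def inj_on_insert
          by (auto simp: inj_on_fun_updI)
        moreover have "f2 ` insert e R' = g2 ` insert e R'"
        proof -
          have "f d \<in> insert (f a) (g ` R')" if "d \<in> R'" for d using that fg uf by blast
          moreover have "g d \<in> insert (g b) (f ` R')" if "d \<in> R'" for d using that gf ug by blast
          ultimately have "insert (g b) (f ` R') = insert (f a) (g ` R')" using a b by blast
          then show ?thesis unfolding image_insert f2im g2im by (simp add: f2_def g2_def)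
        qed
        moreover have "\<forall>d\<in>insert e R'. f2 d \<in> T d \<and> g2 d \<in> T d"
          using f g a b eR unfolding f2_def g2_def by auto
        moreover have "\<exists>d\<in>insert e R'. f2 d \<noteq> g2 d"
          using ab by (intro bexI[of _ e]) (auto simp: f2_def g2_def)
        moreover have "insert e R' \<subseteq> insert e F" using R' by auto
        ultimately show ?thesis by blast
      qed
    qed
  qed
qed

section \<open>Tight entries and maximal permutations\<close>

text \<open>Translates a matching between row and column indices into a permutation of the positions
  that \<open>submat\<close> works with.\<close>

lemma perm_of_bij_betw:
  assumes "finite R" "bij_betw f R S"
  obtains \<sigma> where "\<sigma> permutes {..<card R}"
    "\<And>i. i < card R \<Longrightarrow> sorted_list_of_set S ! \<sigma> i = f (sorted_list_of_set R ! i)"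
proof -
  have fS: "finite S" using assms bij_betw_finite by blast
  have cS: "card S = card R" using assms bij_betw_same_card by metis
  let ?r = "(!) (sorted_list_of_set R)" and ?s = "(!) (sorted_list_of_set S)"
  have r: "bij_betw ?r {..<card R} R"
    by (rule bij_betw_nth) (use assms in auto)
  have s: "bij_betw ?s {..<card R} S"
    by (rule bij_betw_nth) (use fS cS in auto)
  let ?\<tau> = "inv_into {..<card R} ?s \<circ> (f \<circ> ?r)"
  have \<tau>: "bij_betw ?\<tau> {..<card R} {..<card R}"
    using bij_betw_trans[OF bij_betw_trans[OF r assms(2)] bij_betw_inv_into[OF s]] .
  define \<sigma> where "\<sigma> i = (if i < card R then ?\<tau> i else i)" for i
  have "bij_betw \<sigma> {..<card R} {..<card R}"
    using \<tau> by (subst bij_betw_cong[of _ _ ?\<tau>]) (auto simp: \<sigma>_def)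
  then have "\<sigma> permutes {..<card R}" by (rule bij_imp_permutes) (simp add: \<sigma>_def)
  moreover have "?s (\<sigma> i) = f (?r i)" if "i < card R" for i
  proof -
    have "f (?r i) \<in> S" using that r assms(2) by (metis bij_betwE lessThan_iff)
    then show ?thesis using that s by (simp add: \<sigma>_def bij_betw_inv_into_right)
  qed
  ultimately show thesis by (rule that)
qed

instance trop :: ordered_comm_monoid_add
proof
  fix a b c :: trop
  show "a \<le> b \<Longrightarrow> c + a \<le> c + b" by (cases a; cases b; cases c) auto
qed

lemma sum_Fin: "(\<Sum>i\<in>A. Fin (f i)) = Fin (\<Sum>i\<in>A. f i)"
  by (induction A rule: infinite_finite_induct) (auto simp: zero_trop_def)

text \<open>The value at \<open>SNegInf\<close> is a dummy, kept out of play by conditions on the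
  entry or its sign.\<close>

fun mag :: "strop \<Rightarrow> real" where
  "mag SNegInf = 0"
| "mag (Pos a) = a"
| "mag (Neg a) = a"

lemma modulus_eq_Fin_mag: "w \<noteq> SNegInf \<Longrightarrow> modulus w = Fin (mag w)"
  by (cases w) auto

text \<open>These sets are the hyperedges of the tangent graph at \<open>z\<close>, one for each
  row.\<close>

definition tight :: "nat \<Rightarrow> (nat \<Rightarrow> nat \<Rightarrow> strop) \<Rightarrow> (nat \<Rightarrow> real) \<Rightarrow> nat \<Rightarrow> nat set" where
  "tight n W z i = {j. j \<le> n \<and> W i j \<noteq> SNegInf \<and>
     (\<forall>l\<le>n. W i l \<noteq> SNegInf \<longrightarrow> mag (W i l) + z l \<le> mag (W i j) + z j)}"

lemma tight_bounded: "tight n W z i \<subseteq> {..n}"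
  by (auto simp: tight_def)

lemma finite_tight: "finite (tight n W z i)"
  using finite_subset[OF tight_bounded] by blast

text \<open>The row maxima \<open>X\<close> and the point \<open>z\<close> form a dual solution of
  the assignment problem: they bound the weight of every permutation by the same constant
  \<open>Y\<close>, and a permutation through tight entries attains it. Two tight matchings onto the
  same columns would thus both be maximal.\<close>

lemma generic_tight_matching_unique:
  assumes gen: "trop_generic m n W" and R: "R \<subseteq> {..<m}"
    and inj: "inj_on f R" "inj_on g R" and im: "f ` R = g ` R"
    and tight: "\<And>i. i \<in> R \<Longrightarrow> f i \<in> tight n W z i \<and> g i \<in> tight n W z i"
    and e: "e \<in> R"
  shows "f e = g e"
proof (rule ccontr)
  assume ne: "f e \<noteq> g e"
  define S where "S = f ` R"
  define N where "N = mod_mat (submat W R S)"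
  let ?k = "card R"
  let ?r = "(!) (sorted_list_of_set R)" and ?s = "(!) (sorted_list_of_set S)"
  have finR: "finite R" using R finite_subset by blast
  have Sn: "S \<subseteq> {..n}" using tight tight_bounded unfolding S_def by fastforce
  have finS: "finite S" using finR S_def by simp
  have cS: "card S = ?k" unfolding S_def using inj card_image by blast
  have r: "bij_betw ?r {..<?k} R" by (rule bij_betw_nth) (use finR in auto)
  have s: "bij_betw ?s {..<?k} S" by (rule bij_betw_nth) (use finS cS in auto)
  define X where "X i = mag (W i (f i)) + z (f i)" for i
  have ub: "modulus (W i j) \<le> Fin (X i - z j)" if "i \<in> R" "j \<in> S" for i j
  proof (cases "W i j = SNegInf")
    case False
    then have "mag (W i j) + z j \<le> X i"
      using that Sn tight[of i] unfolding X_def tight_def by auto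
    then show ?thesis using False by (simp add: modulus_eq_Fin_mag)
  qed simp
  define Y where "Y = (\<Sum>i<?k. X (?r i)) - (\<Sum>i<?k. z (?s i))"
  have zperm: "(\<Sum>i<?k. X (?r i) - z (?s (\<sigma> i))) = Y" if "\<sigma> permutes {..<?k}" for \<sigma>
    unfolding Y_def sum_subtractf using sum.permute[OF that, of "\<lambda>i. z (?s i)"] by (simp add: o_def)
  have le: "perm_weight ?k N \<sigma> \<le> Fin Y" if \<sigma>: "\<sigma> permutes {..<?k}" for \<sigma>
  proof -
    have "perm_weight ?k N \<sigma> \<le> (\<Sum>i<?k. Fin (X (?r i) - z (?s (\<sigma> i))))"
      unfolding perm_weight_def N_def mod_mat_def submat_def
    proof (rule sum_mono, rule ub)
      fix i assume i: "i \<in> {..<?k}"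
      show "?r i \<in> R" using i r bij_betwE by blast
      show "?s (\<sigma> i) \<in> S" using i s \<sigma> by (metis bij_betwE permutes_in_image)
    qed
    then show ?thesis unfolding sum_Fin zperm[OF \<sigma>] .
  qed
  have attained: "\<exists>\<sigma>. \<sigma> permutes {..<?k} \<and> perm_weight ?k N \<sigma> = Fin Y \<and>
      (\<forall>i<?k. ?s (\<sigma> i) = h (?r i))"
    if h: "inj_on h R" "h ` R = S" "\<And>i. i \<in> R \<Longrightarrow> h i \<in> tight n W z i" for h
  proof -
    have "bij_betw h R S" using h by (simp add: bij_betw_def)
    then obtain \<sigma> where \<sigma>: "\<sigma> permutes {..<?k}" "\<And>i. i < ?k \<Longrightarrow> ?s (\<sigma> i) = h (?r i)"
      using perm_of_bij_betw[OF finR] by metis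
    have "modulus (W i (h i)) = Fin (X i - z (h i))" if "i \<in> R" for i
    proof -
      have "h i \<in> tight n W z i" "f i \<in> tight n W z i" using that h tight by auto
      then have "mag (W i (h i)) + z (h i) = X i" "W i (h i) \<noteq> SNegInf"
        unfolding X_def tight_def by (auto intro: antisym)
      then show ?thesis by (auto simp: modulus_eq_Fin_mag)
    qed
    then have "perm_weight ?k N \<sigma> = (\<Sum>i<?k. Fin (X (?r i) - z (?s (\<sigma> i))))"
      unfolding perm_weight_def N_def mod_mat_def submat_def
      using \<sigma>(2) r by (intro sum.cong) (auto dest: bij_betwE)
    then show ?thesis using \<sigma> unfolding sum_Fin zperm[OF \<sigma>(1)] by blast
  qed
  obtain \<sigma> where \<sigma>: "\<sigma> permutes {..<?k}" "perm_weight ?k N \<sigma> = Fin Y"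
    "\<forall>i<?k. ?s (\<sigma> i) = f (?r i)" using attained[of f] inj tight S_def by blast
  obtain \<pi> where \<pi>: "\<pi> permutes {..<?k}" "perm_weight ?k N \<pi> = Fin Y"
    "\<forall>i<?k. ?s (\<pi> i) = g (?r i)" using attained[of g] inj im tight S_def by blast
  obtain i where i: "i < ?k" "?r i = e" using e r by (metis bij_betw_iff_bijections lessThan_iff)
  have neq: "\<sigma> \<noteq> \<pi>" using \<sigma>(3) \<pi>(3) i ne by metis
  have fin: "finite {\<sigma>. \<sigma> permutes {..<?k}}" by (rule finite_permutations) simp
  have "tper ?k N = Fin Y" unfolding tper_def
    by (rule Max_eqI) (use fin le \<sigma>(1) \<sigma>(2)[symmetric] in auto)
  moreover from this have "\<sigma> \<in> max_perms ?k N" "\<pi> \<in> max_perms ?k N"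
    using \<sigma> \<pi> unfolding max_perms_def by auto
  ultimately show False
    using gen[unfolded trop_generic_def trop_singular_def, rule_format, of R S] R Sn cS neq
    unfolding N_def by auto
qed

text \<open>The edge count of a hyperforest: if it failed, \<open>two_matchings\<close> would
  produce two different tight matchings onto the same columns.\<close>

lemma generic_forest:
  assumes gen: "trop_generic m n W" and R: "R \<subseteq> {..<m}" and V: "V \<subseteq> {..n}" "V \<noteq> {}"
    and T: "\<And>i. i \<in> R \<Longrightarrow> T i \<subseteq> tight n W z i \<inter> V"
  shows "(\<Sum>i\<in>R. card (T i) - 1) < card V"
proof (rule ccontr)
  assume "\<not> ?thesis"
  then have le: "card V \<le> (\<Sum>i\<in>R. card (T i) - 1)" by simp
  have "finite R" "finite V" using R V finite_subset by blast+
  then have "\<exists>R'\<subseteq>R. \<exists>f g. inj_on f R' \<and> inj_on g R' \<and> f ` R' = g ` R' \<and>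
      (\<forall>e\<in>R'. f e \<in> T e \<and> g e \<in> T e) \<and> (\<exists>e\<in>R'. f e \<noteq> g e)"
    by (rule two_matchings[OF _ _ V(2) _ le]) (use T in blast)
  then obtain R' f g where *: "R' \<subseteq> R" "inj_on f R'" "inj_on g R'" "f ` R' = g ` R'"
    "\<forall>e\<in>R'. f e \<in> T e \<and> g e \<in> T e" "\<exists>e\<in>R'. f e \<noteq> g e"
    by (elim exE conjE)
  have "f e = g e" if "e \<in> R'" for e
    by (rule generic_tight_matching_unique[OF gen, of R' f g z]) (use * R T that in blast)+
  then show False using * by blast
qed

lemma generic_card_less:
  assumes "trop_generic m n W" "R \<subseteq> {..<m}" "V \<subseteq> {..n}" "V \<noteq> {}"
    and T: "\<And>i. i \<in> R \<Longrightarrow> \<exists>a b. a \<noteq> b \<and> {a, b} \<subseteq> tight n W z i \<inter> V"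
  shows "card R < card V"
proof -
  have "1 \<le> card (tight n W z i \<inter> V) - 1" if i: "i \<in> R" for i
  proof -
    obtain a b where ab: "a \<noteq> b" "{a, b} \<subseteq> tight n W z i \<inter> V" using T[OF i] by blast
    have "card {a, b} \<le> card (tight n W z i \<inter> V)"
      using ab finite_tight by (intro card_mono) auto
    then show ?thesis using ab by simp
  qed
  then have "(\<Sum>i\<in>R. 1) \<le> (\<Sum>i\<in>R. card (tight n W z i \<inter> V) - 1)" by (rule sum_mono)
  also have "\<dots> < card V" by (rule generic_forest[OF assms(1-4)]) auto
  finally show ?thesis by simp
qed

text \<open>A forest with \<open>card V - 1\<close> edges is a tree, and a nonempty union of its
  components is everything. For a proper \<open>D\<close>, the edges inside \<open>D\<close> and
  those inside \<open>V - D\<close> fall short of their vertices by one each, so together by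
  two.\<close>

lemma generic_connected:
  assumes gen: "trop_generic m n W" and R: "R \<subseteq> {..<m}" and V: "V \<subseteq> {..n}" "card V \<le> Suc (card R)"
    and T: "\<And>i. i \<in> R \<Longrightarrow> \<exists>a b. a \<noteq> b \<and> {a, b} \<subseteq> tight n W z i \<inter> V \<and> (a \<in> D \<longleftrightarrow> b \<in> D)"
    and D: "D \<subseteq> V" "D \<noteq> {}"
  shows "D = V"
proof (rule ccontr)
  assume "D \<noteq> V"
  define R1 where "R1 = {i \<in> R. \<exists>a b. a \<noteq> b \<and> {a, b} \<subseteq> tight n W z i \<inter> D}"
  have "finite R" "finite V" using R V finite_subset by blast+
  have 1: "card R1 < card D"
    by (rule generic_card_less[OF gen]) (use R V D in \<open>auto simp: R1_def\<close>)
  have 2: "card (R - R1) < card (V - D)"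
  proof (rule generic_card_less[OF gen])
    fix i assume i: "i \<in> R - R1"
    then obtain a b where ab: "a \<noteq> b" "{a, b} \<subseteq> tight n W z i \<inter> V" "a \<in> D \<longleftrightarrow> b \<in> D"
      using T[of i] by auto
    have "a \<notin> D" using i ab unfolding R1_def by auto
    then show "\<exists>a b. a \<noteq> b \<and> {a, b} \<subseteq> tight n W z i \<inter> (V - D)" using ab by auto
  qed (use R V D \<open>D \<noteq> V\<close> in auto)
  have "card R = card R1 + card (R - R1)"
    using \<open>finite R\<close> card_Int_Diff[of R R1] by (simp add: R1_def Int_absorb1 Collect_conj_eq)
  moreover have "card V = card D + card (V - D)"
    using \<open>finite V\<close> D by (metis card_Diff_subset card_mono finite_subset le_add_diff_inverse)
  ultimately show False using 1 2 V(2) by linarith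
qed

section \<open>Vertices of the tropical cone\<close>

text \<open>At a finite point, \<open>s = 1\<close> gives the half-space of row \<open>i\<close> and
  \<open>s = -1\<close> the opposite one. The parameter lets one argument serve both signs.\<close>

definition sign_dominates ::
  "nat \<Rightarrow> (nat \<Rightarrow> nat \<Rightarrow> strop) \<Rightarrow> int \<Rightarrow> nat \<Rightarrow> (nat \<Rightarrow> real) \<Rightarrow> bool" where
  "sign_dominates n W s i z \<longleftrightarrow> (\<forall>l\<le>n. strop_sign (W i l) = - s \<longrightarrow>
     (\<exists>j\<le>n. strop_sign (W i j) = s \<and> mag (W i l) + z l \<le> mag (W i j) + z j))"

definition active :: "nat \<Rightarrow> (nat \<Rightarrow> nat \<Rightarrow> strop) \<Rightarrow> nat \<Rightarrow> (nat \<Rightarrow> real) \<Rightarrow> bool" where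
  "active n W i z \<longleftrightarrow> sign_dominates n W 1 i z \<and> sign_dominates n W (-1) i z"

text \<open>Used with \<open>d\<close> the difference of two points: the coordinates in which the
  tropical segment from one to the other starts.\<close>

definition argmax_upto :: "nat \<Rightarrow> (nat \<Rightarrow> real) \<Rightarrow> nat set" where
  "argmax_upto n d = {j. j \<le> n \<and> (\<forall>l\<le>n. d l \<le> d j)}"

lemma strop_sign_cases: "w \<noteq> SNegInf \<Longrightarrow> strop_sign w = 1 \<or> strop_sign w = -1"
  by (cases w) auto

lemma pos_part_eq: "pos_part w = (if strop_sign w = 1 then Fin (mag w) else NegInf)"
  by (cases w) auto

lemma neg_part_eq: "neg_part w = (if strop_sign w = -1 then Fin (mag w) else NegInf)"
  by (cases w) auto

lemma Max_image_le_Max_image_iff: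
  fixes f g :: "nat \<Rightarrow> trop"
  shows "Max (f ` {..n}) \<le> Max (g ` {..n}) \<longleftrightarrow> (\<forall>l\<le>n. \<exists>j\<le>n. f l \<le> g j)"
  by (subst Max_le_iff) (auto simp: Max_ge_iff)

lemma row_neg_le_row_pos_iff:
  assumes "\<forall>j\<le>n. x j = Fin (z j)"
  shows "row_neg n W i x \<le> row_pos n W i x \<longleftrightarrow> sign_dominates n W 1 i z"
proof -
  have "neg_part (W i l) + x l \<le> pos_part (W i j) + x j \<longleftrightarrow>
      (strop_sign (W i l) = -1 \<longrightarrow> strop_sign (W i j) = 1 \<and> mag (W i l) + z l \<le> mag (W i j) + z j)"
    if "l \<le> n" "j \<le> n" for l j using assms that by (simp add: pos_part_eq neg_part_eq)
  \<comment> \<open>If column \<open>l\<close> is not negative, any witness works, and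
    \<open>0 \<le> n\<close> provides one.\<close>
  then show ?thesis
    unfolding row_neg_def row_pos_def Max_image_le_Max_image_iff sign_dominates_def minus_minus
    by (metis zero_le)
qed

lemma row_pos_le_row_neg_iff:
  assumes "\<forall>j\<le>n. x j = Fin (z j)"
  shows "row_pos n W i x \<le> row_neg n W i x \<longleftrightarrow> sign_dominates n W (-1) i z"
proof -
  have "pos_part (W i l) + x l \<le> neg_part (W i j) + x j \<longleftrightarrow>
      (strop_sign (W i l) = 1 \<longrightarrow> strop_sign (W i j) = -1 \<and> mag (W i l) + z l \<le> mag (W i j) + z j)"
    if "l \<le> n" "j \<le> n" for l j using assms that by (simp add: pos_part_eq neg_part_eq)
  then show ?thesis
    unfolding row_neg_def row_pos_def Max_image_le_Max_image_iff sign_dominates_def minus_minus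
    by (metis zero_le)
qed

lemma trop_face_iff:
  assumes "\<forall>j\<le>n. x j = Fin (z j)"
  shows "x \<in> trop_face m n W I \<longleftrightarrow>
    (\<forall>i\<in>I. active n W i z) \<and> (\<forall>i<m. sign_dominates n W 1 i z)"
  using row_neg_le_row_pos_iff[OF assms] row_pos_le_row_neg_iff[OF assms]
  unfolding trop_face_def trop_hyperplane_def trop_cone_def active_def
  by (auto simp: order_eq_iff)

lemma finite_point_coords:
  assumes "admissible m n W" "x \<in> trop_face m n W I" "nonzero_point n x"
  obtains z where "\<forall>j\<le>n. x j = Fin (z j)"
proof -
  have "\<forall>j\<le>n. x j \<noteq> NegInf" using assms unfolding admissible_def trop_face_def by blast
  then have "\<forall>j. \<exists>r. j \<le> n \<longrightarrow> x j = Fin r" by (metis trop.exhaust)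
  then show thesis using that by metis
qed

lemma same_point_coords:
  assumes "\<forall>j\<le>n. x j = Fin (z j)" "\<forall>j\<le>n. y j = Fin (w j)"
  shows "same_point n x y \<longleftrightarrow> (\<exists>c. \<forall>j\<le>n. w j = z j + c)"
  using assms unfolding same_point_def by auto

lemma tight_nonempty:
  assumes "\<exists>j\<le>n. W i j \<noteq> SNegInf"
  obtains j where "j \<in> tight n W z i"
proof -
  let ?S = "{j. j \<le> n \<and> W i j \<noteq> SNegInf}"
  have S: "finite ?S" "?S \<noteq> {}" using assms by auto
  have "Max ((\<lambda>j. mag (W i j) + z j) ` ?S) \<in> (\<lambda>j. mag (W i j) + z j) ` ?S"
    using S by (intro Max_in) auto
  then obtain j where "j \<in> ?S" "Max ((\<lambda>j. mag (W i j) + z j) ` ?S) = mag (W i j) + z j" by auto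
  moreover have "mag (W i l) + z l \<le> Max ((\<lambda>j. mag (W i j) + z j) ` ?S)" if "l \<in> ?S" for l
    using S that by (intro Max_ge) auto
  ultimately have "j \<in> tight n W z i" unfolding tight_def by auto
  then show thesis by (rule that)
qed

lemma tight_of_ge:
  assumes "r \<in> tight n W z i" "j \<le> n" "W i j \<noteq> SNegInf" "mag (W i r) + z r \<le> mag (W i j) + z j"
  shows "j \<in> tight n W z i"
  using assms unfolding tight_def by force

text \<open>Some column attains the maximum of the row; dominance by the other sign puts a column of
  that sign at the same height.\<close>

lemma active_tight:
  assumes "active n W i z" "\<exists>j\<le>n. W i j \<noteq> SNegInf"
  obtains p q where "p \<in> tight n W z i" "strop_sign (W i p) = 1"
    "q \<in> tight n W z i" "strop_sign (W i q) = -1"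
proof -
  obtain j where j: "j \<in> tight n W z i" using tight_nonempty[of n W i z] assms(2) by blast
  then have jn: "j \<le> n" "W i j \<noteq> SNegInf" by (auto simp: tight_def)
  have opp: "\<exists>l\<in>tight n W z i. strop_sign (W i l) = s"
    if s: "strop_sign (W i j) = - s" "s \<noteq> 0" "sign_dominates n W s i z" for s
  proof -
    obtain l where "l \<le> n" "strop_sign (W i l) = s" "mag (W i j) + z j \<le> mag (W i l) + z l"
      using s jn unfolding sign_dominates_def by blast
    moreover from this s have "W i l \<noteq> SNegInf" by auto
    ultimately show ?thesis using tight_of_ge[OF j] by blast
  qed
  show thesis
    using strop_sign_cases[OF jn(2)] opp[of 1] opp[of "-1"] j assms(1) that
    unfolding active_def by (metis minus_minus one_neq_zero neg_equal_0_iff_equal)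
qed

lemma active_if_tight_signs:
  assumes "p \<in> tight n W z i" "strop_sign (W i p) = 1" "q \<in> tight n W z i" "strop_sign (W i q) = -1"
  shows "active n W i z"
proof -
  have "p \<le> n" "q \<le> n" using assms by (auto simp: tight_def)
  moreover have "mag (W i l) + z l \<le> mag (W i r) + z r"
    if "l \<le> n" "strop_sign (W i l) \<noteq> 0" "r \<in> tight n W z i" for l r
    using that by (cases "W i l") (auto simp: tight_def)
  ultimately show ?thesis using assms unfolding active_def sign_dominates_def
    by (metis minus_minus neg_equal_0_iff_equal one_neq_zero)
qed

text \<open>Column \<open>l\<close> is not above \<open>r\<close> at \<open>z\<close> and not below
  it at \<open>w\<close>, so it rises at least as much as \<open>r\<close>. As \<open>r\<close>
  rises by the largest amount, equality holds throughout.\<close>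

lemma argmax_tight_opposite:
  assumes r: "r \<in> tight n W z i" "r \<in> argmax_upto n (\<lambda>j. w j - z j)" "strop_sign (W i r) = - s"
    and dom: "sign_dominates n W s i w"
  obtains l where "l \<in> tight n W z i" "l \<in> argmax_upto n (\<lambda>j. w j - z j)" "strop_sign (W i l) = s"
proof -
  have "r \<le> n" "W i r \<noteq> SNegInf" using r by (auto simp: tight_def)
  then obtain l where l: "l \<le> n" "strop_sign (W i l) = s" "mag (W i r) + w r \<le> mag (W i l) + w l"
    using r dom unfolding sign_dominates_def by blast
  have "s \<noteq> 0" using r strop_sign_cases[OF \<open>W i r \<noteq> SNegInf\<close>] by auto
  then have "W i l \<noteq> SNegInf" using l by auto
  then have a: "mag (W i l) + z l \<le> mag (W i r) + z r" using r l unfolding tight_def by auto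
  have b: "w l - z l \<le> w r - z r" using r l unfolding argmax_upto_def by auto
  have "l \<in> tight n W z i"
    by (rule tight_of_ge[OF r(1) l(1) \<open>W i l \<noteq> SNegInf\<close>]) (use a b l in linarith)
  moreover have "l \<in> argmax_upto n (\<lambda>j. w j - z j)"
    using r(2) a b l unfolding argmax_upto_def by (smt (verit) mem_Collect_eq)
  ultimately show thesis using that l by blast
qed

lemma argmax_upto_nonempty: "argmax_upto n d \<noteq> {}"
proof -
  have "Max (d ` {..n}) \<in> d ` {..n}" by (intro Max_in) auto
  then obtain j where "j \<le> n" "Max (d ` {..n}) = d j" by (metis atMost_iff imageE)
  then have "j \<in> argmax_upto n d" unfolding argmax_upto_def
    using Max_ge[of "d ` {..n}"] by auto
  then show ?thesis by blast
qed

lemma argmax_upto_all: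
  assumes "argmax_upto n (\<lambda>j. w j - z j) = {..n}"
  shows "\<exists>c. \<forall>j\<le>n. w j = z j + c"
proof (intro exI allI impI)
  fix j assume "j \<le> n"
  then have "j \<in> argmax_upto n (\<lambda>j. w j - z j)" "0 \<in> argmax_upto n (\<lambda>j. w j - z j)"
    using assms by auto
  then show "w j = z j + (w 0 - z 0)" using \<open>j \<le> n\<close> unfolding argmax_upto_def by force
qed

lemma active_shift:
  assumes "\<forall>j\<le>n. w j = z j + c"
  shows "active n W i w \<longleftrightarrow> active n W i z"
proof -
  have "mag (W i l) + w l \<le> mag (W i j) + w j \<longleftrightarrow> mag (W i l) + z l \<le> mag (W i j) + z j"
    if "l \<le> n" "j \<le> n" for l j using assms that by simp
  then show ?thesis unfolding active_def sign_dominates_def by (simp cong: conj_cong)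
qed

text \<open>Grow the tree from the root \<open>v\<close> and match each edge with the vertex it
  newly reaches.\<close>

lemma grow_spanning_matching:
  assumes V: "finite V" "v \<in> V" and R: "finite R" "card V = Suc (card R)"
    and T: "\<And>i. i \<in> R \<Longrightarrow> card (T i) = 2 \<and> T i \<subseteq> V"
    and conn: "\<And>D. v \<in> D \<Longrightarrow> D \<subset> V \<Longrightarrow> \<exists>i\<in>R. T i \<inter> D \<noteq> {} \<and> \<not> T i \<subseteq> D"
  obtains f where "bij_betw f R (V - {v})" "\<And>i. i \<in> R \<Longrightarrow> f i \<in> T i"
proof -
  have "\<exists>D R' f. v \<in> D \<and> D \<subseteq> V \<and> card D = Suc k \<and> R' \<subseteq> R \<and> bij_betw f R' (D - {v}) \<and>
      (\<forall>i\<in>R'. f i \<in> T i \<and> T i \<subseteq> D)" if "k \<le> card R" for k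
    using that
  proof (induction k)
    case 0
    show ?case
      by (rule exI[of _ "{v}"], rule exI[of _ "{}"]) (use V in \<open>auto simp: bij_betw_def\<close>)
  next
    case (Suc k)
    then obtain D R' f where D: "v \<in> D" "D \<subseteq> V" "card D = Suc k" and R': "R' \<subseteq> R"
      and f: "bij_betw f R' (D - {v})" "\<forall>i\<in>R'. f i \<in> T i \<and> T i \<subseteq> D" by auto
    have "D \<noteq> V" using D Suc.prems R by auto
    then obtain i a b where i: "i \<in> R" "a \<in> T i" "a \<in> D" "b \<in> T i" "b \<notin> D"
      using conn[of D] D by blast
    obtain c d where "T i = {c, d}" using T[OF i(1)] card_2_iff by metis
    then have Ti: "T i = {a, b}" using i by auto
    have iR': "i \<notin> R'" using f(2) i by auto
    have finD: "finite D" using D V finite_subset by blast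
    have "bij_betw (f(i := b)) R' (D - {v})"
      using f(1) iR' by (subst bij_betw_cong[of _ _ f]) auto
    then have "bij_betw (f(i := b)) (insert i R') (insert b (D - {v}))"
      using bij_betw_combine[of "f(i := b)" R' "D - {v}" "{i}" "{b}"] i(5) by (auto simp: bij_betw_def)
    moreover have "insert b (D - {v}) = insert b D - {v}" using D i by auto
    ultimately have "bij_betw (f(i := b)) (insert i R') (insert b D - {v})" by simp
    moreover have "\<forall>j\<in>insert i R'. (f(i := b)) j \<in> T j \<and> T j \<subseteq> insert b D"
      using f(2) iR' Ti i by auto
    moreover have "insert b D \<subseteq> V" using D i T[OF i(1)] by auto
    moreover have "card (insert b D) = Suc (Suc k)" using i finD D by simp
    ultimately show ?case using D R' i by (metis insert_iff insert_subset)
  qed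
  from this[of "card R"] obtain D R' f where *: "v \<in> D" "D \<subseteq> V" "card D = card V" "R' \<subseteq> R"
    "bij_betw f R' (D - {v})" "\<forall>i\<in>R'. f i \<in> T i" using R by auto
  have "D = V" using * V card_subset_eq by blast
  moreover from this have "card R' = card R"
    using * V R bij_betw_same_card[OF *(5)] by (simp add: card_Diff_singleton)
  then have "R' = R" using * R card_subset_eq by blast
  ultimately show thesis using * that by blast
qed

section \<open>Points with \<open>n\<close> active rows\<close>

text \<open>The end point of the motion is known through its active rows only, so the permanent
  condition of a basis is derived in \<open>is_basis\<close> instead of being part of the
  locale.\<close>

locale vertex =
  fixes m n :: nat and W :: "nat \<Rightarrow> nat \<Rightarrow> strop" and I :: "nat set" and z :: "nat \<Rightarrow> real"
  assumes adm: "admissible m n W" and I: "I \<subseteq> {..<m}" "card I = n"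
    and act: "\<And>i. i \<in> I \<Longrightarrow> active n W i z"
begin

lemma gen: "trop_generic m n W" and row_nonempty: "i < m \<Longrightarrow> \<exists>j\<le>n. W i j \<noteq> SNegInf"
  using adm unfolding admissible_def by auto

text \<open>\<open>n + 1\<close> active rows would need at least \<open>n + 2\<close>
  columns.\<close>

lemma active_other_False:
  assumes "i < m" "i \<notin> I" "active n W i z"
  shows False
proof -
  have "card (insert i I) < card {..n}"
  proof (rule generic_card_less[OF gen])
    fix e assume e: "e \<in> insert i I"
    then have "active n W e z" "e < m" using assms act I by auto
    then obtain p q where "p \<in> tight n W z e" "strop_sign (W e p) = 1"
      "q \<in> tight n W z e" "strop_sign (W e q) = -1" using active_tight row_nonempty by metis
    then show "\<exists>a b. a \<noteq> b \<and> {a, b} \<subseteq> tight n W z e \<inter> {..n}"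
      using tight_bounded[of n W z e] by (intro exI[of _ p] exI[of _ q]) auto
  qed (use assms I in auto)
  then show False using assms I finite_subset[OF I(1)] by simp
qed

text \<open>The \<open>n\<close> rows contribute at least one each to a sum below
  \<open>n + 1\<close>, so no row contributes two.\<close>

lemma card_tight:
  assumes i: "i \<in> I" shows "card (tight n W z i) = 2"
proof -
  have finI: "finite I" using I finite_subset by blast
  have ge: "2 \<le> card (tight n W z e)" if e: "e \<in> I" for e
  proof -
    have "e < m" using e I by auto
    then obtain p q where "p \<in> tight n W z e" "strop_sign (W e p) = 1"
      "q \<in> tight n W z e" "strop_sign (W e q) = -1" using active_tight[OF act[OF e]] row_nonempty by metis
    then have "p \<noteq> q" "{p, q} \<subseteq> tight n W z e" by auto
    then show ?thesis using card_mono[OF finite_tight, of "{p, q}" n W z e] by simp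
  qed
  have "(\<Sum>e\<in>I - {i}. 1) \<le> (\<Sum>e\<in>I - {i}. card (tight n W z e) - 1)"
    by (rule sum_mono) (use ge in force)
  then have "n - 1 \<le> (\<Sum>e\<in>I - {i}. card (tight n W z e) - 1)" using I i finI by simp
  moreover have "(\<Sum>e\<in>I. card (tight n W z e) - 1) < card {..n}"
    by (rule generic_forest[OF gen I(1)]) (use tight_bounded in auto)
  moreover have "(\<Sum>e\<in>I. card (tight n W z e) - 1) =
      (card (tight n W z i) - 1) + (\<Sum>e\<in>I - {i}. card (tight n W z e) - 1)"
    using finI i by (rule sum.remove)
  moreover have "n \<ge> 1" using I i finI card_gt_0_iff[of I] by auto
  ultimately show ?thesis using ge[OF i] by simp
qed

lemma tight_pair:
  assumes "i \<in> I" "p \<in> tight n W z i" "q \<in> tight n W z i" "p \<noteq> q"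
  shows "tight n W z i = {p, q}"
  using card_tight[OF assms(1)] assms(2-4) by (auto simp: card_2_iff)

lemma connected:
  assumes "D \<subseteq> {..n}" "D \<noteq> {}"
    and "\<And>i. i \<in> I \<Longrightarrow> \<exists>p q. p \<noteq> q \<and> {p, q} \<subseteq> tight n W z i \<and> (p \<in> D \<longleftrightarrow> q \<in> D)"
  shows "D = {..n}"
proof (rule generic_connected[OF gen I(1)])
  fix i assume "i \<in> I"
  then show "\<exists>a b. a \<noteq> b \<and> {a, b} \<subseteq> tight n W z i \<inter> {..n} \<and> (a \<in> D \<longleftrightarrow> b \<in> D)"
    using assms(3)[of i] tight_bounded[of n W z i] by fast
qed (use I assms(1,2) in auto)

text \<open>Dominance by one sign carries membership in one direction only. This form is kept
  because in some rows \<open>w\<close> is merely known to lie in the cone.\<close>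

lemma argmax_pair:
  assumes i: "i \<in> I" and pq: "p \<in> tight n W z i" "strop_sign (W i p) = 1"
      "q \<in> tight n W z i" "strop_sign (W i q) = -1"
    and r: "r \<in> {p, q}" "r \<in> argmax_upto n (\<lambda>j. w j - z j)"
    and dom: "sign_dominates n W (- strop_sign (W i r)) i w"
  shows "{p, q} \<subseteq> argmax_upto n (\<lambda>j. w j - z j)"
proof -
  have "tight n W z i = {p, q}" using tight_pair[OF i pq(1,3)] pq by force
  moreover have "r \<in> tight n W z i" using r pq by auto
  then obtain l where "l \<in> tight n W z i" "l \<in> argmax_upto n (\<lambda>j. w j - z j)"
    "strop_sign (W i l) = - strop_sign (W i r)"
    using argmax_tight_opposite[OF _ r(2) _ dom] by auto
  ultimately show ?thesis using r pq by auto
qed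

text \<open>Both directions of \<open>argmax_pair\<close> hold in every row, so the columns of
  largest increase are a union of components of the tree.\<close>

lemma unique:
  assumes "\<And>i. i \<in> I \<Longrightarrow> active n W i w"
  shows "\<exists>c. \<forall>j\<le>n. w j = z j + c"
proof (rule argmax_upto_all, rule connected)
  fix i assume i: "i \<in> I"
  then obtain p q where pq: "p \<in> tight n W z i" "strop_sign (W i p) = 1"
    "q \<in> tight n W z i" "strop_sign (W i q) = -1"
    using active_tight[OF act[OF i]] row_nonempty I by (metis lessThan_iff subsetD)
  have "(p \<in> argmax_upto n (\<lambda>j. w j - z j)) = (q \<in> argmax_upto n (\<lambda>j. w j - z j))"
    using argmax_pair[OF i pq, of p w] argmax_pair[OF i pq, of q w] assms[OF i] pq
    unfolding active_def by auto
  then show "\<exists>p q. p \<noteq> q \<and> {p, q} \<subseteq> tight n W z i \<and>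
      (p \<in> argmax_upto n (\<lambda>j. w j - z j) \<longleftrightarrow> q \<in> argmax_upto n (\<lambda>j. w j - z j))"
    using pq by (intro exI[of _ p] exI[of _ q]) auto
qed (use argmax_upto_nonempty in \<open>auto simp: argmax_upto_def\<close>)

text \<open>With the tree rooted at column \<open>n\<close>, the rows of \<open>I\<close> are
  matched with the columns of \<open>A\<close>, which is a permutation of finite weight.\<close>

lemma is_basis: "is_basis m n W I"
proof -
  have finI: "finite I" using I finite_subset by blast
  obtain f where f: "bij_betw f I ({..n} - {n})" "\<And>i. i \<in> I \<Longrightarrow> f i \<in> tight n W z i"
  proof (rule grow_spanning_matching[of "{..n}" n I "tight n W z"])
    fix D assume D: "n \<in> D" "D \<subset> {..n}"
    show "\<exists>i\<in>I. tight n W z i \<inter> D \<noteq> {} \<and> \<not> tight n W z i \<subseteq> D"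
    proof (rule ccontr)
      assume *: "\<not> ?thesis"
      have "D = {..n}"
      proof (rule connected)
        fix i assume "i \<in> I"
        moreover from this obtain p q where "tight n W z i = {p, q}" "p \<noteq> q"
          using card_tight by (metis card_2_iff)
        ultimately show "\<exists>p q. p \<noteq> q \<and> {p, q} \<subseteq> tight n W z i \<and> (p \<in> D) = (q \<in> D)"
          using * by (intro exI[of _ p] exI[of _ q]) auto
      qed (use D in auto)
      then show False using D by simp
    qed
  qed (use I finI card_tight tight_bounded in auto)
  have "{..n} - {n} = {..<n}" by auto
  then obtain \<sigma> where \<sigma>: "\<sigma> permutes {..<n}"
    "\<And>i. i < n \<Longrightarrow> sorted_list_of_set {..<n} ! \<sigma> i = f (sorted_list_of_set I ! i)"
    using perm_of_bij_betw[OF finI f(1)] I by metis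
  let ?N = "mod_mat (submat W I {..<n})"
  have "perm_weight n ?N \<sigma> = (\<Sum>i<n. Fin (mag (W (sorted_list_of_set I ! i) (f (sorted_list_of_set I ! i)))))"
    unfolding perm_weight_def mod_mat_def submat_def
  proof (rule sum.cong)
    fix i assume i: "i \<in> {..<n}"
    then have "sorted_list_of_set I ! i \<in> I" using I finI
      by (metis lessThan_iff nth_mem set_sorted_list_of_set sorted_list_of_set.length_sorted_key_list_of_set)
    from f(2)[OF this] show "modulus (W (sorted_list_of_set I ! i) (sorted_list_of_set {..<n} ! \<sigma> i)) =
       Fin (mag (W (sorted_list_of_set I ! i) (f (sorted_list_of_set I ! i))))"
      using \<sigma>(2) i by (auto simp: tight_def modulus_eq_Fin_mag)
  qed simp
  then have "perm_weight n ?N \<sigma> > NegInf" unfolding sum_Fin by (simp add: less_trop_def)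
  also have "perm_weight n ?N \<sigma> \<le> tper n ?N"
    unfolding tper_def using \<sigma>(1) finite_permutations[of "{..<n}"] by (intro Max_ge) auto
  finally show ?thesis unfolding is_basis_def using I by simp
qed

lemma basic_point:
  assumes x: "\<forall>j\<le>n. x j = Fin (z j)" and cone: "\<And>i. i < m \<Longrightarrow> sign_dominates n W 1 i z"
  shows "basic_point m n W I x"
  unfolding basic_point_def
proof (intro conjI ballI impI)
  show "is_basis m n W I" by (rule is_basis)
  show "x \<in> trop_face m n W I" using act cone by (simp add: trop_face_iff[OF x])
  show "nonzero_point n x" using x unfolding nonzero_point_def by auto
  fix y assume y: "y \<in> trop_face m n W I" "nonzero_point n y"
  obtain w where w: "\<forall>j\<le>n. y j = Fin (w j)" using finite_point_coords[OF adm y] .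
  then have "\<And>i. i \<in> I \<Longrightarrow> active n W i w" using y trop_face_iff[OF w] by simp
  then show "same_point n x y" unfolding same_point_coords[OF x w] by (rule unique)
qed

end

section \<open>Following a tropical edge\<close>

text \<open>\<open>p\<close> and \<open>q\<close> stand for whichever maximal columns the program
  has recorded. Only the rows of \<open>I\<close> are required to have \<open>q\<close>, since
  another row may lack negative entries.\<close>

locale pivot = vertex m n W I \<xi>
  for m n :: nat and W :: "nat \<Rightarrow> nat \<Rightarrow> strop" and I :: "nat set" and \<xi> :: "nat \<Rightarrow> real" +
  fixes k :: nat and p q :: "nat \<Rightarrow> nat"
  assumes k: "k \<in> I"
    and cone: "\<And>i. i < m \<Longrightarrow> sign_dominates n W 1 i \<xi>"
    and p: "\<And>i. i < m \<Longrightarrow> p i \<le> n \<and> strop_sign (W i (p i)) = 1"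
    and p_max: "\<And>i j. i < m \<Longrightarrow> j \<le> n \<Longrightarrow> strop_sign (W i j) = 1 \<Longrightarrow>
      mag (W i j) + \<xi> j \<le> mag (W i (p i)) + \<xi> (p i)"
    and q: "\<And>i. i \<in> I \<Longrightarrow> q i \<le> n \<and> strop_sign (W i (q i)) = -1"
    and q_max: "\<And>i j. i \<in> I \<Longrightarrow> j \<le> n \<Longrightarrow> strop_sign (W i j) = -1 \<Longrightarrow>
      mag (W i j) + \<xi> j \<le> mag (W i (q i)) + \<xi> (q i)"
begin

definition K :: "nat set" where "K = I - {k}"

text \<open>Because \<open>\<xi>\<close> lies in the cone, this is the maximum of the whole row at
  \<open>\<xi>\<close>, not only of its positive part.\<close>

definition a :: "nat \<Rightarrow> real" where "a i = mag (W i (p i)) + \<xi> (p i)"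

text \<open>The height of a column of \<open>J\<close> at time \<open>-\<beta>\<close> is
  \<open>val g i j - \<beta>\<close>. Hence the order among the columns of \<open>J\<close> never
  changes, and \<open>val\<close> has to be compared with \<open>a i + \<beta>\<close>.\<close>

abbreviation val :: "(nat \<Rightarrow> real) \<Rightarrow> nat \<Rightarrow> nat \<Rightarrow> real" where
  "val g i j \<equiv> mag (W i j) + (\<xi> j + g j)"

definition pt :: "nat set \<Rightarrow> (nat \<Rightarrow> real) \<Rightarrow> real \<Rightarrow> nat \<Rightarrow> real" where
  "pt J g \<beta> j = \<xi> j + (if j \<in> J then g j - \<beta> else 0)"

text \<open>Throughout, \<open>\<beta>\<close> is the negative of the time and \<open>g j\<close> the negative of the time at which column \<open>j\<close>
  entered \<open>J\<close>. Negated times suit the machine, whose only infinite constant is \<open>-\<infinity>\<close>: the next event is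
  then a maximum, and rows without event contribute \<open>-\<infinity>\<close>.\<close>

definition bounds :: "nat set \<Rightarrow> (nat \<Rightarrow> real) \<Rightarrow> nat set \<Rightarrow> real \<Rightarrow> bool" where
  "bounds J g D \<beta> \<longleftrightarrow>
     (\<forall>i\<in>K - D. \<forall>j\<in>J. W i j \<noteq> SNegInf \<longrightarrow> val g i j \<le> a i + \<beta>) \<and>
     (\<forall>i<m. i \<notin> K \<longrightarrow> (\<forall>j\<in>J. strop_sign (W i j) = -1 \<longrightarrow>
        val g i j \<le> a i + \<beta> \<or> (\<exists>l\<in>J. strop_sign (W i l) = 1 \<and> val g i j \<le> val g i l)))"

text \<open>What is kept of a basic point of the edge other than \<open>\<xi>\<close>: its basis has
  a row outside \<open>I\<close>, as otherwise the two bases would agree.\<close>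

definition far_basic :: "(nat \<Rightarrow> real) \<Rightarrow> bool" where
  "far_basic w \<longleftrightarrow> (\<forall>i\<in>K. active n W i w) \<and> (\<forall>i<m. sign_dominates n W 1 i w) \<and>
     (\<exists>i<m. i \<notin> I \<and> active n W i w)"

text \<open>\<open>D\<close> collects the rows of \<open>K\<close> that are done. The last conjunct says that the motion so far heads
  for every other basic point of the edge.\<close>

definition pinv :: "nat set \<Rightarrow> (nat \<Rightarrow> real) \<Rightarrow> nat set \<Rightarrow> real \<Rightarrow> bool" where
  "pinv J g D \<beta> \<longleftrightarrow> p k \<in> J \<and> J \<subseteq> {..n} \<and> D \<subseteq> K \<and> card J = Suc (card D) \<and> g (p k) = 0 \<and>
     (\<forall>j\<in>J. \<beta> \<le> g j \<and> g j \<le> 0) \<and>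
     (\<forall>i\<in>D. \<exists>r\<in>J. \<exists>c\<in>J. strop_sign (W i r) = 1 \<and> strop_sign (W i c) = -1 \<and>
        r \<in> tight n W (pt J g \<beta>) i \<and> c \<in> tight n W (pt J g \<beta>) i) \<and>
     bounds J g D \<beta> \<and>
     (\<forall>w. far_basic w \<longrightarrow> J \<subseteq> argmax_upto n (\<lambda>j. w j - pt J g \<beta> j))"

lemma K_I: "i \<in> K \<Longrightarrow> i \<in> I" and I_m: "i \<in> I \<Longrightarrow> i < m" and K_m: "i \<in> K \<Longrightarrow> i < m"
  and K_subset: "K \<subseteq> {..<m}" and finite_K: "finite K" and card_K: "Suc (card K) = n"
proof -
  have fin: "finite I" using I finite_subset by blast
  show "i \<in> K \<Longrightarrow> i \<in> I" "i \<in> I \<Longrightarrow> i < m" "i \<in> K \<Longrightarrow> i < m" "K \<subseteq> {..<m}" "finite K"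
    using I fin unfolding K_def by auto
  show "Suc (card K) = n" using I k fin unfolding K_def by (metis card.remove)
qed

lemma le_a:
  assumes "i < m" "j \<le> n" "W i j \<noteq> SNegInf" shows "mag (W i j) + \<xi> j \<le> a i"
proof (cases "strop_sign (W i j) = 1")
  case True
  then show ?thesis using p_max assms unfolding a_def by blast
next
  case False
  then have "strop_sign (W i j) = -1" using strop_sign_cases assms by blast
  then obtain l where "l \<le> n" "strop_sign (W i l) = 1" "mag (W i j) + \<xi> j \<le> mag (W i l) + \<xi> l"
    using cone[OF assms(1)] assms unfolding sign_dominates_def by blast
  then show ?thesis using p_max[OF assms(1)] unfolding a_def by force
qed

lemma p_nonzero: "i < m \<Longrightarrow> W i (p i) \<noteq> SNegInf" and q_nonzero: "i \<in> I \<Longrightarrow> W i (q i) \<noteq> SNegInf"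
  using p[of i] q[of i] by auto

lemma tight_iff:
  assumes "i < m" "j \<le> n"
  shows "j \<in> tight n W \<xi> i \<longleftrightarrow> W i j \<noteq> SNegInf \<and> mag (W i j) + \<xi> j = a i"
proof
  assume "j \<in> tight n W \<xi> i"
  then have "W i j \<noteq> SNegInf" "a i \<le> mag (W i j) + \<xi> j"
    using p[OF assms(1)] p_nonzero[OF assms(1)] unfolding tight_def a_def by auto
  then show "W i j \<noteq> SNegInf \<and> mag (W i j) + \<xi> j = a i" using le_a assms by force
next
  assume "W i j \<noteq> SNegInf \<and> mag (W i j) + \<xi> j = a i"
  then show "j \<in> tight n W \<xi> i" using le_a assms unfolding tight_def by auto
qed

lemma p_tight: "i < m \<Longrightarrow> p i \<in> tight n W \<xi> i"
  using tight_iff p p_nonzero by (simp add: a_def)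

lemma q_tight: assumes "i \<in> I" shows "q i \<in> tight n W \<xi> i"
proof -
  obtain r where r: "r \<in> tight n W \<xi> i" "strop_sign (W i r) = -1"
    using active_tight[OF act[OF assms]] row_nonempty[OF I_m[OF assms]] by metis
  then have "mag (W i r) + \<xi> r \<le> mag (W i (q i)) + \<xi> (q i)"
    using q_max[OF assms, of r] by (auto simp: tight_def)
  then show ?thesis using tight_of_ge[OF r(1)] q[OF assms] q_nonzero[OF assms] by blast
qed

lemma a_eq_q: "i \<in> I \<Longrightarrow> mag (W i (q i)) + \<xi> (q i) = a i"
  using tight_iff[of i "q i"] q_tight q I_m by blast

lemma tight_I: assumes "i \<in> I" shows "tight n W \<xi> i = {p i, q i}"
  by (rule tight_pair) (use assms p_tight q_tight I_m p[of i] q[of i] in auto)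

lemma pinvD:
  assumes "pinv J g D \<beta>"
  shows "p k \<in> J" "J \<subseteq> {..n}" "D \<subseteq> K" "card J = Suc (card D)" "g (p k) = 0"
    "\<And>j. j \<in> J \<Longrightarrow> \<beta> \<le> g j" "\<And>j. j \<in> J \<Longrightarrow> g j \<le> 0" "finite J" "finite D" "\<beta> \<le> 0"
    "bounds J g D \<beta>" "\<And>w. far_basic w \<Longrightarrow> J \<subseteq> argmax_upto n (\<lambda>j. w j - pt J g \<beta> j)"
proof -
  show 1: "p k \<in> J" "J \<subseteq> {..n}" "D \<subseteq> K" "card J = Suc (card D)" "g (p k) = 0"
    "\<And>j. j \<in> J \<Longrightarrow> \<beta> \<le> g j" "\<And>j. j \<in> J \<Longrightarrow> g j \<le> 0" "bounds J g D \<beta>"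
    "\<And>w. far_basic w \<Longrightarrow> J \<subseteq> argmax_upto n (\<lambda>j. w j - pt J g \<beta> j)"
    using assms unfolding pinv_def by blast+
  show "\<beta> \<le> 0" using 1(1,5,6) by force
  show "finite J" "finite D" using 1 finite_K finite_subset by blast+
qed

lemma pinv_done:
  assumes "pinv J g D \<beta>" "i \<in> D"
  obtains r c where "r \<in> J" "c \<in> J" "strop_sign (W i r) = 1" "strop_sign (W i c) = -1"
    "r \<in> tight n W (pt J g \<beta>) i" "c \<in> tight n W (pt J g \<beta>) i"
  using assms unfolding pinv_def by blast

text \<open>Columns of \<open>J\<close> rise together while the others stand still, so a maximal
  column of \<open>J\<close> remains maximal.\<close>

lemma tight_shift:
  assumes "r \<in> J" "r \<in> tight n W (pt J g \<beta>) i" "\<beta>' \<le> \<beta>"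
  shows "r \<in> tight n W (pt J g \<beta>') i"
proof -
  have "mag (W i l) + pt J g \<beta>' l \<le> mag (W i r) + pt J g \<beta>' r"
    if "l \<le> n" "W i l \<noteq> SNegInf" for l
  proof -
    have "mag (W i l) + pt J g \<beta> l \<le> mag (W i r) + pt J g \<beta> r"
      using assms(2) that unfolding tight_def by blast
    then show ?thesis using assms(1,3) unfolding pt_def by (auto split: if_splits)
  qed
  then show ?thesis using assms(2) unfolding tight_def by blast
qed

text \<open>By \<open>card J = Suc (card D)\<close> the done rows already form a tree on
  \<open>J\<close>; another row with two tight columns in \<open>J\<close> would close a cycle. The
  later time \<open>\<beta>'\<close> makes this available before the invariant is known to hold
  there.\<close>

lemma forest_in_J:
  assumes inv: "pinv J g D \<beta>" and i: "i < m" "i \<notin> D" and "\<beta>' \<le> \<beta>"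
    and rc: "r \<in> J" "c \<in> J" "r \<noteq> c" "r \<in> tight n W (pt J g \<beta>') i" "c \<in> tight n W (pt J g \<beta>') i"
  shows False
proof -
  note inv' = pinvD[OF inv]
  have "card (insert i D) < card J"
  proof (rule generic_card_less[OF gen])
    fix e assume e: "e \<in> insert i D"
    show "\<exists>a b. a \<noteq> b \<and> {a, b} \<subseteq> tight n W (pt J g \<beta>') e \<inter> J"
    proof (cases "e = i")
      case True
      then show ?thesis using rc by (intro exI[of _ r] exI[of _ c]) auto
    next
      case False
      then obtain r c where "r \<in> J" "c \<in> J" "strop_sign (W e r) = 1" "strop_sign (W e c) = -1"
        "r \<in> tight n W (pt J g \<beta>) e" "c \<in> tight n W (pt J g \<beta>) e"
        using pinv_done[OF inv, of e] e by auto
      then show ?thesis using tight_shift[OF _ _ assms(4)]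
        by (intro exI[of _ r] exI[of _ c]) auto
    qed
  qed (use inv' i K_subset in auto)
  then show False using inv' i by simp
qed

lemma pt_ge: "pinv J g D \<beta> \<Longrightarrow> \<xi> j \<le> pt J g \<beta> j"
  using pinvD(6)[of J g D \<beta> j] unfolding pt_def by auto

lemma undone_le_a:
  assumes "pinv J g D \<beta>" "i \<in> K - D" "j \<le> n" "W i j \<noteq> SNegInf"
  shows "mag (W i j) + pt J g \<beta> j \<le> a i"
proof (cases "j \<in> J")
  case True
  then have "val g i j \<le> a i + \<beta>" using pinvD(11)[OF assms(1)] assms unfolding bounds_def by blast
  then show ?thesis using True unfolding pt_def by simp
next
  case False
  then show ?thesis using le_a[of i j] assms K_m unfolding pt_def by auto
qed

lemma undone_tight:
  assumes inv: "pinv J g D \<beta>" and i: "i \<in> K - D" and j: "j \<le> n" "W i j \<noteq> SNegInf"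
    and "a i \<le> mag (W i j) + pt J g \<beta> j"
  shows "j \<in> tight n W (pt J g \<beta>) i"
  using assms undone_le_a[OF inv i] unfolding tight_def by force

lemma undone_tight_pq:
  assumes inv: "pinv J g D \<beta>" and i: "i \<in> K - D"
  shows "p i \<in> tight n W (pt J g \<beta>) i" "q i \<in> tight n W (pt J g \<beta>) i"
proof -
  have iI: "i \<in> I" "i < m" using i K_I K_m by auto
  show "p i \<in> tight n W (pt J g \<beta>) i"
    using undone_tight[OF inv i] p[OF iI(2)] p_nonzero[OF iI(2)] pt_ge[OF inv, of "p i"]
    by (simp add: a_def)
  show "q i \<in> tight n W (pt J g \<beta>) i"
    using undone_tight[OF inv i] q[OF iI(1)] q_nonzero[OF iI(1)] pt_ge[OF inv, of "q i"]
    by (simp add: a_eq_q[OF iI(1), symmetric])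
qed

lemma K_active:
  assumes inv: "pinv J g D \<beta>" and i: "i \<in> K"
  shows "active n W i (pt J g \<beta>)"
proof (cases "i \<in> D")
  case True
  then show ?thesis using pinv_done[OF inv True] active_if_tight_signs by metis
next
  case False
  then have "i \<in> K - D" using i by auto
  from undone_tight_pq[OF inv this] show ?thesis
    using p[OF K_m[OF i]] q[OF K_I[OF i]] active_if_tight_signs by metis
qed

text \<open>A negative column is either still below the old maximum, which \<open>p i\<close>
  maintains, or below a positive column that rises with it.\<close>

lemma pt_cone:
  assumes inv: "pinv J g D \<beta>" and i: "i < m"
  shows "sign_dominates n W 1 i (pt J g \<beta>)"
proof (cases "i \<in> K")
  case True
  then show ?thesis using K_active[OF inv] unfolding active_def by blast
next
  case False
  have pa: "a i \<le> mag (W i (p i)) + pt J g \<beta> (p i)"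
    using pt_ge[OF inv, of "p i"] unfolding a_def by simp
  show ?thesis unfolding sign_dominates_def
  proof (intro allI impI)
    fix l assume l: "l \<le> n" "strop_sign (W i l) = -1"
    consider "mag (W i l) + pt J g \<beta> l \<le> a i"
      | j where "l \<in> J" "j \<in> J" "strop_sign (W i j) = 1" "val g i l \<le> val g i j"
    proof (cases "l \<in> J")
      case True
      then have "val g i l \<le> a i + \<beta> \<or> (\<exists>j\<in>J. strop_sign (W i j) = 1 \<and> val g i l \<le> val g i j)"
        using pinvD(11)[OF inv] False i l unfolding bounds_def by blast
      then show ?thesis using that True unfolding pt_def by auto
    next
      case False
      have "W i l \<noteq> SNegInf" using l by auto
      then show ?thesis using le_a[OF i l(1)] False that(1) unfolding pt_def by simp
    qed
    then show "\<exists>j\<le>n. strop_sign (W i j) = 1 \<and> mag (W i l) + pt J g \<beta> l \<le> mag (W i j) + pt J g \<beta> j"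
    proof cases
      case 1
      then show ?thesis using pa p[OF i] by (intro exI[of _ "p i"]) auto
    next
      case 2
      then show ?thesis using pinvD(2)[OF inv] unfolding pt_def by (intro exI[of _ j]) auto
    qed
  qed
qed

section \<open>Start of the motion, passage of time, and events\<close>

lemma pinv_init: "pinv {p k} (\<lambda>_. 0) {} 0"
proof -
  have pt0: "pt {p k} (\<lambda>_. 0) 0 = \<xi>" by (auto simp: pt_def)
  have km: "k < m" using k I_m by simp
  \<comment> \<open>If \<open>p k\<close> is not among the columns that rise first, neither is
    \<open>q k\<close>, since \<open>w\<close> satisfies the inequality of row \<open>k\<close>.
    Then row \<open>k\<close> respects the set like all other rows of \<open>I\<close>, and the tree
    makes the set everything.\<close>
  have "p k \<in> argmax_upto n (\<lambda>j. w j - \<xi> j)" if w: "far_basic w" for w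
  proof (rule ccontr)
    let ?A = "argmax_upto n (\<lambda>j. w j - \<xi> j)"
    assume no: "p k \<notin> ?A"
    have "?A = {..n}"
    proof (rule connected)
      fix i assume i: "i \<in> I"
      have pq: "p i \<in> tight n W \<xi> i" "strop_sign (W i (p i)) = 1"
        "q i \<in> tight n W \<xi> i" "strop_sign (W i (q i)) = -1"
        using p_tight q_tight p q i I_m by auto
      have "sign_dominates n W 1 i w" using w I_m[OF i] unfolding far_basic_def by blast
      then have qp: "q i \<in> ?A \<Longrightarrow> p i \<in> ?A" using argmax_pair[OF i pq, of "q i" w] pq by auto
      have "p i \<in> ?A \<Longrightarrow> q i \<in> ?A"
      proof (cases "i = k")
        case False
        assume pA: "p i \<in> ?A"
        have "sign_dominates n W (-1) i w"
          using w False i unfolding far_basic_def active_def K_def by blast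
        then show ?thesis using argmax_pair[OF i pq, of "p i" w] pq pA by auto
      qed (use no in auto)
      then show "\<exists>p q. p \<noteq> q \<and> {p, q} \<subseteq> tight n W \<xi> i \<and> (p \<in> ?A \<longleftrightarrow> q \<in> ?A)"
        using qp pq by (intro exI[of _ "p i"] exI[of _ "q i"]) auto
    qed (use argmax_upto_nonempty in \<open>auto simp: argmax_upto_def\<close>)
    then show False using no p[OF km] by auto
  qed
  moreover have "bounds {p k} (\<lambda>_. 0) {} 0"
    unfolding bounds_def using le_a p[OF km] K_m by fastforce
  ultimately show ?thesis unfolding pinv_def pt0 using p[OF km] by auto
qed

text \<open>Suppose the direction towards \<open>w\<close> changes on the way, first at
  \<open>\<gamma>\<close>. No event has occurred by then, so the undone rows keep their tight pairs
  outside \<open>J\<close> and form a tree there; one column outside \<open>J\<close> that joins the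
  direction draws in all others. Then \<open>w\<close> is the point reached at
  \<open>\<gamma>\<close>, but \<open>bounds\<close> leaves no room for a new active row
  there.\<close>

lemma pinv_move:
  assumes inv: "pinv J g D \<beta>" and bd: "bounds J g D \<beta>'" and le: "\<beta>' \<le> \<beta>"
  shows "pinv J g D \<beta>'"
proof -
  note inv' = pinvD[OF inv]
  have J: "J \<subseteq> argmax_upto n (\<lambda>j. w j - pt J g \<beta>' j)" if w: "far_basic w" for w
  proof (rule ccontr)
    assume not: "\<not> ?thesis"
    have A: "w l - pt J g \<beta> l \<le> w j - pt J g \<beta> j" if "j \<in> J" "l \<le> n" for j l
      using inv'(12)[OF w] that unfolding argmax_upto_def by blast
    \<comment> \<open>By the invariant, \<open>w\<close> exceeds the shifted coordinates by this
      same amount in every column of \<open>J\<close>.\<close>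
    define d where "d = w (p k) - \<xi> (p k) - g (p k)"
    have d: "w j - \<xi> j - g j = d" if "j \<in> J" for j
    proof -
      have "p k \<le> n" "j \<le> n" using that inv'(1,2) by auto
      then show ?thesis
        using A[of j "p k"] A[of "p k" j] that inv'(1) unfolding d_def pt_def by simp
    qed
    have out: "w l - \<xi> l \<le> d + \<beta>" if "l \<le> n" "l \<notin> J" for l
      using A[OF inv'(1) that(1)] that inv'(1) unfolding d_def pt_def by simp
    obtain j l where jl: "j \<in> J" "l \<le> n" "w j - pt J g \<beta>' j < w l - pt J g \<beta>' l"
      using not inv'(2) unfolding argmax_upto_def by force
    have l: "l \<notin> J" "d + \<beta>' < w l - \<xi> l"
      using jl d[of j] d[of l] unfolding pt_def by (auto split: if_splits)
    \<comment> \<open>the point of the segment at which the direction towards \<open>w\<close> first changes\<close>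
    define V where "V = {..n} - J"
    define L where "L = Max ((\<lambda>l. w l - \<xi> l) ` V)"
    have finV: "finite V" "V \<noteq> {}" using jl l unfolding V_def by auto
    have Lge: "w l - \<xi> l \<le> L" if "l \<in> V" for l
      unfolding L_def using finV that by (intro Max_ge) auto
    have "L \<in> (\<lambda>l. w l - \<xi> l) ` V" unfolding L_def using finV by (intro Max_in) auto
    then obtain l0 where l0: "l0 \<in> V" "L = w l0 - \<xi> l0" by auto
    \<comment> \<open>At this time the distance \<open>d + \<gamma>\<close> still to be covered on
      \<open>J\<close> equals the largest one outside \<open>J\<close>.\<close>
    define \<gamma> where "\<gamma> = L - d"
    have \<gamma>: "\<beta>' < \<gamma>" "\<gamma> \<le> \<beta>"
      using Lge[of l] l jl out[of l0] l0 unfolding \<gamma>_def V_def by auto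
    let ?z = "pt J g \<gamma>"
    let ?A = "argmax_upto n (\<lambda>j. w j - ?z j)"
    have diff: "w j - ?z j = (if j \<in> J then L else w j - \<xi> j)" for j
      using d[of j] unfolding pt_def \<gamma>_def by auto
    have Aiff: "j \<in> ?A \<longleftrightarrow> w j - ?z j = L" if "j \<le> n" for j
    proof -
      have "w l - ?z l \<le> L" if "l \<le> n" for l using Lge[of l] that unfolding diff V_def by auto
      moreover have "w (p k) - ?z (p k) = L" "p k \<le> n" using inv'(1,2) diff by auto
      ultimately show ?thesis using that unfolding argmax_upto_def by (smt (verit) mem_Collect_eq)
    qed
    have "?A \<inter> V = V"
    proof (rule generic_connected[OF gen, of "K - D" _ ?z])
      \<comment> \<open>The columns outside \<open>J\<close> exceed the undone rows by one, just as
        \<open>J\<close> exceeds the done rows.\<close>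
      show "card V \<le> Suc (card (K - D))"
      proof -
        have "card V = Suc n - card J" unfolding V_def using inv'(2,8) by (simp add: card_Diff_subset)
        moreover have "card (K - D) = card K - card D"
          using inv'(3,9) by (simp add: card_Diff_subset)
        ultimately show ?thesis using inv'(4) card_K card_mono[OF finite_K inv'(3)] by simp
      qed
      show "?A \<inter> V \<noteq> {}" using l0 Aiff[of l0] diff[of l0] unfolding V_def by auto
      fix i assume i: "i \<in> K - D"
      have im: "i < m" and iI: "i \<in> I" using i K_m K_I by auto
      \<comment> \<open>Strictly before \<open>\<beta>'\<close> no column of \<open>J\<close> has
        caught up with an undone row.\<close>
      have strict: "val g i j < a i + \<gamma>" if "j \<in> J" "W i j \<noteq> SNegInf" for j
        using bd i that \<gamma> unfolding bounds_def by force
      have pJ: "p i \<notin> J"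
        using strict[of "p i"] p_nonzero[OF im] inv'(6)[of "p i"] \<gamma> unfolding a_def by force
      have qJ: "q i \<notin> J"
        using strict[of "q i"] q_nonzero[OF iI] inv'(6)[of "q i"] \<gamma> a_eq_q[OF iI] by force
      have up: "mag (W i j) + ?z j \<le> a i" if "j \<le> n" "W i j \<noteq> SNegInf" for j
        using strict[of j] le_a[OF im that] that unfolding pt_def by auto
      have pt: "p i \<in> tight n W ?z i" and qt: "q i \<in> tight n W ?z i"
        using up pJ qJ p[OF im] q[OF iI] p_nonzero[OF im] q_nonzero[OF iI] a_eq_q[OF iI] a_def[of i]
        unfolding tight_def by (auto simp: pt_def)
      have sub: "tight n W ?z i \<subseteq> {p i, q i}"
      proof
        fix j assume j: "j \<in> tight n W ?z i"
        then have jn: "j \<le> n" "W i j \<noteq> SNegInf" by (auto simp: tight_def)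
        have "mag (W i (p i)) + ?z (p i) \<le> mag (W i j) + ?z j"
          using j p[OF im] p_nonzero[OF im] unfolding tight_def by blast
        then have ge: "a i \<le> mag (W i j) + ?z j" using pJ unfolding a_def pt_def by simp
        then have "j \<notin> J" using strict[of j] jn unfolding pt_def by auto
        then have "mag (W i j) + \<xi> j = a i" using ge le_a[OF im jn] unfolding pt_def by simp
        then show "j \<in> {p i, q i}" using tight_iff[OF im jn(1)] tight_I[OF iI] jn by auto
      qed
      have act: "active n W i w" using w i unfolding far_basic_def by blast
      have "p i \<in> ?A \<longleftrightarrow> q i \<in> ?A"
      proof
        assume "p i \<in> ?A"
        then obtain j where "j \<in> tight n W ?z i" "j \<in> ?A" "strop_sign (W i j) = -1"
          using argmax_tight_opposite[OF pt, of w "-1"] act p[OF im] unfolding active_def by auto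
        then show "q i \<in> ?A" using sub p[OF im] by auto
      next
        assume "q i \<in> ?A"
        then obtain j where "j \<in> tight n W ?z i" "j \<in> ?A" "strop_sign (W i j) = 1"
          using argmax_tight_opposite[OF qt, of w 1] act q[OF iI] unfolding active_def by auto
        then show "p i \<in> ?A" using sub q[OF iI] by auto
      qed
      moreover have "p i \<noteq> q i" using p[OF im] q[OF iI] by auto
      ultimately show "\<exists>x y. x \<noteq> y \<and> {x, y} \<subseteq> tight n W ?z i \<inter> V \<and> (x \<in> ?A \<inter> V \<longleftrightarrow> y \<in> ?A \<inter> V)"
        using pt qt pJ qJ p[OF im] q[OF iI] unfolding V_def
        by (intro exI[of _ "p i"] exI[of _ "q i"]) auto
    qed (use K_subset in \<open>auto simp: V_def\<close>)
    then have "w j = ?z j + L" if "j \<le> n" for j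
      using that Aiff[of j] diff[of j] unfolding V_def by (cases "j \<in> J") auto
    then have shift: "active n W i w \<longleftrightarrow> active n W i ?z" for i by (intro active_shift) blast
    obtain i where i: "i < m" "i \<notin> I" "active n W i ?z"
      using w shift unfolding far_basic_def by blast
    obtain r where r: "r \<in> tight n W ?z i" "strop_sign (W i r) = -1"
      using active_tight[OF i(3) row_nonempty[OF i(1)]] by metis
    have rn: "r \<le> n" "W i r \<noteq> SNegInf" using r by (auto simp: tight_def)
    have "\<xi> (p i) \<le> ?z (p i)" using inv'(6)[of "p i"] \<gamma> unfolding pt_def by auto
    moreover have "mag (W i (p i)) + ?z (p i) \<le> mag (W i r) + ?z r"
      using r p[OF i(1)] p_nonzero[OF i(1)] unfolding tight_def by blast
    ultimately have ge: "a i \<le> mag (W i r) + ?z r" unfolding a_def by simp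
    show False
    \<comment> \<open>A negative tight column in \<open>J\<close> comes with a positive one in
      \<open>J\<close>, which closes a cycle. One outside \<open>J\<close> was already tight at
      \<open>\<xi>\<close>, where no row outside \<open>I\<close> is active.\<close>
    proof (cases "r \<in> J")
      case True
      then have "\<not> val g i r \<le> a i + \<beta>'" using ge \<gamma> unfolding pt_def by simp
      moreover have "i \<notin> K" using i K_I by blast
      ultimately obtain c where c: "c \<in> J" "strop_sign (W i c) = 1" "val g i r \<le> val g i c"
        using bd True r i(1) unfolding bounds_def by blast
      have "c \<in> tight n W ?z i"
        by (rule tight_of_ge[OF r(1)]) (use c True inv'(2) in \<open>auto simp: pt_def\<close>)
      then show False using forest_in_J[OF inv i(1) _ \<gamma>(2) True c(1)] r c i K_I inv'(3) by fastforce
    next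
      case False
      then have "mag (W i r) + \<xi> r = a i" using ge le_a[OF i(1) rn] unfolding pt_def by simp
      then have "r \<in> tight n W \<xi> i" using tight_iff[OF i(1) rn(1)] rn by blast
      then have "active n W i \<xi>"
        using active_if_tight_signs p_tight[OF i(1)] p[OF i(1)] r(2) by blast
      then show False using active_other_False i by blast
    qed
  qed
  have "\<beta>' \<le> g j" if "j \<in> J" for j using inv'(6)[OF that] le by simp
  moreover have "\<forall>i\<in>D. \<exists>r\<in>J. \<exists>c\<in>J. strop_sign (W i r) = 1 \<and> strop_sign (W i c) = -1 \<and>
        r \<in> tight n W (pt J g \<beta>') i \<and> c \<in> tight n W (pt J g \<beta>') i"
    using pinv_done[OF inv] tight_shift[OF _ _ le] by metis
  ultimately show ?thesis unfolding pinv_def using inv' bd J by blast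
qed

text \<open>The acyclicity of \<open>J\<close> forbids a second tight column of row \<open>i\<close>
  in \<open>J\<close>, so the column of opposite sign that \<open>w\<close> calls for lies outside,
  where \<open>c\<close> is the only choice. Setting \<open>g c = \<beta>\<close> means that
  \<open>c\<close> has not been raised yet, so the current point is unchanged.\<close>

lemma pinv_add:
  assumes inv: "pinv J g D \<beta>" and i: "i \<in> K - D" and r: "r \<in> J" "W i r \<noteq> SNegInf" "val g i r = a i + \<beta>"
    and c: "c = (if strop_sign (W i r) = 1 then q i else p i)"
  shows "c \<notin> J" "pinv (insert c J) (g(c := \<beta>)) (insert i D) \<beta>"
proof -
  note inv' = pinvD[OF inv]
  have im: "i < m" and iI: "i \<in> I" using i K_m K_I by auto
  have rn: "r \<le> n" using r inv'(2) by auto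
  have rt: "r \<in> tight n W (pt J g \<beta>) i"
    by (rule undone_tight[OF inv i rn r(2)]) (use r in \<open>simp add: pt_def\<close>)
  have ct: "c \<in> tight n W (pt J g \<beta>) i" using undone_tight_pq[OF inv i] c by simp
  have cs: "strop_sign (W i c) = - strop_sign (W i r)"
    using c strop_sign_cases[OF r(2)] p[OF im] q[OF iI] by auto
  have cn: "c \<le> n" "W i c \<noteq> SNegInf" using ct by (auto simp: tight_def)
  have rc: "r \<noteq> l" if "strop_sign (W i l) = - strop_sign (W i r)" for l
    using that strop_sign_cases[OF r(2)] by auto
  show cJ: "c \<notin> J" using forest_in_J[OF inv im _ order_refl r(1) _ rc[OF cs] rt ct] i by auto
  let ?J = "insert c J" and ?g = "g(c := \<beta>)" and ?D = "insert i D"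
  have ptg: "pt ?J ?g \<beta> = pt J g \<beta>" using cJ by (auto simp: pt_def)
  have gJ: "?g j = g j" if "j \<in> J" for j using that cJ by auto
  have new: "mag (W e c) + (\<xi> c + \<beta>) \<le> a e + \<beta>" if "e < m" "W e c \<noteq> SNegInf" for e
    using le_a[OF that(1) cn(1) that(2)] by simp
  have b1: "val ?g e j \<le> a e + \<beta>" if "e \<in> K - ?D" "j \<in> ?J" "W e j \<noteq> SNegInf" for e j
  proof (cases "j = c")
    case True
    then show ?thesis using new[of e] K_m that by auto
  next
    case False
    then show ?thesis using inv'(11) that unfolding bounds_def by auto
  qed
  have b2: "val ?g e j \<le> a e + \<beta> \<or> (\<exists>l\<in>?J. strop_sign (W e l) = 1 \<and> val ?g e j \<le> val ?g e l)"
    if "e < m" "e \<notin> K" "j \<in> ?J" "strop_sign (W e j) = -1" for e j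
  proof (cases "j = c")
    case True
    have "W e j \<noteq> SNegInf" using that by auto
    then show ?thesis using new[of e] True that by auto
  next
    case False
    then have "j \<in> J" using that by simp
    then have "val g e j \<le> a e + \<beta> \<or> (\<exists>l\<in>J. strop_sign (W e l) = 1 \<and> val g e j \<le> val g e l)"
      using inv'(11) that unfolding bounds_def by blast
    then show ?thesis using \<open>j \<in> J\<close> gJ by (metis insertCI)
  qed
  have "bounds ?J ?g ?D \<beta>" unfolding bounds_def using b1 b2 by blast
  moreover have "\<exists>x\<in>?J. \<exists>y\<in>?J. strop_sign (W e x) = 1 \<and> strop_sign (W e y) = -1 \<and>
      x \<in> tight n W (pt J g \<beta>) e \<and> y \<in> tight n W (pt J g \<beta>) e" if e: "e \<in> ?D" for e
  proof (cases "e = i")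
    case True
    then show ?thesis using strop_sign_cases[OF r(2)] cs rt ct r(1) by auto
  next
    case False
    then show ?thesis using e pinv_done[OF inv, of e] by (metis insertCI insertE)
  qed
  moreover have "?J \<subseteq> argmax_upto n (\<lambda>j. w j - pt J g \<beta> j)" if w: "far_basic w" for w
  proof -
    let ?A = "argmax_upto n (\<lambda>j. w j - pt J g \<beta> j)"
    have JA: "J \<subseteq> ?A" using inv'(12)[OF w] .
    have "active n W i w" using w i unfolding far_basic_def by blast
    then have "sign_dominates n W (- strop_sign (W i r)) i w"
      using strop_sign_cases[OF r(2)] unfolding active_def by auto
    then obtain l where l: "l \<in> tight n W (pt J g \<beta>) i" "l \<in> ?A" "strop_sign (W i l) = - strop_sign (W i r)"
      using argmax_tight_opposite[OF rt, of w "- strop_sign (W i r)"] JA r(1) by auto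
    have lJ: "l \<notin> J" using forest_in_J[OF inv im _ order_refl r(1) _ rc[OF l(3)] rt l(1)] i by auto
    have ln: "l \<le> n" "W i l \<noteq> SNegInf" using l by (auto simp: tight_def)
    have "mag (W i r) + pt J g \<beta> r \<le> mag (W i l) + pt J g \<beta> l"
      using l(1) rn r(2) unfolding tight_def by blast
    then have "a i \<le> mag (W i l) + \<xi> l" using lJ r unfolding pt_def by simp
    then have "l \<in> tight n W \<xi> i" using tight_iff[OF im ln(1)] le_a[OF im ln] ln by simp
    then have "l = c" using l(3) c tight_I[OF iI] strop_sign_cases[OF r(2)] p[OF im] q[OF iI] by auto
    then show ?thesis using l JA by auto
  qed
  moreover have "card ?J = Suc (card ?D)" using inv'(4,8,9) cJ i by auto
  moreover have "?g (p k) = 0" using inv'(1,5) cJ by auto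
  moreover have "\<beta> \<le> ?g j \<and> ?g j \<le> 0" if "j \<in> ?J" for j using that inv'(6,7,10) by auto
  ultimately show "pinv ?J ?g ?D \<beta>" unfolding pinv_def ptg
    using inv'(1,2,3) i cn by auto
qed

lemma exists_event:
  assumes inv: "pinv J g D \<beta>"
  obtains i r where "i < m" "r \<in> J" "W i r \<noteq> SNegInf"
    "i \<in> K - D \<or> i \<notin> K \<and> strop_sign (W i r) = -1 \<and>
      (\<forall>l\<in>J. strop_sign (W i l) = 1 \<longrightarrow> val g i l < val g i r)"
proof (rule ccontr)
  assume not: "\<not> thesis"
  note inv' = pinvD[OF inv]
  note event = that
  \<comment> \<open>The limit of the ray, normalised so that the columns of \<open>J\<close> stay
    finite.\<close>
  define u where "u j = (if j \<in> J then Fin (\<xi> j + g j) else NegInf)" for j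
  have "\<exists>j\<le>n. neg_part (W i l) + u l \<le> pos_part (W i j) + u j" if i: "i < m" and l: "l \<le> n" for i l
  proof (cases "l \<in> J \<and> strop_sign (W i l) = -1")
    case True
    have "\<exists>j\<in>J. strop_sign (W i j) = 1 \<and> val g i l \<le> val g i j"
    proof (cases "i \<in> D")
      case iD: True
      then obtain r where r: "r \<in> J" "strop_sign (W i r) = 1" "r \<in> tight n W (pt J g \<beta>) i"
        using pinv_done[OF inv] by metis
      have "W i l \<noteq> SNegInf" using True by auto
      then have "mag (W i l) + pt J g \<beta> l \<le> mag (W i r) + pt J g \<beta> r"
        using r l unfolding tight_def by blast
      then show ?thesis using True r unfolding pt_def by auto
    next
      case False
      have nz: "W i l \<noteq> SNegInf" using True by auto
      show ?thesis
      proof (rule ccontr)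
        assume "\<not> ?thesis"
        then have "\<forall>j\<in>J. strop_sign (W i j) = 1 \<longrightarrow> val g i j < val g i l" by (meson not_less)
        then have "i \<in> K - D \<or> i \<notin> K \<and> strop_sign (W i l) = -1 \<and>
            (\<forall>j\<in>J. strop_sign (W i j) = 1 \<longrightarrow> val g i j < val g i l)" using True False by blast
        then show False using event[OF i _ nz] True not by blast
      qed
    qed
    then obtain j where "j \<in> J" "strop_sign (W i j) = 1" "val g i l \<le> val g i j" by blast
    then show ?thesis using True inv'(2)
      by (intro exI[of _ j]) (auto simp: u_def pos_part_eq neg_part_eq)
  next
    case False
    then have "neg_part (W i l) + u l = NegInf" by (cases "W i l") (auto simp: u_def)
    then show ?thesis using l by auto
  qed
  then have "u \<in> trop_cone m n W"
    unfolding trop_cone_def row_neg_def row_pos_def Max_image_le_Max_image_iff by simp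
  moreover have "p k \<le> n" "p k \<in> J" using inv'(1,2) by auto
  then have "nonzero_point n u" unfolding nonzero_point_def u_def by auto
  ultimately have "\<forall>j\<le>n. u j \<noteq> NegInf" using adm unfolding admissible_def by blast
  then have "{..n} \<subseteq> J" unfolding u_def by (auto split: if_splits)
  then have "card {..n} \<le> card J" using card_mono[OF inv'(8)] by blast
  then show False using inv'(4) card_mono[OF finite_K inv'(3)] card_K by simp
qed

section \<open>The end point of the motion\<close>

context
  fixes J g D \<beta> i r
  assumes inv: "pinv J g D \<beta>" and i: "i < m" "i \<notin> K"
    and r: "r \<in> J" "strop_sign (W i r) = -1" "val g i r = a i + \<beta>"
    and strict: "\<And>l. l \<in> J \<Longrightarrow> strop_sign (W i l) = 1 \<Longrightarrow> val g i l < val g i r"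
begin

text \<open>Row \<open>k\<close> cannot stop the motion: \<open>p k\<close> is its maximal column
  and rises from the very beginning, so no column overtakes it.\<close>

lemma stop_not_in_I: "i \<notin> I"
proof
  assume "i \<in> I"
  then have ik: "i = k" using i unfolding K_def by simp
  have rn: "r \<le> n" "W i r \<noteq> SNegInf" using r pinvD(2)[OF inv] by auto
  have "val g i (p k) < val g i r" using strict pinvD(1)[OF inv] p[OF i(1)] ik by blast
  moreover have "val g i (p k) = a i" using pinvD(5)[OF inv] ik unfolding a_def by simp
  moreover have "val g i r \<le> a i" using le_a[OF i(1) rn] pinvD(7)[OF inv r(1)] by simp
  ultimately show False by simp
qed

text \<open>No entry of row \<open>i\<close> exceeds \<open>a i\<close>, and \<open>p i\<close> does
  not fall below it; so both \<open>r\<close> and \<open>p i\<close> are at height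
  \<open>a i\<close>.\<close>

lemma stop_tight: "r \<in> tight n W (pt J g \<beta>) i" and stop_active: "active n W i (pt J g \<beta>)"
proof -
  have rn: "r \<le> n" "W i r \<noteq> SNegInf" using r pinvD(2)[OF inv] by auto
  have up: "mag (W i j) + pt J g \<beta> j \<le> a i" if j: "j \<le> n" "W i j \<noteq> SNegInf" for j
  proof (cases "j \<in> J")
    case True
    have "val g i j \<le> a i + \<beta>"
      using strop_sign_cases[OF j(2)]
    proof
      assume "strop_sign (W i j) = 1"
      then show ?thesis using strict[OF True] r(3) by simp
    next
      assume "strop_sign (W i j) = -1"
      then have "val g i j \<le> a i + \<beta> \<or> (\<exists>l\<in>J. strop_sign (W i l) = 1 \<and> val g i j \<le> val g i l)"
        using pinvD(11)[OF inv] i True unfolding bounds_def by blast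
      then show ?thesis using strict r(3) by fastforce
    qed
    then show ?thesis using True by (simp add: pt_def)
  next
    case False
    then show ?thesis using le_a[OF i(1) j] by (simp add: pt_def)
  qed
  have "mag (W i r) + pt J g \<beta> r = a i" using r by (simp add: pt_def)
  then show rt: "r \<in> tight n W (pt J g \<beta>) i" using up rn unfolding tight_def by simp
  have "a i \<le> mag (W i (p i)) + pt J g \<beta> (p i)" using pt_ge[OF inv, of "p i"] by (simp add: a_def)
  then have "p i \<in> tight n W (pt J g \<beta>) i"
    using up p[OF i(1)] p_nonzero[OF i(1)] unfolding tight_def by force
  then show "active n W i (pt J g \<beta>)" using active_if_tight_signs rt r(2) p[OF i(1)] by blast
qed

lemma stop_vertex: "vertex m n W (insert i K) (pt J g \<beta>)"
  by unfold_locales (use adm i K_subset finite_K card_K stop_active K_active[OF inv] in auto)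

lemma stop_different: "\<not> (\<exists>c. \<forall>j\<le>n. pt J g \<beta> j = \<xi> j + c)"
proof
  assume "\<exists>c. \<forall>j\<le>n. pt J g \<beta> j = \<xi> j + c"
  then obtain c where c: "\<forall>j\<le>n. pt J g \<beta> j = \<xi> j + c" by blast
  then have "active n W i \<xi>" using stop_active active_shift[OF c] by blast
  then show False using active_other_False i stop_not_in_I by blast
qed

text \<open>The active row of \<open>w\<close> outside \<open>I\<close> may differ from
  \<open>i\<close>, so in row \<open>i\<close> only the cone inequality is available. The missing
  direction holds because the negative tight column is \<open>r\<close>, which lies in
  \<open>J\<close>.\<close>

lemma stop_far_basic:
  assumes w: "far_basic w" shows "\<exists>c. \<forall>j\<le>n. w j = pt J g \<beta> j + c"
proof -
  interpret y: vertex m n W "insert i K" "pt J g \<beta>" by (rule stop_vertex)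
  let ?A = "argmax_upto n (\<lambda>j. w j - pt J g \<beta> j)"
  have JA: "J \<subseteq> ?A" using pinvD(12)[OF inv w] .
  have "?A = {..n}"
  proof (rule y.connected)
    fix e assume e: "e \<in> insert i K"
    then have em: "e < m" using i K_m by auto
    obtain u v where uv: "u \<in> tight n W (pt J g \<beta>) e" "strop_sign (W e u) = 1"
      "v \<in> tight n W (pt J g \<beta>) e" "strop_sign (W e v) = -1"
      using active_tight[OF y.act[OF e] row_nonempty[OF em]] .
    have "sign_dominates n W 1 e w" using w em unfolding far_basic_def by blast
    then have vu: "v \<in> ?A \<Longrightarrow> u \<in> ?A" using y.argmax_pair[OF e uv, of v w] uv by auto
    have "u \<in> ?A \<Longrightarrow> v \<in> ?A"
    proof (cases "e = i")
      case True
      have "tight n W (pt J g \<beta>) i = {u, v}" using y.tight_pair[OF e uv(1,3)] uv True by force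
      then have "v = r" using stop_tight uv r True by auto
      then show ?thesis using JA r by auto
    next
      case False
      assume "u \<in> ?A"
      moreover have "sign_dominates n W (-1) e w"
        using w False e unfolding far_basic_def active_def by blast
      ultimately show ?thesis using y.argmax_pair[OF e uv, of u w] uv by auto
    qed
    then show "\<exists>p q. p \<noteq> q \<and> {p, q} \<subseteq> tight n W (pt J g \<beta>) e \<and> (p \<in> ?A \<longleftrightarrow> q \<in> ?A)"
      using vu uv by (intro exI[of _ u] exI[of _ v]) auto
  qed (use argmax_upto_nonempty in \<open>auto simp: argmax_upto_def\<close>)
  then show ?thesis by (rule argmax_upto_all)
qed

lemma stop_basic:
  assumes y: "\<forall>j\<le>n. y j = Fin (pt J g \<beta> j)"
  shows "basic_point m n W (insert i K) y"
  using vertex.basic_point[OF stop_vertex y] pt_cone[OF inv] by blast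

lemma stop_other:
  assumes x: "\<forall>j\<le>n. x j = Fin (\<xi> j)" and y: "\<forall>j\<le>n. y j = Fin (pt J g \<beta> j)"
  shows "other_basic_point m n W K x y"
  unfolding other_basic_point_def
proof (intro conjI allI impI)
  show "\<exists>J. basic_point m n W J y" using stop_basic[OF y] by blast
  show "y \<in> trop_face m n W K" using K_active[OF inv] pt_cone[OF inv] by (simp add: trop_face_iff[OF y])
  show "\<not> same_point n x y" using stop_different by (simp add: same_point_coords[OF x y])
  fix J' z assume z: "basic_point m n W J' z \<and> z \<in> trop_face m n W K"
  then have bz: "z \<in> trop_face m n W J'" "nonzero_point n z" "J' \<subseteq> {..<m}" "card J' = n"
    unfolding basic_point_def is_basis_def by auto
  obtain w where w: "\<forall>j\<le>n. z j = Fin (w j)" using finite_point_coords[OF adm bz(1,2)] .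
  have actJ: "active n W e w" if "e \<in> J'" for e using bz that by (simp add: trop_face_iff[OF w])
  have actK: "active n W e w" if "e \<in> K" for e using z that by (simp add: trop_face_iff[OF w])
  have cw: "\<forall>e<m. sign_dominates n W 1 e w" using z by (simp add: trop_face_iff[OF w])
  show "same_point n x z \<or> same_point n y z"
  proof (cases "J' \<subseteq> I")
    case True
    then have "J' = I" using I bz(4) by (metis card_subset_eq finite_lessThan finite_subset)
    then have "\<exists>c. \<forall>j\<le>n. w j = \<xi> j + c" using unique actJ by blast
    then show ?thesis by (simp add: same_point_coords[OF x w])
  next
    case False
    then have "far_basic w" unfolding far_basic_def using actJ actK cw bz(3) by blast
    from stop_far_basic[OF this] show ?thesis by (simp add: same_point_coords[OF y w])
  qed
qed

end

end

section \<open>Resource-bounded execution\<close>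

lemma nfits_mono: "nfits B s e \<Longrightarrow> B \<le> B' \<Longrightarrow> nfits B' s e"
  by (induction e) auto

lemma tfits_mono: "tfits B s e \<Longrightarrow> B \<le> B' \<Longrightarrow> tfits B' s e"
  by (induction e) (auto intro: nfits_mono)

lemma bfits_mono: "bfits B s e \<Longrightarrow> B \<le> B' \<Longrightarrow> bfits B' s e"
  by (induction e) (auto intro: nfits_mono tfits_mono)

text \<open>Allows the program to be run under a small word bound, on which the estimate of space
  depends.\<close>

lemma exec_mono: "exec B c s t S s' \<Longrightarrow> B \<le> B' \<Longrightarrow> exec B' c s t S s'"
  by (induction rule: exec.induct)
    (blast intro: exec.intros nfits_mono tfits_mono bfits_mono)+

fun narrays :: "nexp \<Rightarrow> nat set" where
  "narrays (NLit c) = {}"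
| "narrays (NGet r a) = insert r (narrays a)"
| "narrays (NAdd d e) = narrays d \<union> narrays e"
| "narrays (NSub d e) = narrays d \<union> narrays e"
| "narrays (NMul d e) = narrays d \<union> narrays e"

fun tarrays :: "texp \<Rightarrow> nat set" where
  "tarrays TNegInf = {}"
| "tarrays TZero = {}"
| "tarrays (TGet r a) = insert r (narrays a)"
| "tarrays (TAdd d e) = tarrays d \<union> tarrays e"
| "tarrays (TSub d e) = tarrays d \<union> tarrays e"

fun barrays :: "bexp \<Rightarrow> nat set" where
  "barrays (NLe d e) = narrays d \<union> narrays e"
| "barrays (TLe d e) = tarrays d \<union> tarrays e"
| "barrays (BNot b) = barrays b"
| "barrays (BAnd b c) = barrays b \<union> barrays c"

fun carrays :: "com \<Rightarrow> nat set" where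
  "carrays Skip = {}"
| "carrays (NPut r a e) = insert r (narrays a \<union> narrays e)"
| "carrays (TPut r a e) = insert r (narrays a \<union> tarrays e)"
| "carrays (Seq c d) = carrays c \<union> carrays d"
| "carrays (Cond b c d) = barrays b \<union> carrays c \<union> carrays d"
| "carrays (While b c) = barrays b \<union> carrays c"

definition cells_upto :: "nat set \<Rightarrow> nat \<Rightarrow> cell set" where
  "cells_upto R B = {NCell r a | r a. r \<in> R \<and> a \<le> B} \<union> {TCell r a | r a. r \<in> R \<and> a \<le> B}"

lemma nfits_nval: "nfits B s e \<Longrightarrow> nval s e \<le> B"
  by (cases e) auto

lemma ncells_upto: "nfits B s e \<Longrightarrow> narrays e \<subseteq> R \<Longrightarrow> ncells s e \<subseteq> cells_upto R B"
  by (induction e) (auto simp: cells_upto_def nfits_nval)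

lemma tcells_upto: "tfits B s e \<Longrightarrow> tarrays e \<subseteq> R \<Longrightarrow> tcells s e \<subseteq> cells_upto R B"
proof (induction e)
  case (TGet r a)
  then show ?case using ncells_upto[of B s a R] by (auto simp: cells_upto_def nfits_nval)
qed auto

lemma bcells_upto: "bfits B s e \<Longrightarrow> barrays e \<subseteq> R \<Longrightarrow> bcells s e \<subseteq> cells_upto R B"
proof (induction e)
  case (NLe d e)
  then show ?case using ncells_upto[of B s d R] ncells_upto[of B s e R] by simp
next
  case (TLe d e)
  then show ?case using tcells_upto[of B s d R] tcells_upto[of B s e R] by simp
qed auto

text \<open>Every address is the value of an expression that fits, hence at most \<open>B\<close>.
  Of the program, only the arrays that it names matter.\<close>

lemma exec_cells_upto: "exec B c s t S s' \<Longrightarrow> carrays c \<subseteq> R \<Longrightarrow> S \<subseteq> cells_upto R B"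
proof (induction rule: exec.induct)
  case (exec_NPut s a e r)
  then show ?case using ncells_upto[of B s a R] ncells_upto[of B s e R] nfits_nval[of B s a]
    by (auto simp: cells_upto_def)
next
  case (exec_TPut s a e r)
  then show ?case using ncells_upto[of B s a R] tcells_upto[of B s e R] nfits_nval[of B s a]
    by (auto simp: cells_upto_def)
qed (use bcells_upto in \<open>(simp; blast)+\<close>)

lemma cells_upto_lessThan:
  "finite (cells_upto {..<R} B)" "card (cells_upto {..<R} B) \<le> 2 * (R * Suc B)"
proof -
  have eq: "cells_upto {..<R} B = case_prod NCell ` ({..<R} \<times> {..B}) \<union> case_prod TCell ` ({..<R} \<times> {..B})"
    unfolding cells_upto_def by auto
  show "finite (cells_upto {..<R} B)" unfolding eq by auto
  have "card (case_prod f ` ({..<R} \<times> {..B})) \<le> R * Suc B" for f :: "nat \<Rightarrow> nat \<Rightarrow> cell"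
    using card_image_le[of "{..<R} \<times> {..B}" "case_prod f"] by (simp add: card_cartesian_product)
  from add_mono[OF this[of NCell] this[of TCell]]
  show "card (cells_upto {..<R} B) \<le> 2 * (R * Suc B)"
    unfolding eq using card_Un_le[of "case_prod NCell ` ({..<R} \<times> {..B})" "case_prod TCell ` ({..<R} \<times> {..B})"]
    by simp
qed

section \<open>Total correctness with a time bound\<close>

text \<open>The set of touched cells is left out because \<open>exec_cells_upto\<close> bounds it
  separately.\<close>

definition runs :: "nat \<Rightarrow> com \<Rightarrow> state \<Rightarrow> nat \<Rightarrow> (state \<Rightarrow> bool) \<Rightarrow> bool" where
  "runs B c s T Q \<longleftrightarrow> (\<exists>t S s'. exec B c s t S s' \<and> t \<le> T \<and> Q s')"

lemma runs_conseq:
  "runs B c s T Q \<Longrightarrow> T \<le> T' \<Longrightarrow> (\<And>s'. Q s' \<Longrightarrow> Q' s') \<Longrightarrow> runs B c s T' Q'"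
  unfolding runs_def by (meson order_trans)

lemma runs_Seq:
  assumes "runs B c s T P" "\<And>s'. P s' \<Longrightarrow> runs B d s' T' Q"
  shows "runs B (Seq c d) s (T + T') Q"
proof -
  obtain t S s' where 1: "exec B c s t S s'" "t \<le> T" "P s'" using assms(1) unfolding runs_def by blast
  obtain t' S' s'' where 2: "exec B d s' t' S' s''" "t' \<le> T'" "Q s''"
    using assms(2)[OF 1(3)] unfolding runs_def by blast
  show ?thesis unfolding runs_def using exec_Seq[OF 1(1) 2(1)] 1 2 add_mono by blast
qed

text \<open>Symbolic execution of loop-free code. A loop has precondition \<open>False\<close>, so
  the dummy cost \<open>0\<close> that \<open>ccost\<close> gives it is harmless.\<close>

fun wp :: "nat \<Rightarrow> com \<Rightarrow> (state \<Rightarrow> bool) \<Rightarrow> state \<Rightarrow> bool" where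
  "wp B Skip Q s \<longleftrightarrow> Q s"
| "wp B (NPut r a e) Q s \<longleftrightarrow> nfits B s a \<and> nfits B s e \<and> Q (nput r (nval s a) (nval s e) s)"
| "wp B (TPut r a e) Q s \<longleftrightarrow> nfits B s a \<and> tfits B s e \<and> Q (tput r (nval s a) (tval s e) s)"
| "wp B (Seq c d) Q s \<longleftrightarrow> wp B c (wp B d Q) s"
| "wp B (Cond b c d) Q s \<longleftrightarrow> bfits B s b \<and> (if bval s b then wp B c Q s else wp B d Q s)"
| "wp B (While b c) Q s \<longleftrightarrow> False"

text \<open>Both branches of a conditional are charged; the bound stays a number that does not
  depend on the state.\<close>

fun ccost :: "com \<Rightarrow> nat" where
  "ccost Skip = 1"
| "ccost (NPut r a e) = 1 + ncost a + ncost e"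
| "ccost (TPut r a e) = 1 + ncost a + tcost e"
| "ccost (Seq c d) = ccost c + ccost d"
| "ccost (Cond b c d) = 1 + bcost b + (ccost c + ccost d)"
| "ccost (While b c) = 0"

lemma runs_wp: "wp B c Q s \<Longrightarrow> runs B c s (ccost c) Q"
proof (induction c arbitrary: Q s)
  case Skip
  then show ?case unfolding runs_def wp.simps ccost.simps using exec_Skip by blast
next
  case (NPut r a e)
  then show ?case unfolding runs_def wp.simps ccost.simps using exec_NPut by blast
next
  case (TPut r a e)
  then show ?case unfolding runs_def wp.simps ccost.simps using exec_TPut by blast
next
  case (Seq c d)
  from Seq.prems have "runs B c s (ccost c) (wp B d Q)" using Seq.IH(1) by simp
  then show ?case using runs_Seq Seq.IH(2) by simp
next
  case (Cond b c d)
  have fits: "bfits B s b" using Cond.prems by simp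
  show ?case
  proof (cases "bval s b")
    case True
    then obtain t S s' where *: "exec B c s t S s'" "t \<le> ccost c" "Q s'"
      using Cond.prems Cond.IH(1)[of Q s] unfolding runs_def by auto
    then show ?thesis unfolding runs_def using exec_Cond_True[OF fits True *(1)]
      by (intro exI conjI) auto
  next
    case False
    then obtain t S s' where *: "exec B d s t S s'" "t \<le> ccost d" "Q s'"
      using Cond.prems Cond.IH(2)[of Q s] unfolding runs_def by auto
    then show ?thesis unfolding runs_def using exec_Cond_False[OF fits False *(1)]
      by (intro exI conjI) auto
  qed
qed simp

lemma runs_While:
  assumes fits: "\<And>j s. Inv j s \<Longrightarrow> bfits B s b"
    and body: "\<And>j s. Inv j s \<Longrightarrow> bval s b \<Longrightarrow> j < N \<and> runs B c s T (Inv (Suc j))"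
    and init: "Inv 0 s"
  shows "runs B (While b c) s (N * (1 + bcost b + T) + (1 + bcost b)) (\<lambda>s'. \<exists>j\<le>N. Inv j s' \<and> \<not> bval s' b)"
proof -
  let ?c = "1 + bcost b"
  let ?Q = "\<lambda>s'. \<exists>j\<le>N. Inv j s' \<and> \<not> bval s' b"
  have "runs B (While b c) s (d * (?c + T) + ?c) ?Q" if "Inv j s" "N - j = d" "j \<le> N" for d j s
    using that
  proof (induction d arbitrary: j s)
    case 0
    then have "\<not> bval s b" using body by fastforce
    then show ?case unfolding runs_def using exec_While_False[OF fits[OF 0(1)], of c] 0 by force
  next
    case (Suc d)
    show ?case
    proof (cases "bval s b")
      case True
      then have j: "j < N" and "runs B c s T (Inv (Suc j))" using body Suc.prems by auto
      then obtain t S s1 where 1: "exec B c s t S s1" "t \<le> T" "Inv (Suc j) s1"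
        unfolding runs_def by blast
      have "runs B (While b c) s1 (d * (?c + T) + ?c) ?Q"
        using Suc.IH[OF 1(3)] Suc.prems j by simp
      then obtain t' S' s2 where 2: "exec B (While b c) s1 t' S' s2" "t' \<le> d * (?c + T) + ?c" "?Q s2"
        unfolding runs_def by blast
      have "?c + t + t' \<le> Suc d * (?c + T) + ?c" using 1 2 by simp
      then show ?thesis
        using exec_While_True[OF fits[OF Suc.prems(1)] True 1(1) 2(1)] 2(3) unfolding runs_def by blast
    next
      case False
      then show ?thesis unfolding runs_def
        using exec_While_False[OF fits[OF Suc.prems(1)] False, of c] Suc.prems by force
    qed
  qed
  from this[OF init] show ?thesis by simp
qed

lemma runs_loop:
  assumes "runs B c s T (Inv 0)" "\<And>j s. Inv j s \<Longrightarrow> bfits B s b"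
    and "\<And>j s. Inv j s \<Longrightarrow> bval s b \<Longrightarrow> j < N \<and> runs B d s T' (Inv (Suc j))"
    and "\<And>j s. Inv j s \<Longrightarrow> \<not> bval s b \<Longrightarrow> Q s"
    and "T + (N * (1 + bcost b + T') + (1 + bcost b)) \<le> T''"
  shows "runs B (Seq c (While b d)) s T'' Q"
proof -
  have "runs B (Seq c (While b d)) s (T + (N * (1 + bcost b + T') + (1 + bcost b)))
      (\<lambda>s'. \<exists>j\<le>N. Inv j s' \<and> \<not> bval s' b)"
    by (rule runs_Seq[OF assms(1)], rule runs_While) (use assms(2,3) in blast)+
  then show ?thesis by (rule runs_conseq) (use assms(4,5) in auto)
qed

lemma nmem_nput [simp]: "nmem (nput r a v s) = (nmem s)(r := (nmem s r)(a := v))"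
  and tmem_nput [simp]: "tmem (nput r a v s) = tmem s"
  and nmem_tput [simp]: "nmem (tput r a w s) = nmem s"
  and tmem_tput [simp]: "tmem (tput r a w s) = (tmem s)(r := (tmem s r)(a := w))"
  by (simp_all add: nput_def tput_def)

section \<open>Selecting the next event\<close>

text \<open>\<open>NegInf\<close> is the maximum when no entry of the sign in question is present;
  the recorded column is then meaningless.\<close>

definition row_max :: "nat \<Rightarrow> (nat \<Rightarrow> nat \<Rightarrow> strop) \<Rightarrow> (strop \<Rightarrow> trop) \<Rightarrow> nat set \<Rightarrow> (nat \<Rightarrow> trop) \<Rightarrow>
    (nat \<Rightarrow> trop) \<Rightarrow> (nat \<Rightarrow> nat) \<Rightarrow> bool" where
  "row_max m W part J Y A arg \<longleftrightarrow> (\<forall>i<m. (\<forall>j\<in>J. part (W i j) + Y j \<le> A i) \<and>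
     (A i = NegInf \<or> arg i \<in> J \<and> A i = part (W i (arg i)) + Y (arg i)))"

lemma NegInf_less: "NegInf < y \<longleftrightarrow> y \<noteq> NegInf"
  by (cases y) (auto simp: less_trop_def)

lemma le_NegInf: "y \<le> NegInf \<longleftrightarrow> y = NegInf"
  by (cases y) auto

lemma not_less_NegInf: "\<not> y < NegInf"
  by (simp add: less_trop_def)

lemma row_max_insert:
  assumes "row_max m W part J Y A arg" "\<And>j. j \<in> J \<Longrightarrow> Y' j = Y j"
    and A': "\<And>i. i < m \<Longrightarrow> A' i = max (A i) (part (W i c) + Y' c)"
    and arg': "\<And>i. i < m \<Longrightarrow> arg' i = (if A i < part (W i c) + Y' c then c else arg i)"
  shows "row_max m W part (insert c J) Y' A' arg'"
  unfolding row_max_def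
proof (intro allI impI)
  fix i assume i: "i < m"
  have old: "\<And>j. j \<in> J \<Longrightarrow> part (W i j) + Y' j \<le> A i"
    "A i = NegInf \<or> arg i \<in> J \<and> A i = part (W i (arg i)) + Y' (arg i)"
    using assms(1,2) i unfolding row_max_def by auto
  show "(\<forall>j\<in>insert c J. part (W i j) + Y' j \<le> A' i) \<and>
     (A' i = NegInf \<or> arg' i \<in> insert c J \<and> A' i = part (W i (arg' i)) + Y' (arg' i))"
    using old A'[OF i] arg'[OF i] by (auto simp: max_def le_NegInf NegInf_less intro: order_trans)
qed

text \<open>The negated time of the next event of row \<open>i\<close>. Undone rows of
  \<open>K\<close> react to the larger maximum of either sign, rows outside \<open>K\<close> only to
  a negative maximum above the positive one. Everything else yields \<open>NegInf\<close>, partly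
  through the convention for \<open>trop_diff\<close>.\<close>

definition candidate :: "(nat \<Rightarrow> nat) \<Rightarrow> (nat \<Rightarrow> trop) \<Rightarrow> (nat \<Rightarrow> trop) \<Rightarrow> (nat \<Rightarrow> trop) \<Rightarrow> nat \<Rightarrow> trop" where
  "candidate kind A P N i =
     (if kind i \<le> 1 \<and> \<not> N i \<le> P i then trop_diff (N i) (A i)
      else if kind i = 1 then trop_diff (P i) (A i) else NegInf)"

context pivot
begin

definition kind_of :: "nat set \<Rightarrow> nat \<Rightarrow> nat" where
  "kind_of D i = (if i \<in> K then if i \<in> D then 2 else 1 else 0)"

lemma row_max_pos:
  assumes "row_max m W pos_part J Y P arg" "\<forall>j\<in>J. Y j = Fin (\<xi> j + g j)" "i < m"
  shows "\<And>j. j \<in> J \<Longrightarrow> strop_sign (W i j) = 1 \<Longrightarrow> Fin (val g i j) \<le> P i"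
    "P i \<noteq> NegInf \<Longrightarrow> \<exists>j\<in>J. strop_sign (W i j) = 1 \<and> P i = Fin (val g i j)"
proof -
  show "Fin (val g i j) \<le> P i" if "j \<in> J" "strop_sign (W i j) = 1" for j
  proof -
    have "pos_part (W i j) + Y j \<le> P i" using assms(1,3) that(1) unfolding row_max_def by blast
    then show ?thesis using that assms(2) by (simp add: pos_part_eq)
  qed
  assume "P i \<noteq> NegInf"
  then have "arg i \<in> J" "P i = pos_part (W i (arg i)) + Y (arg i)"
    using assms(1,3) unfolding row_max_def by blast+
  then show "\<exists>j\<in>J. strop_sign (W i j) = 1 \<and> P i = Fin (val g i j)"
    using assms(2) \<open>P i \<noteq> NegInf\<close>
    by (intro bexI[of _ "arg i"]) (auto simp: pos_part_eq split: if_splits)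
qed

lemma row_max_neg:
  assumes "row_max m W neg_part J Y N arg" "\<forall>j\<in>J. Y j = Fin (\<xi> j + g j)" "i < m"
  shows "\<And>j. j \<in> J \<Longrightarrow> strop_sign (W i j) = -1 \<Longrightarrow> Fin (val g i j) \<le> N i"
    "N i \<noteq> NegInf \<Longrightarrow> \<exists>j\<in>J. strop_sign (W i j) = -1 \<and> N i = Fin (val g i j)"
proof -
  show "Fin (val g i j) \<le> N i" if "j \<in> J" "strop_sign (W i j) = -1" for j
  proof -
    have "neg_part (W i j) + Y j \<le> N i" using assms(1,3) that(1) unfolding row_max_def by blast
    then show ?thesis using that assms(2) by (simp add: neg_part_eq)
  qed
  assume "N i \<noteq> NegInf"
  then have "arg i \<in> J" "N i = neg_part (W i (arg i)) + Y (arg i)"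
    using assms(1,3) unfolding row_max_def by blast+
  then show "\<exists>j\<in>J. strop_sign (W i j) = -1 \<and> N i = Fin (val g i j)"
    using assms(2) \<open>N i \<noteq> NegInf\<close>
    by (intro bexI[of _ "arg i"]) (auto simp: neg_part_eq split: if_splits)
qed

text \<open>Besides the event, this records how the program finds the sign of the column
  responsible: by comparing the two maxima over \<open>J\<close>.\<close>

definition selected :: "nat set \<Rightarrow> (nat \<Rightarrow> real) \<Rightarrow> nat set \<Rightarrow> real \<Rightarrow> (nat \<Rightarrow> trop) \<Rightarrow> (nat \<Rightarrow> trop) \<Rightarrow> nat \<Rightarrow> bool" where
  "selected J g D \<beta> P N i \<longleftrightarrow> i < m \<and> (\<exists>r\<in>J. W i r \<noteq> SNegInf \<and> val g i r = a i + \<beta> \<and>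
     (i \<in> K - D \<and> (strop_sign (W i r) = 1 \<longleftrightarrow> N i \<le> P i) \<or>
      i \<notin> K \<and> strop_sign (W i r) = -1 \<and> (\<forall>l\<in>J. strop_sign (W i l) = 1 \<longrightarrow> val g i l < val g i r)))"

text \<open>With negated times the largest candidate is the earliest event. That no candidate
  exceeds it gives \<open>bounds\<close> at \<open>\<beta>'\<close>; the old bounds at the selected
  row give \<open>\<beta>' \<le> \<beta>\<close>, so \<open>pinv_move\<close> applies.
  \<open>exists_event\<close> excludes \<open>best = NegInf\<close>.\<close>

lemma scan_sound:
  assumes inv: "pinv J g D \<beta>" and P: "row_max m W pos_part J Y P argp"
    and N: "row_max m W neg_part J Y N argn"
    and Y: "\<forall>j\<in>J. Y j = Fin (\<xi> j + g j)" and A: "\<And>i. i < m \<Longrightarrow> A i = Fin (a i)"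
    and kind: "\<And>i. i < m \<Longrightarrow> kind i = kind_of D i"
    and best: "\<And>i. i < m \<Longrightarrow> candidate kind A P N i \<le> best"
    and attained: "best = NegInf \<or> bi < m \<and> candidate kind A P N bi = best"
  obtains \<beta>' where "best = Fin \<beta>'" "pinv J g D \<beta>'" "selected J g D \<beta>' P N bi"
proof -
  note Pge = row_max_pos(1)[OF P Y] and Pex = row_max_pos(2)[OF P Y]
  note Nge = row_max_neg(1)[OF N Y] and Nex = row_max_neg(2)[OF N Y]
  have J_ge: "N i \<noteq> NegInf \<or> P i \<noteq> NegInf" if "i < m" "j \<in> J" "W i j \<noteq> SNegInf" for i j
    using Pge[OF that(1,2)] Nge[OF that(1,2)] strop_sign_cases[OF that(3)] by (auto simp: le_NegInf)
  \<comment> \<open>For an undone row of \<open>K\<close>, both branches of \<open>candidate\<close>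
    amount to the larger maximum minus \<open>a i\<close>.\<close>
  have cK: "\<exists>u. candidate kind A P N i = Fin (u - a i) \<and> max (N i) (P i) = Fin u"
    if "i \<in> K - D" "max (N i) (P i) \<noteq> NegInf" for i
  proof -
    have "i < m" using that K_m by auto
    moreover from this have "kind i = 1" using kind that by (simp add: kind_of_def)
    ultimately show ?thesis using that A unfolding candidate_def
      by (cases "N i"; cases "P i") (auto simp: max_def)
  qed
  have cO: "\<exists>u. candidate kind A P N i = Fin (u - a i) \<and> N i = Fin u"
    if "i < m" "i \<notin> K" "\<not> N i \<le> P i" for i
    using that A kind unfolding candidate_def kind_of_def by (cases "N i") auto
  obtain i r where ir: "i < m" "r \<in> J" "W i r \<noteq> SNegInf"
    "i \<in> K - D \<or> i \<notin> K \<and> strop_sign (W i r) = -1 \<and>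
      (\<forall>l\<in>J. strop_sign (W i l) = 1 \<longrightarrow> val g i l < val g i r)"
    using exists_event[OF inv] .
  have "candidate kind A P N i \<noteq> NegInf"
    using ir(4)
  proof
    assume "i \<in> K - D"
    moreover have "max (N i) (P i) \<noteq> NegInf" using J_ge[OF ir(1-3)] by (auto simp: max_def le_NegInf)
    ultimately show ?thesis using cK by fastforce
  next
    assume *: "i \<notin> K \<and> strop_sign (W i r) = -1 \<and>
      (\<forall>l\<in>J. strop_sign (W i l) = 1 \<longrightarrow> val g i l < val g i r)"
    have "\<not> N i \<le> P i"
    proof
      assume "N i \<le> P i"
      then have le: "Fin (val g i r) \<le> P i" using Nge[OF ir(1,2)] * order_trans by blast
      then have "P i \<noteq> NegInf" by auto
      from Pex[OF ir(1) this] show False using le * by fastforce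
    qed
    then show ?thesis using cO ir * by fastforce
  qed
  then obtain \<beta>' where \<beta>': "best = Fin \<beta>'" using best[OF ir(1)] by (cases best) (auto simp: le_NegInf)
  then have bi: "bi < m" "candidate kind A P N bi = Fin \<beta>'" using attained by auto
  have "val g i j \<le> a i + \<beta>'" if i: "i \<in> K - D" and j: "j \<in> J" "W i j \<noteq> SNegInf" for i j
  proof -
    have im: "i < m" using i K_m by auto
    have "Fin (val g i j) \<le> max (N i) (P i)"
      using Pge[OF im j(1)] Nge[OF im j(1)] strop_sign_cases[OF j(2)] by (auto simp: le_max_iff_disj)
    moreover from this have "max (N i) (P i) \<noteq> NegInf" by auto
    from cK[OF i this] obtain u where "candidate kind A P N i = Fin (u - a i)" "max (N i) (P i) = Fin u"
      by blast
    ultimately show ?thesis using best[OF im] \<beta>' by simp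
  qed
  moreover have "val g i j \<le> a i + \<beta>' \<or> (\<exists>l\<in>J. strop_sign (W i l) = 1 \<and> val g i j \<le> val g i l)"
    if i: "i < m" "i \<notin> K" and j: "j \<in> J" "strop_sign (W i j) = -1" for i j
  proof (cases "N i \<le> P i")
    case True
    then have le: "Fin (val g i j) \<le> P i" using Nge[OF i(1) j] order_trans by blast
    then have "P i \<noteq> NegInf" by auto
    from Pex[OF i(1) this] show ?thesis using le by fastforce
  next
    case False
    from cO[OF i False] obtain u where "candidate kind A P N i = Fin (u - a i)" "N i = Fin u" by blast
    then show ?thesis using best[OF i(1)] \<beta>' Nge[OF i(1) j] by auto
  qed
  ultimately have bd: "bounds J g D \<beta>'" unfolding bounds_def by blast
  have sel: "selected J g D \<beta>' P N bi"
  proof (cases "\<not> N bi \<le> P bi")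
    case True
    then have "N bi \<noteq> NegInf" by auto
    from Nex[OF bi(1) this] obtain r where r: "r \<in> J" "strop_sign (W bi r) = -1" "N bi = Fin (val g bi r)"
      by blast
    have kd: "kind bi \<le> 1" using bi(2) True unfolding candidate_def by (auto split: if_splits)
    then have "candidate kind A P N bi = Fin (val g bi r - a bi)"
      using True r(3) A[OF bi(1)] unfolding candidate_def by simp
    then have eq: "val g bi r = a bi + \<beta>'" using bi(2) by simp
    have "val g bi l < val g bi r" if "l \<in> J" "strop_sign (W bi l) = 1" for l
    proof -
      have "\<not> Fin (val g bi r) \<le> Fin (val g bi l)"
      proof
        assume "Fin (val g bi r) \<le> Fin (val g bi l)"
        then have "N bi \<le> P bi" unfolding r(3) using Pge[OF bi(1) that] by (rule order_trans)
        then show False using True by simp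
      qed
      then show ?thesis by simp
    qed
    moreover have "bi \<in> K - D \<or> bi \<notin> K" using kd kind[OF bi(1)] unfolding kind_of_def by (auto split: if_splits)
    moreover have "W bi r \<noteq> SNegInf" using r by auto
    ultimately show ?thesis using bi(1) r eq True unfolding selected_def
      by (intro conjI bexI[of _ r]) auto
  next
    case False
    then have kd: "kind bi = 1" and df: "trop_diff (P bi) (A bi) = Fin \<beta>'"
      using bi(2) unfolding candidate_def by (auto split: if_splits)
    have "P bi \<noteq> NegInf" using df by auto
    from Pex[OF bi(1) this] obtain r where r: "r \<in> J" "strop_sign (W bi r) = 1" "P bi = Fin (val g bi r)"
      by blast
    have "W bi r \<noteq> SNegInf" using r by auto
    moreover have "val g bi r = a bi + \<beta>'" using df unfolding r(3) A[OF bi(1)] by simp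
    moreover have "bi \<in> K - D"
    proof -
      have "kind_of D bi = 1" using kd kind[OF bi(1)] by simp
      then show ?thesis unfolding kind_of_def by (cases "bi \<in> K"; cases "bi \<in> D") simp_all
    qed
    ultimately show ?thesis using bi(1) r(1,2) False unfolding selected_def by blast
  qed
  then obtain r where r: "r \<in> J" "W bi r \<noteq> SNegInf" "val g bi r = a bi + \<beta>'"
    "bi \<in> K - D \<or> bi \<notin> K \<and> strop_sign (W bi r) = -1 \<and> (\<forall>l\<in>J. strop_sign (W bi l) = 1 \<longrightarrow> val g bi l < val g bi r)"
    unfolding selected_def by blast
  have "val g bi r \<le> a bi + \<beta>"
    using r(4)
  proof
    assume "bi \<in> K - D"
    then show ?thesis using pinvD(11)[OF inv] r unfolding bounds_def by blast
  next
    assume "bi \<notin> K \<and> strop_sign (W bi r) = -1 \<and> (\<forall>l\<in>J. strop_sign (W bi l) = 1 \<longrightarrow> val g bi l < val g bi r)"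
    then show ?thesis using pinvD(11)[OF inv] r(1) bi(1) unfolding bounds_def by fastforce
  qed
  then have "\<beta>' \<le> \<beta>" using r(3) by simp
  then show thesis using that[OF \<beta>' pinv_move[OF inv bd] sel] by blast
qed

end

section \<open>The pivoting program\<close>

text \<open>Natural arrays: \<open>4\<close> and \<open>5\<close> the current row and column, \<open>6\<close> the selected row, \<open>7\<close> the kind of a
  row (\<open>0\<close> outside \<open>K\<close>, \<open>1\<close> in \<open>K\<close> but not done, \<open>2\<close> done), \<open>8\<close> and \<open>9\<close> the positive and negative maximal
  columns at \<open>\<xi>\<close>, \<open>10\<close> the indicator of \<open>J\<close>, \<open>11\<close> and \<open>12\<close> the maximal columns within \<open>J\<close>. Tropical
  arrays: \<open>2\<close> the shifted coordinates \<open>\<xi> j + g j\<close> on \<open>J\<close> (the output at the end), \<open>3\<close> and \<open>4\<close> the positive and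
  negative row maxima at \<open>\<xi>\<close>, \<open>5\<close> and \<open>6\<close> those over \<open>J\<close>, \<open>7\<close> the value \<open>\<beta>\<close>, \<open>8\<close> the candidate for it.\<close>

abbreviation var :: "nat \<Rightarrow> nexp" where
  "var r \<equiv> NGet r (NLit 0)"

abbreviation rows :: nexp where "rows \<equiv> NGet 0 (NLit 0)"

abbreviation cols :: nexp where "cols \<equiv> NGet 0 (NLit 1)"

definition entry :: nexp where
  "entry = NAdd (NMul (var 4) (NAdd cols (NLit 1))) (var 5)"

abbreviation rows_left :: bexp where
  "rows_left \<equiv> BNot (NLe rows (var 4))"

abbreviation next_row :: com where
  "next_row \<equiv> NPut 4 (NLit 0) (NAdd (var 4) (NLit 1))"

definition raise_row :: "nat \<Rightarrow> nat \<Rightarrow> nat \<Rightarrow> com" where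
  "raise_row src A arg =
     Cond (BNot (TLe (TAdd (TGet 0 entry) (TGet src (var 5))) (TGet A (var 4))))
       (Seq (TPut A (var 4) (TAdd (TGet 0 entry) (TGet src (var 5)))) (NPut arg (var 4) (var 5))) Skip"

text \<open>Negative entries carry tag \<open>2\<close> and positive ones tag \<open>1\<close>, so
  two threshold tests decode the sign, and tag \<open>0\<close> falls through.\<close>

definition update_row :: "nat \<Rightarrow> nat \<Rightarrow> nat \<Rightarrow> nat \<Rightarrow> nat \<Rightarrow> com" where
  "update_row src P N argp argn =
     Seq (Cond (NLe (NLit 2) (NGet 1 entry)) (raise_row src N argn)
           (Cond (NLe (NLit 1) (NGet 1 entry)) (raise_row src P argp) Skip))
       next_row"

text \<open>One pass absorbs column \<open>var 5\<close> into the maxima of all rows. It serves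
  twice: with every column of \<open>\<xi>\<close> at the start, and with each new column of
  \<open>J\<close> later.\<close>

definition update :: "nat \<Rightarrow> nat \<Rightarrow> nat \<Rightarrow> nat \<Rightarrow> nat \<Rightarrow> com" where
  "update src P N argp argn =
     Seq (NPut 4 (NLit 0) (NLit 0)) (While rows_left (update_row src P N argp argn))"

definition scan_row :: com where
  "scan_row =
     Seq (Cond (BAnd (NLe (NGet 7 (var 4)) (NLit 1)) (BNot (TLe (TGet 6 (var 4)) (TGet 5 (var 4)))))
           (TPut 8 (NLit 0) (TSub (TGet 6 (var 4)) (TGet 3 (var 4))))
           (Cond (BAnd (NLe (NLit 1) (NGet 7 (var 4))) (NLe (NGet 7 (var 4)) (NLit 1)))
             (TPut 8 (NLit 0) (TSub (TGet 5 (var 4)) (TGet 3 (var 4))))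
             (TPut 8 (NLit 0) TNegInf)))
      (Seq (Cond (BNot (TLe (TGet 8 (NLit 0)) (TGet 7 (NLit 0))))
             (Seq (TPut 7 (NLit 0) (TGet 8 (NLit 0))) (NPut 6 (NLit 0) (var 4))) Skip)
        next_row)"

definition scan :: com where
  "scan = Seq (Seq (TPut 7 (NLit 0) TNegInf) (NPut 4 (NLit 0) (NLit 0))) (While rows_left scan_row)"

text \<open>\<open>m * (n + 1)\<close> covers the addresses in the arrays of \<open>W\<close>, while
  \<open>m\<close> and \<open>n + 1\<close> are the final values of the row and column
  counters.\<close>

locale machine =
  fixes B m n :: nat and W :: "nat \<Rightarrow> nat \<Rightarrow> strop"
  assumes B: "2 \<le> B" "m * (n + 1) \<le> B" "n + 1 \<le> B" "m \<le> B"
begin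

definition loaded :: "state \<Rightarrow> bool" where
  "loaded s \<longleftrightarrow> nmem s 0 0 = m \<and> nmem s 0 1 = n \<and>
     (\<forall>i<m. \<forall>j\<le>n. nmem s 1 (i * (n + 1) + j) = sign_tag (W i j) \<and>
        tmem s 0 (i * (n + 1) + j) = modulus (W i j))"

lemma entry_bound:
  assumes "i < m" "j \<le> n"
  shows "i * (n + 1) + j \<le> B" "i * (n + 1) \<le> B"
proof -
  have "i * (n + 1) + (n + 1) \<le> m * (n + 1)" using assms by (metis Suc_leI add.commute mult_Suc mult_le_mono1)
  then show "i * (n + 1) + j \<le> B" "i * (n + 1) \<le> B" using B assms by linarith+
qed

lemma entry_eval:
  assumes "nmem s 0 1 = n" "nmem s 4 0 < m" "nmem s 5 0 \<le> n"
  shows "nval s entry = nmem s 4 0 * (n + 1) + nmem s 5 0" "nfits B s entry"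
  using assms B entry_bound[OF assms(2,3)] unfolding entry_def by auto

text \<open>The whole memory is described, not only the cells of interest, so that preservation of
  everything else comes with it.\<close>

definition update_inv :: "nat \<Rightarrow> nat \<Rightarrow> nat \<Rightarrow> nat \<Rightarrow> nat \<Rightarrow> state \<Rightarrow> nat \<Rightarrow> state \<Rightarrow> bool" where
  "update_inv src P N argp argn s0 k s \<longleftrightarrow>
     (let c = nmem s0 5 0; u = tmem s0 src c in
      k \<le> m \<and>
      nmem s = (nmem s0)(4 := (nmem s0 4)(0 := k),
        argp := (\<lambda>i. if i < k \<and> tmem s0 P i < pos_part (W i c) + u then c else nmem s0 argp i),
        argn := (\<lambda>i. if i < k \<and> tmem s0 N i < neg_part (W i c) + u then c else nmem s0 argn i)) \<and>
      tmem s = (tmem s0)(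
        P := (\<lambda>i. if i < k then max (tmem s0 P i) (pos_part (W i c) + u) else tmem s0 P i),
        N := (\<lambda>i. if i < k then max (tmem s0 N i) (neg_part (W i c) + u) else tmem s0 N i)))"

lemma update_row_runs:
  assumes ld: "loaded s0" and c: "nmem s0 5 0 \<le> n"
    and dist: "P \<noteq> N" "P \<notin> {0, src}" "N \<notin> {0, src}" "argp \<noteq> argn" "argp \<notin> {0, 1, 4, 5}" "argn \<notin> {0, 1, 4, 5}"
    and inv: "update_inv src P N argp argn s0 k s" and k: "k < m"
  shows "runs B (update_row src P N argp argn) s (ccost (update_row src P N argp argn))
    (update_inv src P N argp argn s0 (Suc k))"
proof (rule runs_wp)
  define c where "c = nmem s0 5 0"
  define u where "u = tmem s0 src c"
  note inv' = inv[unfolded update_inv_def Let_def, folded c_def, folded u_def]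
  have nm: "nmem s = (nmem s0)(4 := (nmem s0 4)(0 := k),
        argp := (\<lambda>i. if i < k \<and> tmem s0 P i < pos_part (W i c) + u then c else nmem s0 argp i),
        argn := (\<lambda>i. if i < k \<and> tmem s0 N i < neg_part (W i c) + u then c else nmem s0 argn i))"
    and tm: "tmem s = (tmem s0)(
        P := (\<lambda>i. if i < k then max (tmem s0 P i) (pos_part (W i c) + u) else tmem s0 P i),
        N := (\<lambda>i. if i < k then max (tmem s0 N i) (neg_part (W i c) + u) else tmem s0 N i))"
    using inv' by auto
  define e where "e = k * (n + 1) + c"
  have v: "nmem s 0 0 = m" "nmem s 0 1 = n" "nmem s 4 0 = k" "nmem s 5 0 = c" "tmem s src c = u"
    "nmem s (Suc 0) e = sign_tag (W k c)" "tmem s 0 e = modulus (W k c)"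
    "tmem s P k = tmem s0 P k" "tmem s N k = tmem s0 N k"
    using ld dist k c c_def[symmetric] unfolding loaded_def nm tm e_def by (auto simp: u_def)
  have b: "k \<le> B" "c \<le> B" "Suc k \<le> B" "Suc 0 \<le> B" "2 \<le> B"
    using B k c unfolding c_def by auto
  have d: "P \<noteq> N" "N \<noteq> P" "argn \<noteq> argp" "P \<noteq> 0" "P \<noteq> src" "N \<noteq> 0" "N \<noteq> src" "argp \<noteq> argn" "argp \<noteq> 0" "argp \<noteq> Suc 0"
    "argp \<noteq> 4" "argp \<noteq> 5" "argn \<noteq> 0" "argn \<noteq> Suc 0" "argn \<noteq> 4" "argn \<noteq> 5" using dist by auto
  have ev: "nval s entry = e" "nfits B s entry"
    using entry_eval[of s] v k c unfolding c_def e_def by auto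
  have ev': "nval (tput r i w s) entry = e" "nfits B (tput r i w s) entry" for r i w
    using entry_eval[of "tput r i w s"] v k c unfolding c_def e_def by auto
  \<comment> \<open>A common normal form of the final memory, against which every branch of the
    symbolic execution is matched.\<close>
  have post: "update_inv src P N argp argn s0 (Suc k) s'" if
    "nmem s' = (nmem s)(4 := (nmem s 4)(0 := Suc k),
       argp := (nmem s argp)(k := if tmem s0 P k < pos_part (W k c) + u then c else nmem s argp k),
       argn := (nmem s argn)(k := if tmem s0 N k < neg_part (W k c) + u then c else nmem s argn k))"
    "tmem s' = (tmem s)(P := (tmem s P)(k := max (tmem s0 P k) (pos_part (W k c) + u)),
       N := (tmem s N)(k := max (tmem s0 N k) (neg_part (W k c) + u)))" for s'
    unfolding update_inv_def Let_def c_def[symmetric] u_def[symmetric] that nm tm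
    using dist k by (auto simp: fun_eq_iff less_Suc_eq)
  show "wp B (update_row src P N argp argn) (update_inv src P N argp argn s0 (Suc k)) s"
  proof (cases "W k c")
    case SNegInf
    show ?thesis unfolding update_row_def raise_row_def
      by (simp add: v b d ev ev' SNegInf) (intro conjI impI post;
        auto simp: fun_eq_iff d v SNegInf max_def le_NegInf not_less_NegInf not_le)
  next
    case (Pos w)
    show ?thesis unfolding update_row_def raise_row_def
      by (simp add: v b d ev ev' Pos) (intro conjI impI post;
        auto simp: fun_eq_iff d v Pos max_def le_NegInf not_less_NegInf not_le)
  next
    case (Neg w)
    show ?thesis unfolding update_row_def raise_row_def
      by (simp add: v b d ev ev' Neg) (intro conjI impI post;
        auto simp: fun_eq_iff d v Neg max_def le_NegInf not_less_NegInf not_le)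
  qed
qed

lemma update_row_cost: "ccost (update_row src P N argp argn) \<le> 200"
  by (simp add: update_row_def raise_row_def entry_def)

text \<open>The constants are generous: a row costs at most \<open>200\<close> by
  \<open>update_row_cost\<close>, and each test of the guard \<open>7\<close>.\<close>

lemma update_runs:
  assumes "loaded s0" "nmem s0 5 0 \<le> n"
    and "P \<noteq> N" "P \<notin> {0, src}" "N \<notin> {0, src}" "argp \<noteq> argn" "argp \<notin> {0, 1, 4, 5}" "argn \<notin> {0, 1, 4, 5}"
  shows "runs B (update src P N argp argn) s0 (300 * m + 50) (update_inv src P N argp argn s0 m)"
  unfolding update_def
proof (rule runs_loop[where Inv = "update_inv src P N argp argn s0" and N = m])
  let ?inv = "update_inv src P N argp argn s0"
  have "?inv 0 (nput 4 0 0 s0)"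
    using assms(3-) by (auto simp: update_inv_def Let_def fun_eq_iff)
  then show "runs B (NPut 4 (NLit 0) (NLit 0)) s0 (ccost (NPut 4 (NLit 0) (NLit 0))) (?inv 0)"
    by (intro runs_wp) simp
  fix j s assume inv: "?inv j s"
  have mem: "nmem s 0 0 = m" "nmem s 4 0 = j" "j \<le> m"
    using inv assms unfolding update_inv_def Let_def loaded_def by auto
  show "bfits B s rows_left" using mem B by simp
  {
    assume "bval s rows_left"
    then have "j < m" using mem by simp
    moreover from this have "runs B (update_row src P N argp argn) s 200 (?inv (Suc j))"
      using update_row_runs[OF assms inv] update_row_cost by (blast intro: runs_conseq)
    ultimately show "j < m \<and> runs B (update_row src P N argp argn) s 200 (?inv (Suc j))" by blast
  next
    assume "\<not> bval s rows_left"
    then show "?inv m s" using mem inv by simp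
  }
qed (simp add: algebra_simps)

text \<open>Array \<open>8\<close> holds scratch values only, hence the existential
  \<open>u\<close>.\<close>

definition scan_inv :: "state \<Rightarrow> nat \<Rightarrow> state \<Rightarrow> bool" where
  "scan_inv s0 k s \<longleftrightarrow> k \<le> m \<and> (\<exists>best bi u.
     nmem s = (nmem s0)(4 := (nmem s0 4)(0 := k), 6 := (nmem s0 6)(0 := bi)) \<and>
     tmem s = (tmem s0)(7 := (tmem s0 7)(0 := best), 8 := u) \<and>
     (\<forall>i<k. candidate (nmem s0 7) (tmem s0 3) (tmem s0 5) (tmem s0 6) i \<le> best) \<and>
     (best = NegInf \<or> bi < k \<and> candidate (nmem s0 7) (tmem s0 3) (tmem s0 5) (tmem s0 6) bi = best))"

lemma scan_row_runs:
  assumes inv: "scan_inv s0 k s" and k: "k < m" and kind: "nmem s0 7 k \<le> 2"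
  shows "runs B scan_row s (ccost scan_row) (scan_inv s0 (Suc k))"
proof (rule runs_wp)
  let ?c = "candidate (nmem s0 7) (tmem s0 3) (tmem s0 5) (tmem s0 6)"
  obtain best bi u where nm: "nmem s = (nmem s0)(4 := (nmem s0 4)(0 := k), 6 := (nmem s0 6)(0 := bi))"
    and tm: "tmem s = (tmem s0)(7 := (tmem s0 7)(0 := best), 8 := u)"
    and best: "\<forall>i<k. ?c i \<le> best" "best = NegInf \<or> bi < k \<and> ?c bi = best"
    using inv unfolding scan_inv_def by blast
  have b: "k \<le> B" "Suc k \<le> B" "Suc 0 \<le> B" "nmem s0 7 k \<le> B" using B k kind by auto
  define cd where "cd = ?c k"
  have post: "scan_inv s0 (Suc k) s'" if
    "nmem s' = (nmem s)(4 := (nmem s 4)(0 := Suc k), 6 := (nmem s 6)(0 := if cd \<le> best then bi else k))"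
    "tmem s' = (tmem s)(7 := (tmem s 7)(0 := if cd \<le> best then best else cd), 8 := tmem s' 8)" for s'
  proof -
    have "\<forall>i<Suc k. ?c i \<le> (if cd \<le> best then best else cd)"
      using best(1) by (auto simp: less_Suc_eq cd_def intro: order_trans)
    moreover have "(if cd \<le> best then best else cd) = NegInf \<or> (if cd \<le> best then bi else k) < Suc k \<and>
        ?c (if cd \<le> best then bi else k) = (if cd \<le> best then best else cd)"
      using best(2) by (auto simp: cd_def)
    moreover have "nmem s' = (nmem s0)(4 := (nmem s0 4)(0 := Suc k),
        6 := (nmem s0 6)(0 := if cd \<le> best then bi else k))"
      unfolding that nm by (auto simp: fun_eq_iff)
    moreover have "tmem s' = (tmem s0)(7 := (tmem s0 7)(0 := if cd \<le> best then best else cd), 8 := tmem s' 8)"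
      by (subst that(2)) (simp add: tm fun_eq_iff)
    ultimately show ?thesis unfolding scan_inv_def using k by (intro conjI exI) auto
  qed
  show "wp B scan_row (scan_inv s0 (Suc k)) s"
    unfolding scan_row_def
    by (simp add: nm tm b)
      (intro conjI impI post; auto simp: fun_eq_iff nm tm cd_def candidate_def not_le not_less_NegInf)
qed

end

section \<open>The phases of the program\<close>

abbreviation next_col :: com where
  "next_col \<equiv> NPut 5 (NLit 0) (NAdd (var 5) (NLit 1))"

text \<open>Blank cells already mean kind \<open>0\<close>, so only the basis is visited and the
  phase takes time \<open>O(n)\<close>.\<close>

definition mark_basis :: com where
  "mark_basis = Seq (Seq (NPut 5 (NLit 0) (NLit 0)) (While (BNot (NLe cols (var 5)))
       (Seq (NPut 7 (NGet 2 (var 5)) (NLit 1)) next_col)))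
     (NPut 7 (NGet 0 (NLit 2)) (NLit 0))"

definition initial_maxima :: com where
  "initial_maxima = Seq (NPut 5 (NLit 0) (NLit 0)) (While (NLe (var 5) cols)
     (Seq (update 1 3 4 8 9) next_col))"

definition start :: com where
  "start = Seq (NPut 5 (NLit 0) (NGet 8 (NGet 0 (NLit 2))))
     (Seq (TPut 2 (var 5) (TGet 1 (var 5))) (NPut 10 (var 5) (NLit 1)))"

definition process :: com where
  "process = Seq (update 2 5 6 11 12) scan"

text \<open>The new column has the sign opposite to the larger maximum over \<open>J\<close>; a tie
  counts as positive, in agreement with \<open>selected\<close>.\<close>

definition enter :: com where
  "enter = Seq (Cond (TLe (TGet 6 (var 6)) (TGet 5 (var 6)))
       (NPut 5 (NLit 0) (NGet 9 (var 6))) (NPut 5 (NLit 0) (NGet 8 (var 6))))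
     (Seq (NPut 7 (var 6) (NLit 2))
     (Seq (TPut 2 (var 5) (TAdd (TGet 1 (var 5)) (TGet 7 (NLit 0)))) (NPut 10 (var 5) (NLit 1))))"

text \<open>Kind \<open>2\<close> is never selected, so the guard fails exactly when the selected
  row lies outside \<open>K\<close>.\<close>

definition advance :: com where
  "advance = While (NLe (NLit 1) (NGet 7 (var 6))) (Seq enter process)"

text \<open>Subtracting \<open>\<beta>\<close> turns the shifted coordinates into those of
  \<open>pt J g \<beta>\<close>; the remaining columns have not moved.\<close>

definition finish :: com where
  "finish = Seq (Seq (NPut 3 (NLit 0) (var 6)) (NPut 5 (NLit 0) (NLit 0))) (While (NLe (var 5) cols)
     (Seq (Cond (NLe (NLit 1) (NGet 10 (var 5)))
       (TPut 2 (var 5) (TSub (TGet 2 (var 5)) (TGet 7 (NLit 0))))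
       (TPut 2 (var 5) (TGet 1 (var 5)))) next_col))"

definition pivot_program :: com where
  "pivot_program = Seq mark_basis (Seq initial_maxima (Seq start (Seq process (Seq advance finish))))"

context machine
begin

lemma scan_runs:
  assumes "nmem s0 0 0 = m" "\<And>i. i < m \<Longrightarrow> nmem s0 7 i \<le> 2"
  shows "runs B scan s0 (300 * m + 50) (scan_inv s0 m)"
  unfolding scan_def
proof (rule runs_loop[where Inv = "scan_inv s0" and N = m and T' = "ccost scan_row"])
  let ?c = "Seq (TPut 7 (NLit 0) TNegInf) (NPut 4 (NLit 0) (NLit 0))"
  have "scan_inv s0 0 (nput 4 0 0 (tput 7 0 NegInf s0))"
    unfolding scan_inv_def
    by (intro conjI exI[of _ NegInf] exI[of _ "nmem s0 6 0"] exI[of _ "tmem s0 8"])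
      (auto simp: fun_eq_iff)
  then show "runs B ?c s0 (ccost ?c) (scan_inv s0 0)" by (intro runs_wp) simp
  fix j s assume inv: "scan_inv s0 j s"
  have mem: "nmem s 0 0 = m" "nmem s 4 0 = j" "j \<le> m"
    using inv assms unfolding scan_inv_def by auto
  show "bfits B s rows_left" using mem B by simp
  show "j < m \<and> runs B scan_row s (ccost scan_row) (scan_inv s0 (Suc j))" if "bval s rows_left"
    using that mem scan_row_runs[OF inv] assms(2) by auto
  show "scan_inv s0 m s" if "\<not> bval s rows_left" using that mem inv by simp
qed (simp add: scan_row_def algebra_simps)

definition finish_inv :: "state \<Rightarrow> nat \<Rightarrow> state \<Rightarrow> bool" where
  "finish_inv s0 c s \<longleftrightarrow> c \<le> Suc n \<and>
     nmem s = (nmem s0)(3 := (nmem s0 3)(0 := nmem s0 6 0), 5 := (nmem s0 5)(0 := c)) \<and>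
     tmem s = (tmem s0)(2 := (\<lambda>j. if j < c
       then if 1 \<le> nmem s0 10 j then trop_diff (tmem s0 2 j) (tmem s0 7 0) else tmem s0 1 j
       else tmem s0 2 j))"

lemma finish_runs:
  assumes "nmem s0 0 1 = n" "nmem s0 6 0 \<le> B" "\<And>j. j \<le> n \<Longrightarrow> nmem s0 10 j \<le> 1"
  shows "runs B finish s0 (50 * n + 100) (finish_inv s0 (Suc n))"
  unfolding finish_def
proof (rule runs_loop[where Inv = "finish_inv s0" and N = "Suc n"])
  let ?c = "Seq (NPut 3 (NLit 0) (var 6)) (NPut 5 (NLit 0) (NLit 0))"
  let ?d = "Seq (Cond (NLe (NLit 1) (NGet 10 (var 5)))
       (TPut 2 (var 5) (TSub (TGet 2 (var 5)) (TGet 7 (NLit 0))))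
       (TPut 2 (var 5) (TGet 1 (var 5)))) next_col"
  have "finish_inv s0 0 (nput 5 0 0 (nput 3 0 (nmem s0 6 0) s0))"
    unfolding finish_inv_def by (auto simp: fun_eq_iff)
  then show "runs B ?c s0 (ccost ?c) (finish_inv s0 0)" using assms by (intro runs_wp) simp
  fix j s assume inv: "finish_inv s0 j s"
  have nm: "nmem s = (nmem s0)(3 := (nmem s0 3)(0 := nmem s0 6 0), 5 := (nmem s0 5)(0 := j))"
    and tm: "tmem s = (tmem s0)(2 := (\<lambda>i. if i < j
       then if 1 \<le> nmem s0 10 i then trop_diff (tmem s0 2 i) (tmem s0 7 0) else tmem s0 1 i
       else tmem s0 2 i))" and jn: "j \<le> Suc n"
    using inv unfolding finish_inv_def by auto
  have mem: "nmem s 0 1 = n" "nmem s 5 0 = j" using assms nm by auto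
  show "bfits B s (NLe (var 5) cols)" using mem jn B by simp
  show "j < Suc n \<and> runs B ?d s (ccost ?d) (finish_inv s0 (Suc j))" if "bval s (NLe (var 5) cols)"
  proof -
    have j: "j \<le> n" using that mem by simp
    have b: "j \<le> B" "Suc j \<le> B" "nmem s0 10 j \<le> B" "Suc 0 \<le> B" using assms(3)[OF j] B j by auto
    have post: "finish_inv s0 (Suc j) s'" if "nmem s' = (nmem s)(5 := (nmem s 5)(0 := Suc j))"
      "tmem s' = (tmem s)(2 := (tmem s 2)(j := if 1 \<le> nmem s0 10 j
         then trop_diff (tmem s0 2 j) (tmem s0 7 0) else tmem s0 1 j))" for s'
      using j unfolding finish_inv_def that nm tm by (auto simp: fun_eq_iff less_Suc_eq)
    have "wp B ?d (finish_inv s0 (Suc j)) s"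
      by (simp add: nm tm b) (intro conjI impI post; auto simp: fun_eq_iff nm tm)
    then show ?thesis using j runs_wp less_Suc_eq_le by blast
  qed
  show "finish_inv s0 (Suc n) s" if "\<not> bval s (NLe (var 5) cols)"
  proof -
    have "j = Suc n" using that mem jn by simp
    then show ?thesis using inv by simp
  qed
qed (simp add: algebra_simps)

definition maxima_inv :: "state \<Rightarrow> nat \<Rightarrow> state \<Rightarrow> bool" where
  "maxima_inv s0 c s \<longleftrightarrow> c \<le> Suc n \<and> nmem s 5 0 = c \<and>
     (\<forall>r. r \<notin> {4, 5, 8, 9} \<longrightarrow> nmem s r = nmem s0 r) \<and> (\<forall>r. r \<notin> {3, 4} \<longrightarrow> tmem s r = tmem s0 r) \<and>
     row_max m W pos_part {..<c} (tmem s0 1) (tmem s 3) (nmem s 8) \<and>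
     row_max m W neg_part {..<c} (tmem s0 1) (tmem s 4) (nmem s 9)"

lemma loaded_cong:
  assumes "loaded s0" "nmem s 0 = nmem s0 0" "nmem s 1 = nmem s0 1" "tmem s 0 = tmem s0 0"
  shows "loaded s"
  using assms unfolding loaded_def by simp

lemma initial_maxima_runs:
  assumes ld: "loaded s0" and blank: "\<And>i. tmem s0 3 i = NegInf" "\<And>i. tmem s0 4 i = NegInf"
  shows "runs B initial_maxima s0 (Suc n * (300 * m + 100) + 50) (maxima_inv s0 (Suc n))"
  unfolding initial_maxima_def
proof (rule runs_loop[where Inv = "maxima_inv s0" and N = "Suc n" and T' = "300 * m + 50 + 10"])
  \<comment> \<open>Blank cells hold \<open>NegInf\<close>, the maximum over no columns, so the
    arrays of maxima need no initialisation.\<close>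
  have "maxima_inv s0 0 (nput 5 0 0 s0)"
    unfolding maxima_inv_def row_max_def using blank by simp
  then show "runs B (NPut 5 (NLit 0) (NLit 0)) s0 3 (maxima_inv s0 0)"
    using runs_wp[of B "NPut 5 (NLit 0) (NLit 0)"] by (simp add: numeral_3_eq_3)
  fix j s assume inv: "maxima_inv s0 j s"
  have ld': "loaded s" by (rule loaded_cong[OF ld]) (use inv in \<open>auto simp: maxima_inv_def\<close>)
  have mem: "nmem s 0 1 = n" "nmem s 5 0 = j" "j \<le> Suc n"
    using inv ld' unfolding maxima_inv_def loaded_def by auto
  show "bfits B s (NLe (var 5) cols)" using mem B by simp
  show "maxima_inv s0 (Suc n) s" if "\<not> bval s (NLe (var 5) cols)"
  proof -
    have "j = Suc n" using that mem by simp
    then show ?thesis using inv by simp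
  qed
  show "j < Suc n \<and> runs B (Seq (update 1 3 4 8 9) next_col) s (300 * m + 50 + 10) (maxima_inv s0 (Suc j))"
    if "bval s (NLe (var 5) cols)"
  proof -
    have j: "j \<le> n" using that mem by simp
    have "runs B (Seq (update 1 3 4 8 9) next_col) s (300 * m + 50 + 10) (maxima_inv s0 (Suc j))"
    proof (rule runs_Seq)
      show "runs B (update 1 3 4 8 9) s (300 * m + 50) (update_inv 1 3 4 8 9 s m)"
        by (rule update_runs) (use ld' mem j in auto)
      fix s' assume u: "update_inv 1 3 4 8 9 s m s'"
      have nm: "nmem s' r = nmem s r" if "r \<notin> {4, 8, 9}" for r
        using u that unfolding update_inv_def Let_def by auto
      have tm: "tmem s' r = tmem s r" if "r \<notin> {3, 4}" for r
        using u that unfolding update_inv_def Let_def by auto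
      have c: "nmem s' 5 0 = j" using nm mem by simp
      have x: "tmem s 1 j = tmem s0 1 j" using inv unfolding maxima_inv_def by auto
      have P: "row_max m W pos_part {..<Suc j} (tmem s0 1) (tmem s' 3) (nmem s' 8)"
        unfolding lessThan_Suc
      proof (rule row_max_insert)
        show "row_max m W pos_part {..<j} (tmem s0 1) (tmem s 3) (nmem s 8)"
          using inv unfolding maxima_inv_def by blast
      qed (use u x mem in \<open>auto simp: update_inv_def Let_def\<close>)
      have N: "row_max m W neg_part {..<Suc j} (tmem s0 1) (tmem s' 4) (nmem s' 9)"
        unfolding lessThan_Suc
      proof (rule row_max_insert)
        show "row_max m W neg_part {..<j} (tmem s0 1) (tmem s 4) (nmem s 9)"
          using inv unfolding maxima_inv_def by blast
      qed (use u x mem in \<open>auto simp: update_inv_def Let_def\<close>)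
      have "maxima_inv s0 (Suc j) (nput 5 0 (Suc j) s')"
        using inv nm tm P N j unfolding maxima_inv_def by simp
      then have "wp B next_col (maxima_inv s0 (Suc j)) s'" using c B j by simp
      from runs_wp[OF this] show "runs B next_col s' 10 (maxima_inv s0 (Suc j))"
        by (rule runs_conseq) auto
    qed
    then show ?thesis using j by simp
  qed
qed (simp add: algebra_simps)

definition mark_inv :: "state \<Rightarrow> nat \<Rightarrow> state \<Rightarrow> bool" where
  "mark_inv s0 l s \<longleftrightarrow> l \<le> n \<and> tmem s = tmem s0 \<and>
     nmem s = (nmem s0)(5 := (nmem s0 5)(0 := l),
       7 := (\<lambda>i. if i \<in> nmem s0 2 ` {..<l} then 1 else nmem s0 7 i))"

lemma mark_basis_runs:
  assumes ld: "nmem s0 0 1 = n" and bas: "\<And>l. l < n \<Longrightarrow> nmem s0 2 l < m" and k: "nmem s0 0 2 < m"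
  shows "runs B mark_basis s0 (50 * n + 50) (\<lambda>s. tmem s = tmem s0 \<and>
    nmem s = (nmem s0)(5 := (nmem s0 5)(0 := n),
       7 := (\<lambda>i. if i = nmem s0 0 2 then 0 else if i \<in> nmem s0 2 ` {..<n} then 1 else nmem s0 7 i)))"
    (is "runs B _ s0 _ ?Q")
proof -
  have "runs B mark_basis s0 (50 * n + 25 + 25) ?Q"
    unfolding mark_basis_def
  proof (rule runs_Seq)
    let ?d = "Seq (NPut 7 (NGet 2 (var 5)) (NLit 1)) next_col"
    let ?b = "BNot (NLe cols (var 5))"
    show "runs B (Seq (NPut 5 (NLit 0) (NLit 0)) (While ?b ?d)) s0 (50 * n + 25) (mark_inv s0 n)"
    proof (rule runs_loop[where Inv = "mark_inv s0" and N = n])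
      have "mark_inv s0 0 (nput 5 0 0 s0)" unfolding mark_inv_def by (auto simp: fun_eq_iff)
      then show "runs B (NPut 5 (NLit 0) (NLit 0)) s0 (ccost (NPut 5 (NLit 0) (NLit 0))) (mark_inv s0 0)"
        by (intro runs_wp) simp
      fix j s assume inv: "mark_inv s0 j s"
      have mem: "nmem s 0 1 = n" "nmem s 5 0 = j" "j \<le> n" using inv ld unfolding mark_inv_def by auto
      show "bfits B s ?b" using mem B by simp
      show "mark_inv s0 n s" if "\<not> bval s ?b" using that mem inv by simp
      show "j < n \<and> runs B ?d s (ccost ?d) (mark_inv s0 (Suc j))" if "bval s ?b"
      proof -
        have j: "j < n" using that mem by simp
        have n2: "nmem s 2 j = nmem s0 2 j" using inv unfolding mark_inv_def by auto
        have "mark_inv s0 (Suc j) (nput 5 0 (Suc j) (nput 7 (nmem s0 2 j) 1 s))"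
          using inv j unfolding mark_inv_def by (auto simp: fun_eq_iff less_Suc_eq)
        then have "wp B ?d (mark_inv s0 (Suc j)) s" using mem n2 bas[OF j] B j by simp
        then show ?thesis using j runs_wp by blast
      qed
    qed (simp add: algebra_simps)
    fix s assume inv: "mark_inv s0 n s"
    have Q: "?Q (nput 7 (nmem s0 0 2) 0 s)"
      using inv unfolding mark_inv_def by (auto simp: fun_eq_iff)
    have e: "nmem s 0 2 = nmem s0 0 2" using inv unfolding mark_inv_def by auto
    have b: "nmem s0 0 2 \<le> B" "0 \<le> B" "2 \<le> B" using k B by auto
    have "wp B (NPut 7 (NGet 0 (NLit 2)) (NLit 0)) ?Q s"
      unfolding wp.simps nval.simps nfits.simps e using Q b by blast
    from runs_wp[OF this] show "runs B (NPut 7 (NGet 0 (NLit 2)) (NLit 0)) s 25 ?Q"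
      by (rule runs_conseq) auto
  qed
  then show ?thesis by (rule runs_conseq) simp_all
qed

end

section \<open>The program carries out the motion\<close>

locale pivot_run = pivot m n W I \<xi> k p q + machine B m n W
  for B m n :: nat and W :: "nat \<Rightarrow> nat \<Rightarrow> strop" and I :: "nat set" and \<xi> :: "nat \<Rightarrow> real"
    and k :: nat and p q :: "nat \<Rightarrow> nat"
begin

definition base :: "nat set \<Rightarrow> (nat \<Rightarrow> real) \<Rightarrow> nat set \<Rightarrow> state \<Rightarrow> bool" where
  "base J g D s \<longleftrightarrow> loaded s \<and>
     (\<forall>i<m. nmem s 7 i = kind_of D i \<and> nmem s 8 i = p i \<and> nmem s 9 i = q i \<and> tmem s 3 i = Fin (a i)) \<and>
     (\<forall>j\<le>n. tmem s 1 j = Fin (\<xi> j) \<and> nmem s 10 j = (if j \<in> J then 1 else 0)) \<and>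
     (\<forall>j\<in>J. tmem s 2 j = Fin (\<xi> j + g j))"

text \<open>Kept apart from \<open>base\<close> because between \<open>enter\<close> and
  \<open>process\<close> the maxima lag behind by the column just entered.\<close>

definition maxed :: "nat set \<Rightarrow> state \<Rightarrow> bool" where
  "maxed J s \<longleftrightarrow> row_max m W pos_part J (tmem s 2) (tmem s 5) (nmem s 11) \<and>
     row_max m W neg_part J (tmem s 2) (tmem s 6) (nmem s 12)"

definition ready :: "nat set \<Rightarrow> (nat \<Rightarrow> real) \<Rightarrow> nat set \<Rightarrow> real \<Rightarrow> state \<Rightarrow> bool" where
  "ready J g D \<beta> s \<longleftrightarrow> base J g D s \<and> maxed J s \<and> tmem s 7 0 = Fin \<beta> \<and> pinv J g D \<beta> \<and>
     selected J g D \<beta> (tmem s 5) (tmem s 6) (nmem s 6 0)"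

lemma base_cong:
  assumes "base J g D s0" "\<And>r. r \<in> {0, 1, 7, 8, 9, 10} \<Longrightarrow> nmem s r = nmem s0 r"
    "\<And>r. r \<in> {0, 1, 2, 3} \<Longrightarrow> tmem s r = tmem s0 r"
  shows "base J g D s"
proof -
  have "loaded s" by (rule loaded_cong[of s0]) (use assms in \<open>auto simp: base_def\<close>)
  then show ?thesis using assms unfolding base_def by simp
qed

lemma process_runs:
  assumes inv: "pinv (insert c J) g D \<beta>" and base: "base (insert c J) g D s0" and mx: "maxed J s0"
    and c: "nmem s0 5 0 = c"
  shows "runs B process s0 (600 * m + 100) (\<lambda>s. \<exists>\<beta>'. ready (insert c J) g D \<beta>' s)"
proof -
  let ?J = "insert c J"
  have cn: "c \<le> n" using pinvD(2)[OF inv] by auto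
  have ld: "loaded s0" using base unfolding base_def by blast
  have "runs B process s0 ((300 * m + 50) + (300 * m + 50)) (\<lambda>s. \<exists>\<beta>'. ready ?J g D \<beta>' s)"
    unfolding process_def
  proof (rule runs_Seq)
    show "runs B (update 2 5 6 11 12) s0 (300 * m + 50) (update_inv 2 5 6 11 12 s0 m)"
      by (rule update_runs) (use ld c cn in auto)
    fix s1 assume u: "update_inv 2 5 6 11 12 s0 m s1"
    have base1: "base ?J g D s1"
      by (rule base_cong[OF base]) (use u in \<open>auto simp: update_inv_def Let_def\<close>)
    have y: "tmem s1 2 = tmem s0 2" using u by (auto simp: update_inv_def Let_def)
    have P: "row_max m W pos_part ?J (tmem s1 2) (tmem s1 5) (nmem s1 11)"
    proof (rule row_max_insert)
      show "row_max m W pos_part J (tmem s0 2) (tmem s0 5) (nmem s0 11)" using mx unfolding maxed_def by blast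
    qed (use u c y in \<open>auto simp: update_inv_def Let_def\<close>)
    have N: "row_max m W neg_part ?J (tmem s1 2) (tmem s1 6) (nmem s1 12)"
    proof (rule row_max_insert)
      show "row_max m W neg_part J (tmem s0 2) (tmem s0 6) (nmem s0 12)" using mx unfolding maxed_def by blast
    qed (use u c y in \<open>auto simp: update_inv_def Let_def\<close>)
    have ld1: "nmem s1 0 0 = m" using base1 unfolding base_def loaded_def by blast
    have kind: "nmem s1 7 i = kind_of D i" if "i < m" for i using base1 that unfolding base_def by blast
    have A: "tmem s1 3 i = Fin (a i)" if "i < m" for i using base1 that unfolding base_def by blast
    have Y: "\<forall>j\<in>?J. tmem s1 2 j = Fin (\<xi> j + g j)" using base1 unfolding base_def by blast
    have "runs B scan s1 (300 * m + 50) (scan_inv s1 m)"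
      by (rule scan_runs) (use ld1 kind in \<open>auto simp: kind_of_def\<close>)
    then show "runs B scan s1 (300 * m + 50) (\<lambda>s. \<exists>\<beta>'. ready ?J g D \<beta>' s)"
    proof (rule runs_conseq[OF _ order_refl])
      fix s assume "scan_inv s1 m s"
      then obtain best bi u where
        nm: "nmem s = (nmem s1)(4 := (nmem s1 4)(0 := m), 6 := (nmem s1 6)(0 := bi))"
        and tm: "tmem s = (tmem s1)(7 := (tmem s1 7)(0 := best), 8 := u)"
        and best: "\<And>i. i < m \<Longrightarrow> candidate (nmem s1 7) (tmem s1 3) (tmem s1 5) (tmem s1 6) i \<le> best"
        and att: "best = NegInf \<or> bi < m \<and> candidate (nmem s1 7) (tmem s1 3) (tmem s1 5) (tmem s1 6) bi = best"
        unfolding scan_inv_def by blast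
      obtain \<beta>' where *: "best = Fin \<beta>'" "pinv ?J g D \<beta>'" "selected ?J g D \<beta>' (tmem s1 5) (tmem s1 6) bi"
        using scan_sound[OF inv P N Y A kind best att] .
      have "base ?J g D s" by (rule base_cong[OF base1]) (auto simp: nm tm)
      moreover have "maxed ?J s" using P N unfolding maxed_def nm tm by simp
      ultimately have "ready ?J g D \<beta>' s" unfolding ready_def using * nm tm by simp
      then show "\<exists>\<beta>'. ready ?J g D \<beta>' s" ..
    qed
  qed
  then show ?thesis by (rule runs_conseq) simp_all
qed

lemma enter_runs:
  assumes rd: "ready J g D \<beta> s0" and kd: "1 \<le> nmem s0 7 (nmem s0 6 0)"
  shows "runs B enter s0 100 (\<lambda>s. \<exists>c i. c \<notin> J \<and> i \<notin> D \<and> i \<in> K \<and> nmem s 5 0 = c \<and>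
    pinv (insert c J) (g(c := \<beta>)) (insert i D) \<beta> \<and> base (insert c J) (g(c := \<beta>)) (insert i D) s \<and> maxed J s)"
    (is "runs B enter s0 100 ?Q")
proof -
  define i where "i = nmem s0 6 0"
  have base: "base J g D s0" and mx: "maxed J s0" and best: "tmem s0 7 0 = Fin \<beta>"
    and inv: "pinv J g D \<beta>" and sel: "selected J g D \<beta> (tmem s0 5) (tmem s0 6) i"
    using rd unfolding ready_def i_def by auto
  have im: "i < m" using sel unfolding selected_def by blast
  have k7: "nmem s0 7 i = kind_of D i" using base im unfolding base_def by blast
  then have "1 \<le> kind_of D i" using kd unfolding i_def by simp
  then have iK: "i \<in> K" unfolding kind_of_def by (cases "i \<in> K") simp_all
  then obtain r where r: "r \<in> J" "W i r \<noteq> SNegInf" "val g i r = a i + \<beta>" and iD: "i \<in> K - D"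
    and sg: "strop_sign (W i r) = 1 \<longleftrightarrow> tmem s0 6 i \<le> tmem s0 5 i"
    using sel unfolding selected_def by blast
  define c where "c = (if strop_sign (W i r) = 1 then q i else p i)"
  have cJ: "c \<notin> J" and inv': "pinv (insert c J) (g(c := \<beta>)) (insert i D) \<beta>"
    using pinv_add[OF inv iD r c_def] by auto
  have cn: "c \<le> n" using pinvD(2)[OF inv'] by auto
  have c: "(if tmem s0 6 i \<le> tmem s0 5 i then nmem s0 9 i else nmem s0 8 i) = c"
    using base im sg unfolding base_def c_def by auto
  have b: "i \<le> B" "c \<le> B" "2 \<le> B" "Suc 0 \<le> B" using im cn B by auto
  let ?s = "nput 10 c 1 (tput 2 c (tmem s0 1 c + tmem s0 7 0) (nput 7 i 2 (nput 5 0 c s0)))"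
  have ld: "loaded ?s"
    by (rule loaded_cong[of s0]) (use base in \<open>auto simp: base_def\<close>)
  have "base (insert c J) (g(c := \<beta>)) (insert i D) ?s"
    unfolding base_def using ld base iK cn best cJ by (auto simp: base_def kind_of_def)
  \<comment> \<open>Storing the coordinate of \<open>c\<close> leaves the maxima over
    \<open>J\<close> valid because \<open>c \<notin> J\<close>.\<close>
  moreover have "maxed J ?s"
    using mx cJ unfolding maxed_def row_max_def by auto
  ultimately have Q: "?Q ?s" using cJ iD inv' by (intro exI[of _ c] exI[of _ i]) auto
  have "wp B enter ?Q s0"
  proof (cases "tmem s0 6 i \<le> tmem s0 5 i")
    case True
    then have "nmem s0 9 i = c" using c by simp
    then show ?thesis unfolding enter_def
      using Q True b by (simp add: i_def[symmetric] del: ex_simps)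
  next
    case False
    then have "nmem s0 8 i = c" using c by simp
    then show ?thesis unfolding enter_def
      using Q False b by (simp add: i_def[symmetric] del: ex_simps)
  qed
  from runs_wp[OF this] show ?thesis by (rule runs_conseq) (simp_all add: enter_def)
qed

lemma advance_runs:
  assumes "ready J g {} \<beta> s0"
  shows "runs B advance s0 (n * (600 * m + 210) + 10)
    (\<lambda>s. \<exists>J g D \<beta>. ready J g D \<beta> s \<and> nmem s 6 0 \<notin> K)"
proof -
  let ?b = "NLe (NLit 1) (NGet 7 (var 6))"
  \<comment> \<open>Every round moves one row of \<open>K\<close> into \<open>D\<close>, so
    \<open>card D\<close> counts the rounds.\<close>
  let ?Inv = "\<lambda>j s. \<exists>J g D \<beta>. card D = j \<and> ready J g D \<beta> s"
  have facts: "nmem s 6 0 < m" "nmem s 7 (nmem s 6 0) = kind_of D (nmem s 6 0)"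
    if "ready J g D \<beta> s" for J g D \<beta> s
    using that unfolding ready_def selected_def base_def by blast+
  have "runs B advance s0 (n * (1 + bcost ?b + (100 + (600 * m + 100))) + (1 + bcost ?b))
      (\<lambda>s'. \<exists>j\<le>n. ?Inv j s' \<and> \<not> bval s' ?b)"
    unfolding advance_def
  proof (rule runs_While)
    fix j s assume "?Inv j s"
    then obtain J g D \<beta> where rd: "card D = j" "ready J g D \<beta> s" by blast
    have "kind_of D (nmem s 6 0) \<le> 2" by (simp add: kind_of_def)
    then show "bfits B s ?b" using facts[OF rd(2)] B by simp
    assume bv: "bval s ?b"
    then have kd: "1 \<le> nmem s 7 (nmem s 6 0)" by simp
    then have sK: "nmem s 6 0 \<in> K - D"
    proof -
      have "1 \<le> kind_of D (nmem s 6 0)" using kd facts(2)[OF rd(2)] by simp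
      then have "nmem s 6 0 \<in> K" unfolding kind_of_def by (cases "nmem s 6 0 \<in> K") simp_all
      then show ?thesis using rd(2) unfolding ready_def selected_def by blast
    qed
    have inv: "pinv J g D \<beta>" using rd unfolding ready_def by blast
    have "card D < card K"
      using sK pinvD(3)[OF inv] finite_K by (intro psubset_card_mono) auto
    then have "j < n" using rd card_K by simp
    moreover have "runs B (Seq enter process) s (100 + (600 * m + 100)) (?Inv (Suc j))"
    proof (rule runs_Seq[OF enter_runs[OF rd(2) kd]])
      fix s1 assume "\<exists>c i. c \<notin> J \<and> i \<notin> D \<and> i \<in> K \<and> nmem s1 5 0 = c \<and>
        pinv (insert c J) (g(c := \<beta>)) (insert i D) \<beta> \<and> base (insert c J) (g(c := \<beta>)) (insert i D) s1 \<and> maxed J s1"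
      then obtain c i where *: "i \<notin> D" "nmem s1 5 0 = c"
        "pinv (insert c J) (g(c := \<beta>)) (insert i D) \<beta>" "base (insert c J) (g(c := \<beta>)) (insert i D) s1" "maxed J s1"
        by blast
      have "card (insert i D) = Suc j" using * rd pinvD(9)[OF inv] by simp
      then show "runs B process s1 (600 * m + 100) (?Inv (Suc j))"
        by (intro runs_conseq[OF process_runs[OF *(3,4,5,2)] order_refl]) blast
    qed
    ultimately show "j < n \<and> runs B (Seq enter process) s (100 + (600 * m + 100)) (?Inv (Suc j))" by blast
  next
    show "?Inv 0 s0" using assms by (metis card.empty)
  qed
  then show ?thesis
  proof (rule runs_conseq)
    fix s assume "\<exists>j\<le>n. ?Inv j s \<and> \<not> bval s ?b"
    then obtain J g D \<beta> where rd: "ready J g D \<beta> s" and "\<not> bval s ?b" by blast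
    then have "kind_of D (nmem s 6 0) = 0" using facts[OF rd] by simp
    then have "nmem s 6 0 \<notin> K" unfolding kind_of_def by (metis zero_neq_numeral zero_neq_one)
    then show "\<exists>J g D \<beta>. ready J g D \<beta> s \<and> nmem s 6 0 \<notin> K" using rd by blast
  qed (simp add: algebra_simps)
qed

definition solved :: "(nat \<Rightarrow> trop) \<Rightarrow> state \<Rightarrow> bool" where
  "solved x s \<longleftrightarrow> output_index s < m \<and> output_index s \<notin> I \<and>
     basic_point m n W (insert (output_index s) (I - {k})) (output_point s) \<and>
     other_basic_point m n W (I - {k}) x (output_point s)"

lemma finish_solved:
  assumes x: "\<forall>j\<le>n. x j = Fin (\<xi> j)" and rd: "ready J g D \<beta> s0" and nK: "nmem s0 6 0 \<notin> K"
  shows "runs B finish s0 (50 * n + 100) (solved x)"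
proof -
  define i where "i = nmem s0 6 0"
  have base: "base J g D s0" and best: "tmem s0 7 0 = Fin \<beta>"
    and inv: "pinv J g D \<beta>" and sel: "selected J g D \<beta> (tmem s0 5) (tmem s0 6) i"
    using rd unfolding ready_def i_def by auto
  obtain r where im: "i < m" and r: "r \<in> J" "strop_sign (W i r) = -1" "val g i r = a i + \<beta>"
    "\<And>l. l \<in> J \<Longrightarrow> strop_sign (W i l) = 1 \<Longrightarrow> val g i l < val g i r"
    using sel nK unfolding selected_def i_def[symmetric] by blast
  note stop = inv im nK[folded i_def] r
  have "runs B finish s0 (50 * n + 100) (finish_inv s0 (Suc n))"
    by (rule finish_runs) (use base im B in \<open>auto simp: base_def loaded_def i_def\<close>)
  then show ?thesis
  proof (rule runs_conseq[OF _ order_refl])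
    fix s assume fin: "finish_inv s0 (Suc n) s"
    have oi: "output_index s = i" using fin unfolding output_index_def finish_inv_def i_def by simp
    have y: "\<forall>j\<le>n. output_point s j = Fin (pt J g \<beta> j)"
      using fin base best pinvD(2)[OF inv]
      unfolding output_point_def finish_inv_def base_def pt_def by auto
    show "solved x s"
      unfolding solved_def oi K_def[symmetric]
      using im stop_not_in_I[OF stop] stop_basic[OF stop y] stop_other[OF stop x y] by blast
  qed
qed

lemma start_runs:
  assumes ld: "loaded s0" and k2: "nmem s0 0 2 = k"
    and rows: "\<And>i. i < m \<Longrightarrow> nmem s0 7 i = kind_of {} i \<and> nmem s0 8 i = p i \<and> nmem s0 9 i = q i \<and> tmem s0 3 i = Fin (a i)"
    and x: "\<And>j. j \<le> n \<Longrightarrow> tmem s0 1 j = Fin (\<xi> j)" and blank: "\<And>j. nmem s0 10 j = 0"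
    "\<And>i. tmem s0 5 i = NegInf" "\<And>i. tmem s0 6 i = NegInf"
  shows "runs B start s0 50 (\<lambda>s. base {p k} (\<lambda>_. 0) {} s \<and> maxed {} s \<and> nmem s 5 0 = p k)"
    (is "runs B start s0 50 ?Q")
proof -
  have km: "k < m" using k I_m by blast
  have pn: "p k \<le> n" using p[OF km] by simp
  have p8: "nmem s0 8 k = p k" using rows[OF km] by blast
  let ?s = "nput 10 (p k) 1 (tput 2 (p k) (tmem s0 1 (p k)) (nput 5 0 (p k) s0))"
  have "loaded ?s" by (rule loaded_cong[OF ld]) auto
  then have "base {p k} (\<lambda>_. 0) {} ?s"
    using rows x blank pn unfolding base_def by auto
  moreover have "maxed {} ?s" using blank unfolding maxed_def row_max_def by simp
  ultimately have Q: "?Q ?s" by simp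
  have b: "p k \<le> B" "k \<le> B" "2 \<le> B" "Suc 0 \<le> B" using B km pn by auto
  have "wp B start ?Q s0" unfolding start_def using Q b by (simp add: k2 p8)
  from runs_wp[OF this] show ?thesis by (rule runs_conseq) (simp_all add: start_def)
qed

lemma main_runs:
  assumes xx: "\<forall>j\<le>n. x j = Fin (\<xi> j)" and ld: "loaded s0" and k2: "nmem s0 0 2 = k"
    and rows: "\<And>i. i < m \<Longrightarrow> nmem s0 7 i = kind_of {} i \<and> nmem s0 8 i = p i \<and> nmem s0 9 i = q i \<and> tmem s0 3 i = Fin (a i)"
    and x: "\<And>j. j \<le> n \<Longrightarrow> tmem s0 1 j = Fin (\<xi> j)" and blank: "\<And>j. nmem s0 10 j = 0"
    "\<And>i. tmem s0 5 i = NegInf" "\<And>i. tmem s0 6 i = NegInf"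
  shows "runs B (Seq start (Seq process (Seq advance finish))) s0
    (50 + ((600 * m + 100) + ((n * (600 * m + 210) + 10) + (50 * n + 100)))) (solved x)"
proof (rule runs_Seq[OF start_runs[OF ld k2 rows x blank]])
  fix s1 assume s1: "base {p k} (\<lambda>_. 0) {} s1 \<and> maxed {} s1 \<and> nmem s1 5 0 = p k"
  show "runs B (Seq process (Seq advance finish)) s1
    ((600 * m + 100) + ((n * (600 * m + 210) + 10) + (50 * n + 100))) (solved x)"
  proof (rule runs_Seq[OF process_runs[OF pinv_init]])
    fix s2 assume "\<exists>\<beta>. ready {p k} (\<lambda>_. 0) {} \<beta> s2"
    then obtain \<beta> where rd: "ready {p k} (\<lambda>_. 0) {} \<beta> s2" ..
    show "runs B (Seq advance finish) s2 ((n * (600 * m + 210) + 10) + (50 * n + 100)) (solved x)"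
      by (rule runs_Seq[OF advance_runs[OF rd]]) (use finish_solved[OF xx] in blast)
  qed (use s1 in auto)
qed

end

lemma (in machine) loaded_pivot_input: "loaded (pivot_input m n W x bas k)"
  unfolding loaded_def
proof (intro conjI allI impI)
  fix i j assume ij: "i < m" "j \<le> n"
  have "Suc i * (n + 1) \<le> m * (n + 1)" using ij by (intro mult_le_mono1) simp
  then have "i * (n + 1) + j < m * (n + 1)" using ij by simp
  moreover have "(i * (n + 1) + j) div (n + 1) = i" "(i * (n + 1) + j) mod (n + 1) = j"
    using ij by (auto simp: div_mult_self3 div_less mod_less simp del: mult_Suc_right)
  ultimately show "nmem (pivot_input m n W x bas k) 1 (i * (n + 1) + j) = sign_tag (W i j)"
    "tmem (pivot_input m n W x bas k) 0 (i * (n + 1) + j) = modulus (W i j)"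
    unfolding pivot_input_def by simp_all
qed (simp_all add: pivot_input_def)

text \<open>A nonempty row whose inequality holds at a finite point has a positive entry, so its
  positive maximum is finite. A negative entry is guaranteed in active rows.\<close>

lemma (in vertex) initial_pivot:
  assumes k: "k \<in> I" and cone: "\<And>i. i < m \<Longrightarrow> sign_dominates n W 1 i z"
    and P: "row_max m W pos_part {..<Suc n} x A p" and N: "row_max m W neg_part {..<Suc n} x A' q"
    and x: "\<forall>j\<le>n. x j = Fin (z j)"
  shows "pivot m n W I z k p q" "\<And>i. i < m \<Longrightarrow> A i = Fin (mag (W i (p i)) + z (p i))"
proof -
  have pos: "p i \<le> n \<and> strop_sign (W i (p i)) = 1 \<and> A i = Fin (mag (W i (p i)) + z (p i)) \<and>
      (\<forall>j\<le>n. strop_sign (W i j) = 1 \<longrightarrow> mag (W i j) + z j \<le> mag (W i (p i)) + z (p i))"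
    if i: "i < m" for i
  proof -
    have le: "pos_part (W i j) + x j \<le> A i" if "j \<le> n" for j
      using P i that unfolding row_max_def by (simp add: less_Suc_eq_le)
    obtain j where "j \<le> n" "strop_sign (W i j) = 1"
    proof -
      obtain j where j: "j \<le> n" "W i j \<noteq> SNegInf" using row_nonempty[OF i] by blast
      then show thesis
        using strop_sign_cases[OF j(2)] cone[OF i] that unfolding sign_dominates_def by blast
    qed
    then have "A i \<noteq> NegInf" using le[of j] x by (auto simp: pos_part_eq)
    then have arg: "p i \<le> n" "A i = pos_part (W i (p i)) + x (p i)"
      using P i unfolding row_max_def by (auto simp: less_Suc_eq_le)
    then have "strop_sign (W i (p i)) = 1" "A i = Fin (mag (W i (p i)) + z (p i))"
      using \<open>A i \<noteq> NegInf\<close> x by (auto simp: pos_part_eq split: if_splits)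
    moreover have "mag (W i j) + z j \<le> mag (W i (p i)) + z (p i)" if "j \<le> n" "strop_sign (W i j) = 1" for j
      using le[OF that(1)] that x calculation(2) by (simp add: pos_part_eq)
    ultimately show ?thesis using arg by blast
  qed
  have neg: "q i \<le> n \<and> strop_sign (W i (q i)) = -1 \<and>
      (\<forall>j\<le>n. strop_sign (W i j) = -1 \<longrightarrow> mag (W i j) + z j \<le> mag (W i (q i)) + z (q i))"
    if iI: "i \<in> I" for i
  proof -
    have i: "i < m" using iI I by auto
    have le: "neg_part (W i j) + x j \<le> A' i" if "j \<le> n" for j
      using N i that unfolding row_max_def by (simp add: less_Suc_eq_le)
    obtain j where "j \<in> tight n W z i" "strop_sign (W i j) = -1"
      using active_tight[OF act[OF iI] row_nonempty[OF i]] by metis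
    then have "A' i \<noteq> NegInf" using le[of j] x by (auto simp: neg_part_eq tight_def)
    then have arg: "q i \<le> n" "A' i = neg_part (W i (q i)) + x (q i)"
      using N i unfolding row_max_def by (auto simp: less_Suc_eq_le)
    then have "strop_sign (W i (q i)) = -1" "A' i = Fin (mag (W i (q i)) + z (q i))"
      using \<open>A' i \<noteq> NegInf\<close> x by (auto simp: neg_part_eq split: if_splits)
    moreover have "mag (W i j) + z j \<le> mag (W i (q i)) + z (q i)" if "j \<le> n" "strop_sign (W i j) = -1" for j
      using le[OF that(1)] that x calculation(2) by (simp add: neg_part_eq)
    ultimately show ?thesis using arg by blast
  qed
  show "pivot m n W I z k p q" by unfold_locales (use k cone pos neg in blast)+
  show "A i = Fin (mag (W i (p i)) + z (p i))" if "i < m" for i using pos[OF that] by blast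
qed

lemma pivot_program_runs:
  assumes adm: "admissible m n W" and bp: "basic_point m n W I x" and bas: "bij_betw bas {..<n} I"
    and k: "k \<in> I" and mach: "machine B m n"
  shows "runs B pivot_program (pivot_input m n W x bas k)
    ((50 * n + 50) + ((Suc n * (300 * m + 100) + 50) +
      (50 + ((600 * m + 100) + ((n * (600 * m + 210) + 10) + (50 * n + 100))))))
    (\<lambda>s. output_index s < m \<and> output_index s \<notin> I \<and>
       basic_point m n W (insert (output_index s) (I - {k})) (output_point s) \<and>
       other_basic_point m n W (I - {k}) x (output_point s))" (is "runs B _ ?s0 _ ?Q")
proof -
  have bp': "x \<in> trop_face m n W I" "nonzero_point n x" and I: "I \<subseteq> {..<m}" "card I = n"
    using bp unfolding basic_point_def is_basis_def by auto
  obtain \<xi> where x: "\<forall>j\<le>n. x j = Fin (\<xi> j)" using finite_point_coords[OF adm bp'] .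
  have act: "\<And>i. i \<in> I \<Longrightarrow> active n W i \<xi>" and cone: "\<And>i. i < m \<Longrightarrow> sign_dominates n W 1 i \<xi>"
    using bp'(1) trop_face_iff[OF x] by auto
  interpret vertex m n W I \<xi> using adm I act by unfold_locales
  interpret machine B m n W by (rule mach)
  have km: "k < m" using k I by auto
  have basI: "bas ` {..<n} = I" using bas by (simp add: bij_betw_def)
  show ?thesis unfolding pivot_program_def
  proof (rule runs_Seq)
    let ?Q1 = "\<lambda>s::state. tmem s = tmem ?s0 \<and> nmem s = (nmem ?s0)(5 := (nmem ?s0 5)(0 := n),
       7 := (\<lambda>i. if i = nmem ?s0 0 2 then 0 else if i \<in> nmem ?s0 2 ` {..<n} then 1 else nmem ?s0 7 i))"
    show "runs B mark_basis ?s0 (50 * n + 50) ?Q1"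
    proof (rule mark_basis_runs)
      fix l assume "l < n"
      then have "bas l < m" using basI I by blast
      then show "nmem ?s0 2 l < m" using \<open>l < n\<close> by (simp add: pivot_input_def)
    qed (use km in \<open>simp_all add: pivot_input_def\<close>)
    fix s1 assume Q1: "?Q1 s1"
    have s1: "nmem s1 0 = nmem ?s0 0" "nmem s1 1 = nmem ?s0 1" "nmem s1 10 = nmem ?s0 10" "tmem s1 = tmem ?s0"
      using Q1 by auto
    have "nmem ?s0 2 ` {..<n} = bas ` {..<n}" by (intro image_cong) (auto simp: pivot_input_def)
    then have kinds: "nmem s1 7 i = (if i \<in> I - {k} then 1 else 0)" for i
      using Q1 basI by (simp add: pivot_input_def)
    have ld1: "loaded s1" by (rule loaded_cong[OF loaded_pivot_input]) (use s1 in auto)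
    show "runs B (Seq initial_maxima (Seq start (Seq process (Seq advance finish)))) s1
      ((Suc n * (300 * m + 100) + 50) +
        (50 + ((600 * m + 100) + ((n * (600 * m + 210) + 10) + (50 * n + 100))))) ?Q"
    proof (rule runs_Seq)
      show "runs B initial_maxima s1 (Suc n * (300 * m + 100) + 50) (maxima_inv s1 (Suc n))"
        by (rule initial_maxima_runs[OF ld1]) (auto simp: s1 pivot_input_def)
      fix s2 assume s2: "maxima_inv s1 (Suc n) s2"
      have x1: "\<forall>j\<le>n. tmem s1 1 j = Fin (\<xi> j)" using x by (simp add: s1 pivot_input_def)
      note ip = initial_pivot[OF k cone _ _ x1, of "tmem s2 3" "nmem s2 8" "tmem s2 4" "nmem s2 9"]
      have rm: "row_max m W pos_part {..<Suc n} (tmem s1 1) (tmem s2 3) (nmem s2 8)"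
        "row_max m W neg_part {..<Suc n} (tmem s1 1) (tmem s2 4) (nmem s2 9)"
        using s2 unfolding maxima_inv_def by blast+
      \<comment> \<open>The maximal columns are those found by the run itself, so the locale can be
        interpreted only at this state.\<close>
      interpret pivot m n W I \<xi> k "nmem s2 8" "nmem s2 9" by (rule ip(1)[OF _ rm])
      interpret pivot_run B m n W I \<xi> k "nmem s2 8" "nmem s2 9" by unfold_locales
      have fr: "nmem s2 r = nmem s1 r" if "r \<notin> {4, 5, 8, 9}" for r
        using s2 that unfolding maxima_inv_def by blast
      have frt: "tmem s2 r = tmem s1 r" if "r \<notin> {3, 4}" for r
        using s2 that unfolding maxima_inv_def by blast
      have "runs B (Seq start (Seq process (Seq advance finish))) s2
        (50 + ((600 * m + 100) + ((n * (600 * m + 210) + 10) + (50 * n + 100)))) (solved x)"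
      proof (rule main_runs[OF x])
        show "loaded s2" by (rule loaded_cong[OF ld1]) (simp_all add: fr frt)
        show "nmem s2 0 2 = k" by (simp add: fr s1 pivot_input_def)
        show "nmem s2 7 i = kind_of {} i \<and> nmem s2 8 i = nmem s2 8 i \<and> nmem s2 9 i = nmem s2 9 i \<and>
            tmem s2 3 i = Fin (a i)" if "i < m" for i
          using ip(2)[OF _ rm that] kinds[of i] by (simp add: fr kind_of_def K_def a_def)
        show "tmem s2 1 j = Fin (\<xi> j)" if "j \<le> n" for j using x1 that by (simp add: frt)
      qed (simp_all add: fr frt s1 pivot_input_def)
      then show "runs B (Seq start (Seq process (Seq advance finish))) s2
        (50 + ((600 * m + 100) + ((n * (600 * m + 210) + 10) + (50 * n + 100)))) ?Q"
        by (rule runs_conseq) (simp_all add: solved_def)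
    qed
  qed
qed

lemma carrays_pivot_program: "carrays pivot_program \<subseteq> {..<13}"
  by (simp add: pivot_program_def mark_basis_def initial_maxima_def start_def process_def advance_def
      finish_def enter_def update_def update_row_def raise_row_def scan_def scan_row_def entry_def)

theorem theorem4p13:
  shows "\<exists>(P :: com) (C :: nat).
    \<forall>(m :: nat) (n :: nat) (W :: nat \<Rightarrow> nat \<Rightarrow> strop) (I :: nat set) (bas :: nat \<Rightarrow> nat)
      (x :: nat \<Rightarrow> trop) (k :: nat).
      admissible m n W \<and> basic_point m n W I x \<and> bij_betw bas {..<n} I \<and>
      k \<in> I \<and> is_trop_edge m n W (I - {k}) \<longrightarrow>
      (\<exists>t S s. exec (C * (n * m)) P (pivot_input m n W x bas k) t S s \<and>
         t \<le> C * (n * (m + n)) \<and>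
         finite S \<and> card S \<le> C * (n * m) \<and>
         output_index s < m \<and> output_index s \<notin> I \<and>
         basic_point m n W (insert (output_index s) (I - {k})) (output_point s) \<and>
         other_basic_point m n W (I - {k}) x (output_point s))"
proof (rule exI[of _ pivot_program], rule exI[of _ 10000], intro allI impI, elim conjE)
  fix m n W I bas x k
  assume adm: "admissible m n W" and bp: "basic_point m n W I x" and bas: "bij_betw bas {..<n} I"
    and k: "k \<in> I"
  have I: "I \<subseteq> {..<m}" "card I = n" using bp unfolding basic_point_def is_basis_def by auto
  have "finite I" using I finite_subset by blast
  then have "0 < card I" using k by (auto simp: card_gt_0_iff)
  \<comment> \<open>Positive dimensions let \<open>n * m\<close> absorb \<open>m\<close>,
    \<open>n\<close> and all constants.\<close>
  then have n: "1 \<le> n" and m: "1 \<le> m" using I k by auto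
  define N where "N = n * m"
  have N: "1 \<le> N" "m \<le> N" "n \<le> N" using n m unfolding N_def by simp_all
  \<comment> \<open>\<open>4 * N\<close> is enough because \<open>n + 1 \<le> 2 * n\<close>. The run
    is bounded here and not by \<open>10000 * N\<close>, since 13 arrays of two kinds cost 26 cells
    per address and the same constant has to bound the space.\<close>
  have mach: "machine (4 * N) m n"
  proof
    show "m * (n + 1) \<le> 4 * N" using N by (simp add: N_def mult.commute)
  qed (use N in simp_all)
  obtain t S s where ex: "exec (4 * N) pivot_program (pivot_input m n W x bas k) t S s"
    and t: "t \<le> (50 * n + 50) + ((Suc n * (300 * m + 100) + 50) +
      (50 + ((600 * m + 100) + ((n * (600 * m + 210) + 10) + (50 * n + 100)))))"
    and Q: "output_index s < m" "output_index s \<notin> I"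
      "basic_point m n W (insert (output_index s) (I - {k})) (output_point s)"
      "other_basic_point m n W (I - {k}) x (output_point s)"
    using pivot_program_runs[OF adm bp bas k mach] unfolding runs_def by blast
  have "exec (10000 * N) pivot_program (pivot_input m n W x bas k) t S s" using exec_mono[OF ex] by simp
  moreover have "t \<le> 10000 * (n * (m + n))"
  proof -
    \<comment> \<open>The leading term collects \<open>300\<close> per entry for the initial maxima
      and \<open>600\<close> for each update and scan during the motion.\<close>
    have "t \<le> 900 * N + 900 * m + 410 * n + 510" using t unfolding N_def by (simp add: algebra_simps)
    also have "\<dots> \<le> 10000 * N" using N by linarith
    also have "\<dots> \<le> 10000 * (n * (m + n))" unfolding N_def by simp
    finally show ?thesis .
  qed
  moreover have "S \<subseteq> cells_upto {..<13} (4 * N)" by (rule exec_cells_upto[OF ex carrays_pivot_program])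
  then have "finite S" "card S \<le> 2 * (13 * Suc (4 * N))"
    using cells_upto_lessThan[of 13 "4 * N"] finite_subset card_mono order_trans by metis+
  moreover from this have "card S \<le> 10000 * N" using N by simp
  ultimately show "\<exists>t S s. exec (10000 * (n * m)) pivot_program (pivot_input m n W x bas k) t S s \<and>
         t \<le> 10000 * (n * (m + n)) \<and> finite S \<and> card S \<le> 10000 * (n * m) \<and>
         output_index s < m \<and> output_index s \<notin> I \<and>
         basic_point m n W (insert (output_index s) (I - {k})) (output_point s) \<and>
         other_basic_point m n W (I - {k}) x (output_point s)"
    using Q unfolding N_def by blast
qed

end
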